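(* Let $E$ be a Dedekind $\sigma$-complete Banach lattice. The following assertions are equivalent: (1) $E$ is reflexive. (2) Each positive weak Dunford–Pettis operator from $E$ into $E$ is uaw-Dunford–Pettis.
   Context: All operators are continuous linear operators. A net $(x_\alpha)$ in a Banach lattice $E$ is uaw-convergent to $x$ (written $x_\alpha\xrightarrow{uaw}x$) if $|x_\alpha-x|\wedge u\to 0$ weakly for every $u\in E_+$. An operator $T$ from a Banach lattice $E$ into a Banach space $X$ is uaw-Dunford–Pettis if for every norm bounded sequence $(x_n)$ in $E$ with $x_n\xrightarrow{uaw}0$ one has $\|Tx_n\|\to 0$. An operator $T:X\to Y$ between Banach spaces is weak Dunford–Pettis if $f_n(Tx_n)\to 0$ for every weakly null sequence $(x_n)$ in $X$ and every weakly null sequence $(f_n)$ in $Y'$. *)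

theory Defs
  imports "HOL-Analysis.Analysis"
begin

class banach_lattice = banach + ordered_real_vector + lattice +
  assumes norm_lattice_mono: "sup x (- x) \<le> sup y (- y) \<Longrightarrow> norm x \<le> norm y"

definition labs :: "'a::banach_lattice \<Rightarrow> 'a" where
  "labs x = sup x (- x)"

definition dedekind_sigma_complete :: "'a::banach_lattice itself \<Rightarrow> bool" where
  "dedekind_sigma_complete _ \<longleftrightarrow>
     (\<forall>A::'a set. countable A \<and> A \<noteq> {} \<and> bdd_above A \<longrightarrow>
        (\<exists>s. (\<forall>a\<in>A. a \<le> s) \<and> (\<forall>b. (\<forall>a\<in>A. a \<le> b) \<longrightarrow> s \<le> b)))"

definition reflexive :: "'a::real_normed_vector itself \<Rightarrow> bool" where
  "reflexive _ \<longleftrightarrow>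
     (\<forall>\<Phi> :: ('a \<Rightarrow>\<^sub>L real) \<Rightarrow>\<^sub>L real. \<exists>x::'a. \<forall>f. blinfun_apply \<Phi> f = blinfun_apply f x)"

definition weakly_null :: "(nat \<Rightarrow> 'a::real_normed_vector) \<Rightarrow> bool" where
  "weakly_null x \<longleftrightarrow> (\<forall>f :: 'a \<Rightarrow>\<^sub>L real. (\<lambda>n. blinfun_apply f (x n)) \<longlonglongrightarrow> 0)"

definition uaw_null :: "(nat \<Rightarrow> 'a::banach_lattice) \<Rightarrow> bool" where
  "uaw_null x \<longleftrightarrow> (\<forall>u. 0 \<le> u \<longrightarrow> weakly_null (\<lambda>n. inf (labs (x n)) u))"

definition positive_op :: "('a::banach_lattice \<Rightarrow>\<^sub>L 'b::banach_lattice) \<Rightarrow> bool" where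
  "positive_op T \<longleftrightarrow> (\<forall>x. 0 \<le> x \<longrightarrow> 0 \<le> blinfun_apply T x)"

definition weak_DP :: "('a::real_normed_vector \<Rightarrow>\<^sub>L 'b::real_normed_vector) \<Rightarrow> bool" where
  "weak_DP T \<longleftrightarrow>
     (\<forall>(x :: nat \<Rightarrow> 'a) (f :: nat \<Rightarrow> ('b \<Rightarrow>\<^sub>L real)).
        weakly_null x \<and> weakly_null f \<longrightarrow> (\<lambda>n. blinfun_apply (f n) (blinfun_apply T (x n))) \<longlonglongrightarrow> 0)"

definition uaw_DP :: "('a::banach_lattice \<Rightarrow>\<^sub>L 'b::real_normed_vector) \<Rightarrow> bool" where
  "uaw_DP T \<longleftrightarrow>
     (\<forall>x :: nat \<Rightarrow> 'a. bounded (range x) \<and> uaw_null x \<longrightarrow> (\<lambda>n. norm (blinfun_apply T (x n))) \<longlonglongrightarrow> 0)"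

end

theory Submission
  imports Defs "HOL-Library.Lattice_Algebras" "HOL-Library.Diagonal_Subsequence"
begin

text \<open>
  If \<open>E\<close> is reflexive, a bounded disjoint positive sequence has only \<open>0\<close> as weak cluster point, so
  bounded uaw-null sequences have weakly null moduli; and a weak Dunford--Pettis operator on a
  reflexive space maps weakly null sequences to norm null ones, because norming functionals of the
  images have weakly convergent subsequences.

  Conversely, (2) is tested on three kinds of positive weak Dunford--Pettis operators. Rank one
  operators \<open>f \<otimes> e\<close> show that positive functionals tend to \<open>0\<close> along bounded disjoint sequences, i.e.
  that they are almost order bounded on the unit ball. Operators \<open>x \<mapsto> sup\<^sub>N (\<Sum>n<N. \<phi>\<^sub>n x d\<^sub>n)\<close> factoring
  through \<open>\<ell>\<^sub>\<infinity>\<close>, which are weak Dunford--Pettis by the Dunford--Pettis property of \<open>\<ell>\<^sub>\<infinity>\<close>, show that order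
  bounded increasing sequences converge. Operators \<open>x \<mapsto> \<Sum>n. \<phi>\<^sub>n x v\<^sub>n\<close> factoring through \<open>c\<^sub>0\<close>, which are
  weak Dunford--Pettis by the Schur property of \<open>\<ell>\<^sub>1\<close>, show the same for norm bounded ones.

  If such an \<open>E\<close> were not reflexive, James's sequences \<open>x\<^sub>k\<close>, \<open>f\<^sub>n\<close> would exist. A Hilbert space
  argument for the seminorms \<open>F (a\<^sup>2 / u)\<close>, where \<open>F = \<Sum>n. 2\<^sup>-\<^sup>n \<bar>f\<^sub>n\<bar>\<close>, yields forward convex combinations of
  \<open>x\<^sub>k\<close> that are Cauchy for \<open>F\<close>; their limit in \<open>E\<close> contradicts the separation of the James sequences.
\<close>

section \<open>Banach lattices\<close>

text \<open>The classical route to reflexivity (Ogasawara) exhibits the lattice as a band in its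
  bidual. Here everything is compared with one positive functional \<open>F\<close>, without
  building L1(F): weak compactness there is replaced by minimising quadratic seminorms. These make
  sense on order intervals only, which is why almost order boundedness is needed: it clips the ball
  to an order interval up to a small \<open>F\<close>-error. Clipping does not commute with convex
  combinations, so all clipped copies of \<open>x k\<close> travel as components of one vector and
  share their coefficients.

  The limit \<open>Z\<close> satisfies \<open>\<theta> \<le> f j Z\<close> for every
  \<open>j\<close>, whereas a convex combination \<open>z\<close> of the \<open>x k\<close> has
  \<open>f n z \<le> \<theta> / 4\<close> only from an \<open>n\<close> on that depends on
  \<open>z\<close>. So \<open>z\<close> must be close to \<open>Z\<close> uniformly in
  \<open>j\<close>. The norm is too fine for this, since a functional dominated by it need not be
  controlled by \<open>F\<close>. The supremum \<open>q\<close> of the moduli of the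
  \<open>f j\<close> is coarse enough: a functional below \<open>q\<close> has a modulus that
  vanishes where \<open>F\<close> does, so it sees the convergence to \<open>Z\<close>, and
  separation applies.\<close>

context banach_lattice
begin
subclass lattice_ab_group_add ..
end

declare diff_inf_eq_sup [simp del] diff_sup_eq_inf [simp del] neg_inf_eq_sup [simp del] neg_sup_eq_inf [simp del]

lemma labs_eq: "labs x = pprt x + pprt (- x)"
proof -
  have "pprt x + pprt (- x) = sup (x + pprt (-x)) (pprt (-x))"
    by (simp add: pprt_def add_sup_distrib_right)
  also have "\<dots> = sup (sup 0 x) (sup (-x) 0)"
    by (simp add: pprt_def add_sup_distrib_left)
  also have "\<dots> = sup (labs x) 0"
    by (simp add: labs_def ac_simps sup.left_commute)
  finally have *: "pprt x + pprt (- x) = sup (labs x) 0" .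
  have "0 \<le> labs x"
  proof -
    have "x + - x \<le> labs x + labs x" unfolding labs_def by (rule add_mono) auto
    then show ?thesis by simp
  qed
  then show ?thesis using * by (simp add: sup_absorb1)
qed

lemma labs_nonneg [simp]: "0 \<le> labs x"
  by (simp add: labs_eq)

lemma labs_uminus [simp]: "labs (- x) = labs x"
  by (simp add: labs_def sup_commute)

lemma le_labs: "x \<le> labs x" and neg_le_labs: "- x \<le> labs x"
  by (auto simp: labs_def)

lemma labs_leI: "x \<le> y \<Longrightarrow> - x \<le> y \<Longrightarrow> labs x \<le> y"
  by (simp add: labs_def)

lemma labs_le_iff: "labs x \<le> y \<longleftrightarrow> x \<le> y \<and> - x \<le> y"
  by (simp add: labs_def)

lemma labs_of_nonneg [simp]: "0 \<le> x \<Longrightarrow> labs x = x"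
  unfolding labs_def by (rule sup_absorb1) (metis neg_le_0_iff_le order_trans)

lemma pprt_minus_pprt: "pprt x - pprt (- x) = x"
  using prts[of x] pprt_neg[of x] by simp

lemma pprt_le_labs: "pprt x \<le> labs x"
  by (simp add: labs_eq)

lemma pprt_le_iff: "pprt x \<le> y \<longleftrightarrow> x \<le> y \<and> 0 \<le> y"
  by (simp add: pprt_def)

lemma le_pprt: "x \<le> pprt x"
  by (simp add: pprt_def)

lemma labs_triangle: "labs (x + y) \<le> labs x + labs y"
proof (rule labs_leI)
  show "- (x + y) \<le> labs x + labs y"
    using add_mono[OF neg_le_labs[of x] neg_le_labs[of y]] by simp
qed (rule add_mono[OF le_labs le_labs])

lemma labs_triangle_diff: "labs (x - y) \<le> labs x + labs y"
  using labs_triangle[of x "- y"] by simp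

lemma labs_commute: "labs (x - y) = labs (y - x)"
  by (metis labs_uminus minus_diff_eq)

lemma labs_sum: "labs (\<Sum>i\<in>A. f i) \<le> (\<Sum>i\<in>A. labs (f i))"
proof (induction A rule: infinite_finite_induct)
  case (insert x A)
  then show ?case
    by (simp add: order_trans[OF labs_triangle])
qed auto

lemma scaleR_sup: "0 \<le> c \<Longrightarrow> c *\<^sub>R sup x y = sup (c *\<^sub>R x) (c *\<^sub>R (y::'a::banach_lattice))"
proof (cases "c = 0")
  case False
  assume "0 \<le> c"
  with False have c: "c > 0" by simp
  show ?thesis
  proof (rule antisym)
    have "sup x y \<le> inverse c *\<^sub>R sup (c *\<^sub>R x) (c *\<^sub>R y)"
    proof (rule sup_least)
      show "x \<le> inverse c *\<^sub>R sup (c *\<^sub>R x) (c *\<^sub>R y)"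
        using scaleR_left_mono[of "c *\<^sub>R x" "sup (c *\<^sub>R x) (c *\<^sub>R y)" "inverse c"] c by simp
      show "y \<le> inverse c *\<^sub>R sup (c *\<^sub>R x) (c *\<^sub>R y)"
        using scaleR_left_mono[of "c *\<^sub>R y" "sup (c *\<^sub>R x) (c *\<^sub>R y)" "inverse c"] c by simp
    qed
    from scaleR_left_mono[OF this, of c] c show "c *\<^sub>R sup x y \<le> sup (c *\<^sub>R x) (c *\<^sub>R y)" by simp
  qed (use c in \<open>auto intro!: sup_least scaleR_left_mono\<close>)
qed simp

lemma scaleR_inf: "0 \<le> c \<Longrightarrow> c *\<^sub>R inf x y = inf (c *\<^sub>R x) (c *\<^sub>R (y::'a::banach_lattice))"
  using scaleR_sup[of c "-x" "-y"] by (simp add: inf_eq_neg_sup)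

lemma pprt_scaleR: "0 \<le> c \<Longrightarrow> pprt (c *\<^sub>R x) = c *\<^sub>R pprt (x::'a::banach_lattice)"
  by (simp add: pprt_def scaleR_sup)

lemma labs_scaleR: "labs (c *\<^sub>R x) = \<bar>c\<bar> *\<^sub>R labs x"
proof (cases "0 \<le> c")
  case True
  then show ?thesis by (simp add: labs_def scaleR_sup)
next
  case False
  then have "labs (c *\<^sub>R x) = labs ((- c) *\<^sub>R x)" by (metis labs_uminus scaleR_minus_left)
  also have "\<dots> = (- c) *\<^sub>R labs x"
    using False by (simp only: labs_def scaleR_sup[of "- c"] scaleR_minus_right)
  finally show ?thesis using False by simp
qed

lemma norm_mono_labs: "labs x \<le> labs y \<Longrightarrow> norm x \<le> norm y"
  by (simp add: labs_def norm_lattice_mono)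

lemma norm_labs [simp]: "norm (labs x) = norm x"
  by (intro antisym norm_mono_labs) auto

lemma norm_mono_nonneg: "0 \<le> x \<Longrightarrow> x \<le> y \<Longrightarrow> norm x \<le> norm (y::'a::banach_lattice)"
  by (rule norm_mono_labs) (use order_trans in auto)

lemma norm_le_of_labs_le: "labs x \<le> y \<Longrightarrow> norm x \<le> norm y"
  using norm_mono_nonneg[of "labs x" y] by simp

lemma norm_pprt_le: "norm (pprt x) \<le> norm (x::'a::banach_lattice)"
  by (rule norm_mono_labs) (simp add: pprt_le_labs)

text \<open>Both \<open>x\<close> and \<open>z\<close> lie below
  \<open>sup y z + labs (x - y)\<close>. Lattice operations are thus nonexpansive, and the
  continuity of \<open>pprt\<close> and \<open>inf\<close> rests on this.\<close>

lemma sup_diff_labs: "labs (sup x z - sup y z) \<le> labs (x - y)"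
proof (rule labs_leI)
  have *: "sup x z - sup y z \<le> labs (x - y)" for x y z :: 'a
  proof -
    have "x \<le> sup y z + labs (x - y)"
      using add_mono[OF sup_ge1[of y z] le_labs[of "x - y"]] by simp
    moreover have "z \<le> sup y z + labs (x - y)"
      using add_mono[OF sup_ge2[of z y] labs_nonneg[of "x - y"]] by simp
    ultimately show ?thesis by (simp add: diff_le_eq add.commute)
  qed
  show "sup x z - sup y z \<le> labs (x - y)" by (rule *)
  show "- (sup x z - sup y z) \<le> labs (x - y)" using *[of y z x] by (simp add: labs_commute)
qed

lemma inf_diff_labs: "labs (inf x z - inf y z) \<le> labs (x - y)"
proof -
  have "inf x z - inf y z = - (sup (-x) (-z) - sup (-y) (-z))"
    by (simp add: inf_eq_neg_sup)
  then have "labs (inf x z - inf y z) = labs (sup (-x) (-z) - sup (-y) (-z))"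
    by (metis labs_uminus)
  also have "\<dots> \<le> labs (- x - - y)" by (rule sup_diff_labs)
  finally show ?thesis by (simp add: labs_commute)
qed

lemma pprt_diff_labs: "labs (pprt x - pprt y) \<le> labs (x - y)"
  unfolding pprt_def by (rule sup_diff_labs)

lemma tendsto_of_labs_le:
  fixes f :: "'b \<Rightarrow> 'a::banach_lattice" and g :: "'b \<Rightarrow> 'c::banach_lattice"
  assumes "(f \<longlongrightarrow> a) F" and "\<And>x. norm (h x - b) \<le> norm (f x - a)"
  shows "(h \<longlongrightarrow> (b::'c)) F"
proof -
  have "((\<lambda>x. norm (f x - a)) \<longlongrightarrow> 0) F" using assms(1) by (simp add: LIM_zero tendsto_norm_zero)
  then have "((\<lambda>x. h x - b) \<longlongrightarrow> 0) F"
    by (rule Lim_null_comparison[rotated]) (simp add: assms(2))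
  then show ?thesis by (rule LIM_zero_cancel)
qed

lemma tendsto_pprt: "(f \<longlongrightarrow> a) F \<Longrightarrow> ((\<lambda>x. pprt (f x)) \<longlongrightarrow> pprt (a::'a::banach_lattice)) F"
  by (rule tendsto_of_labs_le) (auto intro: norm_mono_labs pprt_diff_labs)

lemma tendsto_inf_const: "(f \<longlongrightarrow> a) F \<Longrightarrow> ((\<lambda>x. inf (f x) c) \<longlongrightarrow> inf a (c::'a::banach_lattice)) F"
  by (rule tendsto_of_labs_le) (auto intro: norm_mono_labs inf_diff_labs)

lemma nonneg_iff_pprt: "0 \<le> (x::'a::banach_lattice) \<longleftrightarrow> pprt (- x) = 0"
  using pprt_neg[of x] zero_le_iff_zero_nprt[of x] by simp

text \<open>The positive cone is the zero set of the continuous map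
  \<open>\<lambda>x. pprt (- x)\<close>, hence closed; order relations therefore survive norm
  limits.\<close>

lemma nonneg_limit:
  fixes f :: "'b \<Rightarrow> 'a::banach_lattice"
  assumes "(f \<longlongrightarrow> a) F" "F \<noteq> bot" "eventually (\<lambda>x. 0 \<le> f x) F"
  shows "0 \<le> a"
proof -
  have "((\<lambda>x. pprt (- f x)) \<longlongrightarrow> pprt (- a)) F"
    by (intro tendsto_pprt tendsto_minus assms)
  moreover have "((\<lambda>x. pprt (- f x)) \<longlongrightarrow> 0) F"
    by (rule tendsto_eventually, rule eventually_mono[OF assms(3)]) (metis nonneg_iff_pprt)
  ultimately have "pprt (- a) = 0" using tendsto_unique assms(2) by blast
  then show ?thesis by (metis nonneg_iff_pprt)
qed

lemma limit_mono:
  fixes f g :: "nat \<Rightarrow> 'a::banach_lattice"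
  assumes "f \<longlonglongrightarrow> a" "g \<longlonglongrightarrow> b" "\<And>n. n \<ge> N \<Longrightarrow> f n \<le> g n"
  shows "a \<le> b"
proof -
  have "0 \<le> b - a"
    by (rule nonneg_limit[OF tendsto_diff[OF assms(2,1)]])
      (use assms(3) in \<open>auto simp: eventually_sequentially\<close>)
  then show ?thesis by simp
qed

lemma limit_ge_const:
  fixes f :: "nat \<Rightarrow> 'a::banach_lattice"
  shows "f \<longlonglongrightarrow> a \<Longrightarrow> (\<And>n. n \<ge> N \<Longrightarrow> c \<le> f n) \<Longrightarrow> c \<le> a"
  using limit_mono[OF tendsto_const] .

lemma limit_le_const:
  fixes f :: "nat \<Rightarrow> 'a::banach_lattice"
  shows "f \<longlonglongrightarrow> a \<Longrightarrow> (\<And>n. n \<ge> N \<Longrightarrow> f n \<le> c) \<Longrightarrow> a \<le> c"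
  using limit_mono[OF _ tendsto_const] .

section \<open>Disjoint elements\<close>

lemma inf_add_le:
  fixes a b c :: "'a::banach_lattice"
  assumes "0 \<le> a" "0 \<le> b" "0 \<le> c"
  shows "inf (a + b) c \<le> inf a c + inf b c"
proof -
  let ?m = "inf (a + b) c"
  have "?m \<le> a + inf b c"
    unfolding add_inf_distrib_left using assms(1)
    by (meson add_increasing inf.cobounded1 inf.cobounded2 inf.orderI le_infI order_refl)
  moreover have "?m \<le> c + inf b c"
    using assms by (meson add_increasing2 inf.cobounded2 le_infI order_trans)
  ultimately show ?thesis
    by (simp add: add_inf_distrib_right)
qed

lemma diff_inf_eq_pprt: "x - inf x u = pprt (x - u)"
  by (simp add: diff_inf_eq_sup pprt_def add_sup_distrib_left sup_commute)

lemma inf_nonneg: "0 \<le> x \<Longrightarrow> 0 \<le> y \<Longrightarrow> 0 \<le> inf x (y::'a::banach_lattice)"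
  by simp

lemma inf_zero_sum:
  fixes v :: "'a::banach_lattice"
  assumes "finite A" "\<And>i. i \<in> A \<Longrightarrow> 0 \<le> x i" "0 \<le> v" "\<And>i. i \<in> A \<Longrightarrow> inf (x i) v = 0"
  shows "inf (\<Sum>i\<in>A. x i) v = 0"
  using assms
proof (induction A rule: finite_induct)
  case (insert a A)
  have "inf (x a + (\<Sum>i\<in>A. x i)) v \<le> inf (x a) v + inf (\<Sum>i\<in>A. x i) v"
    using insert by (intro inf_add_le sum_nonneg) auto
  also have "\<dots> = 0" using insert by simp
  finally show ?case using insert by (auto intro!: antisym add_nonneg_nonneg sum_nonneg)
qed (simp add: inf_absorb1)

lemma add_eq_sup_of_disjoint: "inf a b = 0 \<Longrightarrow> a + b = sup a (b::'a::banach_lattice)"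
  using add_eq_inf_sup[of a b] by simp

text \<open>Disjointness turns each sum into a supremum, so the bound of the single terms bounds the
  sum.\<close>

lemma disjoint_sum_le:
  fixes x :: "nat \<Rightarrow> 'a::banach_lattice"
  assumes "\<And>n. 0 \<le> x n" "\<And>n. x n \<le> u" "\<And>n m. n \<noteq> m \<Longrightarrow> inf (x n) (x m) = 0"
  shows "(\<Sum>n<N. x n) \<le> u"
proof (induction N)
  case 0
  then show ?case using order_trans[OF assms(1,2)] by simp
next
  case (Suc N)
  have "inf (\<Sum>n<N. x n) (x N) = 0"
    using assms by (intro inf_zero_sum) auto
  then have "(\<Sum>n<N. x n) + x N = sup (\<Sum>n<N. x n) (x N)" by (rule add_eq_sup_of_disjoint)
  then show ?case using Suc assms(2) by simp
qed

lemma pprt_disjoint: "inf (pprt x) (pprt (- x)) = (0::'a::banach_lattice)"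
proof -
  have "inf (pprt x) (pprt (- x)) = pprt (-x) + inf (pprt x - pprt (-x)) 0"
    by (simp add: add_inf_distrib_left)
  also have "\<dots> = pprt (-x) + nprt x" by (simp add: pprt_minus_pprt nprt_def)
  also have "\<dots> = 0" by (simp add: pprt_neg)
  finally show ?thesis .
qed

lemma disjoint_mono:
  fixes a :: "'a::banach_lattice"
  assumes "0 \<le> a'" "a' \<le> a" "0 \<le> b'" "b' \<le> b" "inf a b = 0"
  shows "inf a' b' = 0"
  using assms by (metis inf.mono inf_nonneg antisym)

lemma disjoint_scaleR:
  fixes a :: "'a::banach_lattice"
  assumes "0 \<le> a" "0 \<le> b" "inf a b = 0" "0 \<le> c" "0 \<le> d"
  shows "inf (c *\<^sub>R a) (d *\<^sub>R b) = 0"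
proof -
  let ?m = "max c d"
  have "inf (?m *\<^sub>R a) (?m *\<^sub>R b) = 0" using assms by (simp add: scaleR_inf[symmetric])
  moreover have "c *\<^sub>R a \<le> ?m *\<^sub>R a" "d *\<^sub>R b \<le> ?m *\<^sub>R b" "0 \<le> c *\<^sub>R a" "0 \<le> d *\<^sub>R b"
    using assms by (auto intro!: scaleR_right_mono scaleR_nonneg_nonneg)
  ultimately show ?thesis by (metis disjoint_mono)
qed

lemma diff_diff_le:
  fixes a :: "'a::ordered_ab_group_add"
  assumes "c \<le> s" "0 \<le> w"
  shows "a - s - w \<le> a - c"
  using add_mono[OF assms] by (simp add: diff_diff_add diff_left_mono)

lemma diff_diff_le':
  fixes a :: "'a::ordered_ab_group_add"
  assumes "0 \<le> s" "c \<le> w"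
  shows "a - s - w \<le> a - c"
  using add_mono[OF assms] by (simp add: diff_diff_add diff_left_mono)

text \<open>Disjointification: the weight of each earlier term inside \<open>v n\<close> grows fast enough, and each
  later term is subtracted through \<open>w\<close>, so that any two \<open>v\<close>'s sit below the positive and the
  negative part of a common element.\<close>

lemma disjointification:
  fixes x :: "nat \<Rightarrow> 'a::banach_lattice"
  assumes pos: "\<And>n. 0 \<le> x n" and bd: "\<And>n. norm (x n) \<le> C"
  defines "w \<equiv> (\<Sum>j. (1/2)^j *\<^sub>R x j)"
  defines "v \<equiv> \<lambda>n. pprt (x n - (4^n) *\<^sub>R (\<Sum>j<n. x j) - (1/2)^n *\<^sub>R w)"
  shows "0 \<le> w" "\<And>n. 0 \<le> v n" "\<And>n. v n \<le> x n" "\<And>n m. n \<noteq> m \<Longrightarrow> inf (v n) (v m) = 0"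
proof -
  have summ: "summable (\<lambda>j. (1/2)^j *\<^sub>R x j)"
  proof (rule summable_comparison_test')
    show "summable (\<lambda>j. (1/2)^j * C)" by (intro summable_mult2 summable_geometric) simp
    show "norm ((1/2)^j *\<^sub>R x j) \<le> (1/2)^j * C" if "0 \<le> j" for j
      using bd[of j] by (simp add: mult_left_mono)
  qed
  have le_w: "(1/2)^m *\<^sub>R x m \<le> w" for m
  proof -
    have "(\<lambda>n. \<Sum>j<n. (1/2)^j *\<^sub>R x j) \<longlonglongrightarrow> w"
      unfolding w_def using summ by (rule summable_LIMSEQ)
    then show ?thesis
    proof (rule limit_ge_const[where N="Suc m"])
      fix n assume "Suc m \<le> n"
      then have "(\<Sum>j\<in>{m}. (1/2)^j *\<^sub>R x j) \<le> (\<Sum>j<n. (1/2)^j *\<^sub>R x j)"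
        using pos by (intro sum_mono2) (auto intro!: scaleR_nonneg_nonneg)
      then show "(1/2)^m *\<^sub>R x m \<le> (\<Sum>j<n. (1/2)^j *\<^sub>R x j)" by simp
    qed
  qed
  show w0: "0 \<le> w" using le_w[of 0] pos[of 0] by (simp add: order_trans)
  show "0 \<le> v n" for n by (simp add: v_def)
  have s0: "0 \<le> (\<Sum>j<n. x j)" for n using pos by (simp add: sum_nonneg)
  show "v n \<le> x n" for n
    using diff_diff_le[of 0 "4^n *\<^sub>R (\<Sum>j<n. x j)" "(1/2)^n *\<^sub>R w" "x n"] pos[of n] s0[of n] w0
    unfolding v_def pprt_le_iff by (simp add: scaleR_nonneg_nonneg)
  have *: "inf (v n) (v m) = 0" if "n < m" for n m
  proof -
    let ?y = "x m - 4^m *\<^sub>R x n"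
    have "x n \<le> (\<Sum>j<m. x j)"
      using sum_mono2[of "{..<m}" "{n}" x] pos that by auto
    then have "4^m *\<^sub>R x n \<le> 4^m *\<^sub>R (\<Sum>j<m. x j)" by (intro scaleR_left_mono) auto
    then have "x m - (4^m) *\<^sub>R (\<Sum>j<m. x j) - (1/2)^m *\<^sub>R w \<le> ?y"
      by (rule diff_diff_le) (intro scaleR_nonneg_nonneg w0, simp)
    then have 1: "v m \<le> pprt ?y" unfolding v_def by (rule pprt_mono)
    \<comment> \<open>This is where \<open>4^m\<close> comes from: \<open>v n\<close> lost a share
      \<open>(1/2)^n\<close> of \<open>w\<close>, and \<open>w\<close> contains a share
      \<open>(1/2)^m\<close> of \<open>x m\<close>; as \<open>n < m\<close>, the product of the two
      dominates \<open>(1/4)^m\<close>.\<close>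
    have "(1/4)^m *\<^sub>R x m \<le> ((1/2)^n * (1/2)^m) *\<^sub>R x m"
    proof (rule scaleR_right_mono)
      have "(1/4::real)^m = (1/2)^m * (1/2)^m" by (simp add: power_mult_distrib[symmetric])
      also have "\<dots> \<le> (1/2)^n * (1/2)^m" using that by (intro mult_right_mono power_decreasing) auto
      finally show "(1/4::real)^m \<le> (1/2)^n * (1/2)^m" .
    qed (rule pos)
    also have "\<dots> \<le> (1/2)^n *\<^sub>R w"
      using scaleR_left_mono[OF le_w[of m], of "(1/2)^n"] by simp
    finally have "(1/4)^m *\<^sub>R x m \<le> (1/2)^n *\<^sub>R w" .
    then have "x n - (4^n) *\<^sub>R (\<Sum>j<n. x j) - (1/2)^n *\<^sub>R w \<le> x n - (1/4)^m *\<^sub>R x m"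
      by (rule diff_diff_le'[rotated]) (auto intro!: scaleR_nonneg_nonneg s0)
    also have "\<dots> = (1/4)^m *\<^sub>R (- ?y)"
      by (simp add: scaleR_diff_right power_mult_distrib[symmetric])
    finally have 2: "v n \<le> (1/4)^m *\<^sub>R pprt (- ?y)"
      unfolding v_def by (simp add: pprt_scaleR[symmetric] pprt_mono)
    have "inf (1 *\<^sub>R pprt ?y) ((1/4)^m *\<^sub>R pprt (- ?y)) = 0"
      by (intro disjoint_scaleR pprt_disjoint zero_le_pprt) auto
    then have "inf (pprt ?y) ((1/4)^m *\<^sub>R pprt (- ?y)) = 0" by simp
    from disjoint_mono[OF _ 1 _ 2 this] show ?thesis by (simp add: v_def inf_commute)
  qed
  show "inf (v n) (v m) = 0" if "n \<noteq> m" for n m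
    using that *[of n m] *[of m n] by (metis inf_commute linorder_neqE_nat)
qed

section \<open>The Hahn--Banach theorem\<close>

definition sublinear :: "('v::real_vector \<Rightarrow> real) \<Rightarrow> bool" where
  "sublinear p \<longleftrightarrow> (\<forall>x y. p (x + y) \<le> p x + p y) \<and> (\<forall>c x. 0 \<le> c \<longrightarrow> p (c *\<^sub>R x) = c * p x)"

lemma sublinearD:
  assumes "sublinear p"
  shows "p (x + y) \<le> p x + p y" "0 \<le> c \<Longrightarrow> p (c *\<^sub>R x) = c * p x" "p 0 = 0" "- p (- x) \<le> p x"
proof -
  show 1: "p (x + y) \<le> p x + p y" for x y using assms by (simp add: sublinear_def)
  show 2: "0 \<le> c \<Longrightarrow> p (c *\<^sub>R x) = c * p x" for c x using assms by (simp add: sublinear_def)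
  show 3: "p 0 = 0" using 2[of 0 0] by simp
  show "- p (- x) \<le> p x" using 1[of x "-x"] 3 by simp
qed

text \<open>The reverse inequality for \<open>c\<close> is the given one for
  \<open>inverse c\<close>.\<close>

lemma sublinearI:
  assumes "\<And>x y. p (x + y) \<le> p x + p y" "p 0 = 0" "\<And>c x. 0 < c \<Longrightarrow> p (c *\<^sub>R x) \<le> c * p x"
  shows "sublinear p"
proof -
  have "p (c *\<^sub>R x) = c * p x" if "0 \<le> c" for c x
  proof (cases "c = 0")
    case False
    with that have c: "0 < c" by simp
    have "p x \<le> inverse c * p (c *\<^sub>R x)" using assms(3)[of "inverse c" "c *\<^sub>R x"] c by simp
    then have "c * p x \<le> p (c *\<^sub>R x)" using c by (simp add: field_simps)
    then show ?thesis using assms(3)[OF c, of x] by simp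
  qed (simp add: assms)
  then show ?thesis using assms by (simp add: sublinear_def)
qed

text \<open>A pair \<open>(g, s)\<close> stands for the constraint \<open>s \<le> f g\<close> on a
  functional \<open>f\<close> to be found; constraints of this form may be added and scaled.\<close>

definition real_cone :: "('v::real_vector \<times> real) set \<Rightarrow> bool" where
  "real_cone K \<longleftrightarrow> (0, 0) \<in> K \<and> (\<forall>g s g' s'. (g, s) \<in> K \<longrightarrow> (g', s') \<in> K \<longrightarrow> (g + g', s + s') \<in> K)
     \<and> (\<forall>c g s. 0 < c \<longrightarrow> (g, s) \<in> K \<longrightarrow> (c *\<^sub>R g, c * s) \<in> K)"

text \<open>The witness \<open>r x\<close> is the infimum of \<open>p (x + g) - s\<close> over all
  constraints. A linear \<open>f\<close> below \<open>r\<close> obeys every constraint, since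
  \<open>f (- g) \<le> r (- g) \<le> - s\<close>; the constrained Hahn-Banach theorem thus reduces
  to the plain one.\<close>

lemma sublinear_reduce:
  assumes p: "sublinear p" and K: "real_cone K" and le: "\<And>g s. (g, s) \<in> K \<Longrightarrow> s \<le> p g"
  obtains r where "sublinear r" "\<And>x. r x \<le> p x" "\<And>g s. (g, s) \<in> K \<Longrightarrow> r (- g) \<le> - s"
proof -
  define S where "S x = (\<lambda>(g, s). p (x + g) - s) ` K" for x
  define r where "r x = Inf (S x)" for x
  have K0: "(0, 0) \<in> K" and Ka: "\<And>g s g' s'. (g, s) \<in> K \<Longrightarrow> (g', s') \<in> K \<Longrightarrow> (g + g', s + s') \<in> K"
    and Kc: "\<And>c g s. 0 < c \<Longrightarrow> (g, s) \<in> K \<Longrightarrow> (c *\<^sub>R g, c * s) \<in> K"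
    using K unfolding real_cone_def by blast+
  have lb: "- p (- x) \<le> t" if "t \<in> S x" for x t
  proof -
    from that obtain g s where gs: "(g, s) \<in> K" "t = p (x + g) - s" by (auto simp: S_def)
    have "p g \<le> p (x + g) + p (- x)" using sublinearD(1)[OF p, of "x + g" "- x"] by simp
    with le[OF gs(1)] gs(2) show ?thesis by simp
  qed
  have bdd: "bdd_below (S x)" for x using lb by (meson bdd_below.I)
  have ne: "S x \<noteq> {}" for x using K0 by (auto simp: S_def)
  have up: "r x \<le> p (x + g) - s" if "(g, s) \<in> K" for x g s
    unfolding r_def by (rule cInf_lower[OF _ bdd]) (use that in \<open>force simp: S_def\<close>)
  have low: "b \<le> r x" if "\<And>g s. (g, s) \<in> K \<Longrightarrow> b \<le> p (x + g) - s" for b x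
    unfolding r_def by (rule cInf_greatest[OF ne]) (use that in \<open>auto simp: S_def\<close>)
  have rp: "r x \<le> p x" for x using up[OF K0] by simp
  have "sublinear r"
  proof (rule sublinearI)
    fix x y
    have "r (x + y) - r x \<le> r y"
    proof (rule low)
      fix g' s' assume 1: "(g', s') \<in> K"
      have "r (x + y) - (p (y + g') - s') \<le> r x"
      proof (rule low)
        fix g s assume 2: "(g, s) \<in> K"
        have "r (x + y) \<le> p (x + y + (g + g')) - (s + s')" by (rule up[OF Ka[OF 2 1]])
        also have "x + y + (g + g') = (x + g) + (y + g')" by simp
        also have "p \<dots> \<le> p (x + g) + p (y + g')" by (rule sublinearD(1)[OF p])
        finally show "r (x + y) - (p (y + g') - s') \<le> p (x + g) - s" by simp
      qed
      then show "r (x + y) - r x \<le> p (y + g') - s'" by simp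
    qed
    then show "r (x + y) \<le> r x + r y" by simp
  next
    have "0 \<le> r 0" using le sublinearD[OF p] by (intro low) auto
    then show "r 0 = 0" using rp[of 0] sublinearD(3)[OF p] by simp
  next
    fix c :: real and x assume c: "0 < c"
    have "inverse c * r (c *\<^sub>R x) \<le> r x"
    proof (rule low)
      fix g s assume 1: "(g, s) \<in> K"
      have "r (c *\<^sub>R x) \<le> p (c *\<^sub>R x + c *\<^sub>R g) - c * s" by (rule up[OF Kc[OF c 1]])
      also have "\<dots> = c * (p (x + g) - s)"
        using sublinearD(2)[OF p, of c "x + g"] c by (simp add: scaleR_add_right algebra_simps)
      finally show "inverse c * r (c *\<^sub>R x) \<le> p (x + g) - s" using c by (simp add: field_simps)
    qed
    then show "r (c *\<^sub>R x) \<le> c * r x" using c by (simp add: field_simps)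
  qed
  moreover have "r (- g) \<le> - s" if "(g, s) \<in> K" for g s
    using up[OF that, of "- g"] sublinearD(3)[OF p] by simp
  ultimately show thesis using that rp by blast
qed

text \<open>Zorn's lemma for the reversed pointwise order. The infimum of a chain stays finite
  because every sublinear \<open>q\<close> below \<open>p\<close> satisfies
  \<open>- p (- x) \<le> q x\<close>.\<close>

lemma minimal_sublinear:
  assumes p: "sublinear (p :: 'v::real_vector \<Rightarrow> real)"
  obtains q where "sublinear q" "\<And>x. q x \<le> p x" "\<And>q'. sublinear q' \<Longrightarrow> (\<And>x. q' x \<le> q x) \<Longrightarrow> q' = q"
proof -
  define A where "A = {q. sublinear q \<and> q \<le> p}"
  have "\<exists>m\<in>A. \<forall>a\<in>A. a \<le> m \<longrightarrow> a = m"
  proof (rule predicate_Zorn)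
    show "partial_order_on A (relation_of (\<lambda>x y. y \<le> x) A)"
      by (rule partial_order_on_relation_ofI) auto
  next
    fix C assume C: "C \<in> Chains (relation_of (\<lambda>x y. y \<le> x) A)"
    then have CA: "\<And>q. q \<in> C \<Longrightarrow> sublinear q \<and> q \<le> p" using Chains_relation_of[OF C] by (auto simp: A_def)
    have tot: "\<And>a b. a \<in> C \<Longrightarrow> b \<in> C \<Longrightarrow> a \<le> b \<or> b \<le> a"
      using C by (auto simp: Chains_def relation_of_def)
    show "\<exists>u\<in>A. \<forall>a\<in>C. u \<le> a"
    proof (cases "C = {}")
      case True
      then show ?thesis using p by (auto simp: A_def)
    next
      case False
      define u where "u x = (INF q\<in>C. q x)" for x
      have bdd: "bdd_below ((\<lambda>q. q x) ` C)" for x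
      proof (rule bdd_belowI2)
        fix q assume "q \<in> C"
        then have "sublinear q" "q (- x) \<le> p (- x)" using CA by (auto simp: le_fun_def)
        then show "- p (- x) \<le> q x" using sublinearD(4)[of q x] by simp
      qed
      have up: "u x \<le> q x" if "q \<in> C" for q x
        unfolding u_def using that bdd by (rule cINF_lower[rotated])
      have low: "b \<le> u x" if "\<And>q. q \<in> C \<Longrightarrow> b \<le> q x" for b x
        unfolding u_def using False that by (rule cINF_greatest)
      have "sublinear u"
      proof (rule sublinearI)
        fix x y
        have "u (x + y) - u x \<le> u y"
        proof (rule low)
          fix q assume q: "q \<in> C"
          have "u (x + y) - q y \<le> u x"
          proof (rule low)
            fix q' assume q': "q' \<in> C"
            \<comment> \<open>Subadditivity of the infimum needs one member of the chain below both
              \<open>q\<close> and \<open>q'\<close>.\<close>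
            from tot[OF q q'] obtain m where m: "m \<in> C" "m \<le> q" "m \<le> q'" using q q' by blast
            have "u (x + y) \<le> m (x + y)" by (rule up[OF m(1)])
            also have "\<dots> \<le> m x + m y" using CA m(1) sublinearD(1) by blast
            also have "\<dots> \<le> q' x + q y" using m by (auto simp: le_fun_def intro: add_mono)
            finally show "u (x + y) - q y \<le> q' x" by simp
          qed
          then show "u (x + y) - u x \<le> q y" by simp
        qed
        then show "u (x + y) \<le> u x + u y" by simp
      next
        have "q 0 = 0" if "q \<in> C" for q using CA that sublinearD(3) by blast
        then have "(\<lambda>q. q 0) ` C = {0}" using False by (auto simp: image_iff)
        then show "u 0 = 0" unfolding u_def by simp
      next
        fix c :: real and x assume c: "0 < c"
        have "inverse c * u (c *\<^sub>R x) \<le> u x"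
        proof (rule low)
          fix q assume q: "q \<in> C"
          then have "q (c *\<^sub>R x) = c * q x" using CA c sublinearD(2)[of q c x] by simp
          then show "inverse c * u (c *\<^sub>R x) \<le> q x" using up[OF q, of "c *\<^sub>R x"] c by (simp add: field_simps)
        qed
        then show "u (c *\<^sub>R x) \<le> c * u x" using c by (simp add: field_simps)
      qed
      moreover obtain q where "q \<in> C" using False by blast
      ultimately have "u \<in> A" using CA[of q] up[of q] by (auto simp: A_def le_fun_def intro: order_trans)
      then show ?thesis using up by (auto simp: le_fun_def)
    qed
  qed
  then obtain q where "q \<in> A" and min: "\<And>a. a \<in> A \<Longrightarrow> a \<le> q \<Longrightarrow> a = q" by blast
  moreover from this have "q' = q" if "sublinear q'" "\<And>x. q' x \<le> q x" for q'
    using that by (intro min) (auto simp: A_def le_fun_def intro: order_trans)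
  ultimately show thesis using that by (auto simp: A_def le_fun_def)
qed

text \<open>Reduce \<open>q\<close> by the constraints \<open>t * q y\<close> at
  \<open>t *\<^sub>R y\<close>. Minimality returns \<open>q\<close> itself, which therefore
  satisfies \<open>q (- y) \<le> - q y\<close>; an odd sublinear functional is linear.\<close>

lemma minimal_sublinear_linear:
  assumes q: "sublinear q" and min: "\<And>q'. sublinear q' \<Longrightarrow> (\<And>x. q' x \<le> q x) \<Longrightarrow> q' = q"
  shows "linear q" "q (- y) = - q y"
proof -
  have neg: "q (- y) = - q y" for y
  proof -
    define K where "K = {(t *\<^sub>R y, t * q y) |t. 0 \<le> t}"
    have "real_cone K"
    proof -
      have 1: "(0, 0) \<in> K" unfolding K_def by (rule CollectI, rule exI[of _ 0]) simp
      have 2: "(g + g', s + s') \<in> K" if gs: "(g, s) \<in> K" "(g', s') \<in> K" for g s g' s'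
      proof -
        from gs obtain t t' where "0 \<le> t" "0 \<le> t'" "g = t *\<^sub>R y" "s = t * q y" "g' = t' *\<^sub>R y" "s' = t' * q y"
          by (auto simp: K_def)
        then show ?thesis unfolding K_def
          by (intro CollectI exI[of _ "t + t'"]) (auto simp: scaleR_add_left distrib_right)
      qed
      have 3: "(c *\<^sub>R g, c * s) \<in> K" if "0 < c" "(g, s) \<in> K" for c g s
      proof -
        from that obtain t where "0 \<le> t" "g = t *\<^sub>R y" "s = t * q y" by (auto simp: K_def)
        then show ?thesis unfolding K_def using that(1)
          by (intro CollectI exI[of _ "c * t"]) auto
      qed
      show ?thesis unfolding real_cone_def using 1 2 3 by blast
    qed
    moreover have "s \<le> q g" if "(g, s) \<in> K" for g s
      using that sublinearD(2)[OF q] by (auto simp: K_def)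
    ultimately obtain r where r: "sublinear r" "\<And>x. r x \<le> q x" "\<And>g s. (g, s) \<in> K \<Longrightarrow> r (- g) \<le> - s"
      using sublinear_reduce[OF q] by metis
    have "r = q" by (rule min) (use r in auto)
    have "(y, q y) \<in> K" unfolding K_def by (rule CollectI, rule exI[of _ 1]) simp
    then have "q (- y) \<le> - q y" using r(3) \<open>r = q\<close> by blast
    moreover have "- q y \<le> q (- y)" using sublinearD(4)[OF q, of "- y"] by simp
    ultimately show ?thesis by simp
  qed
  then show "q (- y) = - q y" .
  show "linear q"
  proof (rule linearI)
    fix x y
    have "q x \<le> q (x + y) + q (- y)" using sublinearD(1)[OF q, of "x + y" "- y"] by simp
    then show "q (x + y) = q x + q y" using sublinearD(1)[OF q, of x y] neg[of y] by simp
  next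
    fix c x
    show "q (c *\<^sub>R x) = c *\<^sub>R q x"
    proof (cases "0 \<le> c")
      case False
      then have "q (c *\<^sub>R x) = - q ((- c) *\<^sub>R x)" using neg[of "(- c) *\<^sub>R x"] by simp
      also have "\<dots> = c * q x" using sublinearD(2)[OF q, of "- c" x] False by simp
      finally show ?thesis by simp
    qed (simp add: sublinearD(2)[OF q])
  qed
qed

theorem hahn_banach_cone:
  assumes p: "sublinear p" and K: "real_cone K" and le: "\<And>g s. (g, s) \<in> K \<Longrightarrow> s \<le> p g"
  obtains f where "linear f" "\<And>x. f x \<le> p x" "\<And>g s. (g, s) \<in> K \<Longrightarrow> s \<le> f g"
proof -
  obtain r where r: "sublinear r" "\<And>x. r x \<le> p x" "\<And>g s. (g, s) \<in> K \<Longrightarrow> r (- g) \<le> - s"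
    using sublinear_reduce[OF p K le] by metis
  obtain q where q: "sublinear q" "\<And>x. q x \<le> r x" "\<And>q'. sublinear q' \<Longrightarrow> (\<And>x. q' x \<le> q x) \<Longrightarrow> q' = q"
    using minimal_sublinear[OF r(1)] by metis
  have lin: "linear q" and neg: "\<And>y. q (- y) = - q y" using minimal_sublinear_linear[OF q(1)] q(3) by metis+
  show thesis
  proof
    show "linear q" by (rule lin)
    show "q x \<le> p x" for x using q(2) r(2) order_trans by blast
    show "s \<le> q g" if "(g, s) \<in> K" for g s using q(2)[of "- g"] r(3)[OF that] neg[of g] by simp
  qed
qed

text \<open>The upper bound on \<open>p\<close>, used at \<open>x\<close> and at \<open>- x\<close>,
  bounds \<open>f\<close> from both sides.\<close>

theorem hahn_banach_bounded:
  fixes p :: "'v::real_normed_vector \<Rightarrow> real"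
  assumes p: "sublinear p" and C: "\<And>x. p x \<le> C * norm x"
    and K: "real_cone K" and le: "\<And>g s. (g, s) \<in> K \<Longrightarrow> s \<le> p g"
  obtains f :: "'v \<Rightarrow>\<^sub>L real" where "\<And>x. f x \<le> p x" "\<And>g s. (g, s) \<in> K \<Longrightarrow> s \<le> f g"
proof -
  obtain f where f: "linear f" "\<And>x. f x \<le> p x" "\<And>g s. (g, s) \<in> K \<Longrightarrow> s \<le> f g"
    using hahn_banach_cone[OF p K le] by metis
  have "\<bar>f x\<bar> \<le> norm x * C" for x
  proof -
    have "f x \<le> C * norm x" using f(2)[of x] C[of x] by simp
    moreover have "- f x \<le> C * norm x"
      using f(2)[of "- x"] C[of "- x"] linear_neg[OF f(1), of x] by simp
    ultimately show ?thesis by (simp add: mult.commute)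
  qed
  then have "bounded_linear f"
    using f(1) by (intro bounded_linear_intro[where K=C]) (auto simp: linear_add linear_scale)
  then have "blinfun_apply (Blinfun f) = f" by (rule bounded_linear_Blinfun_apply)
  with f that show thesis by metis
qed

lemma sublinear_norm: "sublinear norm"
  by (simp add: sublinear_def norm_triangle_ineq)

lemma norm_blinfun_le_of_le:
  fixes f :: "'v::real_normed_vector \<Rightarrow>\<^sub>L real"
  assumes "0 \<le> C" "\<And>x. f x \<le> C * norm x"
  shows "norm f \<le> C"
proof (rule norm_blinfun_bound[OF assms(1)])
  fix x
  show "norm (f x) \<le> C * norm x"
    using assms(2)[of x] assms(2)[of "- x"] by (simp add: blinfun.minus_right abs_le_iff)
qed

text \<open>The constraint \<open>d \<le> f\<close> on \<open>S\<close> is encoded by the cone over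
  \<open>S \<times> {d}\<close>, which convexity of \<open>S\<close> closes under addition. The
  freedom in \<open>p\<close> matters: it carries positivity, or domination by a given family of
  functionals.\<close>

theorem mazur_orlicz:
  fixes p :: "'v::real_normed_vector \<Rightarrow> real"
  assumes p: "sublinear p" and C: "\<And>x. p x \<le> C * norm x"
    and S: "convex S" "S \<noteq> {}" and le: "\<And>x. x \<in> S \<Longrightarrow> d \<le> p x"
  obtains f :: "'v \<Rightarrow>\<^sub>L real" where "\<And>x. f x \<le> p x" "\<And>x. x \<in> S \<Longrightarrow> d \<le> f x"
proof -
  define K where "K = {(t *\<^sub>R x, t * d) |t x. 0 \<le> t \<and> x \<in> S}"
  obtain x0 where x0: "x0 \<in> S" using S by blast
  have 1: "(0, 0) \<in> K" unfolding K_def using x0 by (intro CollectI exI[of _ 0] exI[of _ x0]) simp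
  have 2: "(g + g', s + s') \<in> K" if gs: "(g, s) \<in> K" "(g', s') \<in> K" for g s g' s'
  proof -
    from gs obtain t x t' x' where *: "0 \<le> t" "x \<in> S" "0 \<le> t'" "x' \<in> S"
        "g = t *\<^sub>R x" "s = t * d" "g' = t' *\<^sub>R x'" "s' = t' * d"
      by (auto simp: K_def)
    show ?thesis
    proof (cases "t + t' = 0")
      case True
      then have "t = 0" "t' = 0" using * by auto
      then show ?thesis using * 1 by simp
    next
      case False
      let ?y = "(t / (t + t')) *\<^sub>R x + (t' / (t + t')) *\<^sub>R x'"
      have "?y \<in> S" using * False by (intro convexD[OF S(1)]) (auto simp: add_divide_distrib[symmetric])
      moreover have "g + g' = (t + t') *\<^sub>R ?y" using * False by (simp add: scaleR_add_right)
      ultimately show ?thesis unfolding K_def using *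
        by (intro CollectI exI[of _ "t + t'"] exI[of _ ?y]) (auto simp: distrib_right)
    qed
  qed
  have 3: "(c *\<^sub>R g, c * s) \<in> K" if "0 < c" "(g, s) \<in> K" for c g s
  proof -
    from that obtain t x where "0 \<le> t" "x \<in> S" "g = t *\<^sub>R x" "s = t * d" by (auto simp: K_def)
    then show ?thesis unfolding K_def using that(1)
      by (intro CollectI exI[of _ "c * t"] exI[of _ x]) auto
  qed
  have "real_cone K" unfolding real_cone_def using 1 2 3 by blast
  moreover have "s \<le> p g" if "(g, s) \<in> K" for g s
    using that le sublinearD(2)[OF p] by (auto simp: K_def intro!: mult_left_mono)
  ultimately obtain f :: "'v \<Rightarrow>\<^sub>L real" where f: "\<And>x. f x \<le> p x" "\<And>g s. (g, s) \<in> K \<Longrightarrow> s \<le> f g"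
    using hahn_banach_bounded[OF p C] by metis
  have "d \<le> f x" if "x \<in> S" for x
    using f(2)[of x d] that unfolding K_def by (force intro!: exI[of _ 1])
  with f that show thesis by metis
qed

lemma norming_functional:
  obtains f :: "'v::real_normed_vector \<Rightarrow>\<^sub>L real" where "norm f \<le> 1" "f x = norm x"
proof -
  obtain f :: "'v \<Rightarrow>\<^sub>L real" where f: "\<And>x. f x \<le> norm x" "\<And>y. y \<in> {x} \<Longrightarrow> norm x \<le> f y"
    using mazur_orlicz[OF sublinear_norm, of 1 "{x}" "norm x"] by auto
  show thesis
    by (rule that[of f]) (use f in \<open>auto intro!: norm_blinfun_le_of_le antisym\<close>)
qed

lemma mazur_separation:
  fixes w :: "'v::real_normed_vector"
  assumes S: "convex S" "S \<noteq> {}" and e: "\<And>z. z \<in> S \<Longrightarrow> e \<le> norm (w - z)"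
  obtains f :: "'v \<Rightarrow>\<^sub>L real" where "norm f \<le> 1" "\<And>z. z \<in> S \<Longrightarrow> f z \<le> f w - e"
proof -
  have "convex ((\<lambda>z. w - z) ` S)"
    using convex_translation[OF convex_negations[OF S(1)], of w] by (simp add: image_image)
  then obtain f :: "'v \<Rightarrow>\<^sub>L real" where f: "\<And>x. f x \<le> norm x" "\<And>y. y \<in> (\<lambda>z. w - z) ` S \<Longrightarrow> e \<le> f y"
    using mazur_orlicz[OF sublinear_norm, of 1 "(\<lambda>z. w - z) ` S" e] S(2) e by auto
  show thesis
  proof (rule that)
    show "norm f \<le> 1" using f by (auto intro!: norm_blinfun_le_of_le)
    show "f z \<le> f w - e" if "z \<in> S" for z using f(2)[of "w - z"] that by (simp add: blinfun.diff_right)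
  qed
qed

text \<open>The canonical embedding into the bidual; through it, statements about sequences of
  functionals apply to sequences of vectors.\<close>

definition eval_at :: "'v::real_normed_vector \<Rightarrow> ('v \<Rightarrow>\<^sub>L real) \<Rightarrow>\<^sub>L real" where
  "eval_at x = Blinfun (\<lambda>f. blinfun_apply f x)"

lemma eval_at_apply [simp]: "blinfun_apply (eval_at x) f = blinfun_apply f x"
  unfolding eval_at_def by (simp add: bounded_linear_Blinfun_apply bounded_linear_blinfun_apply bounded_linear_intros)

lemma norm_eval_at [simp]: "norm (eval_at x) = norm x"
proof (rule antisym)
  show "norm (eval_at x) \<le> norm x"
  proof (rule norm_blinfun_bound)
    show "norm (eval_at x f) \<le> norm x * norm f" for f
      using norm_blinfun[of f x] by (simp add: mult.commute)
  qed simp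
  obtain f :: "'a \<Rightarrow>\<^sub>L real" where f: "norm f \<le> 1" "f x = norm x" by (rule norming_functional)
  have "norm x \<le> norm (eval_at x) * norm f" using norm_blinfun[of "eval_at x" f] f by simp
  also have "\<dots> \<le> norm (eval_at x)" using f(1) by (simp add: mult_left_le)
  finally show "norm x \<le> norm (eval_at x)" .
qed

lemma eval_at_diff: "eval_at (x - y) = eval_at x - eval_at y"
  by (rule blinfun_eqI) (simp add: blinfun.diff_right blinfun.diff_left)

lemma weakly_nullD: "weakly_null x \<Longrightarrow> (\<lambda>n. blinfun_apply f (x n)) \<longlonglongrightarrow> (0::real)"
  by (simp add: weakly_null_def)

lemma weakly_null_subseq: "weakly_null x \<Longrightarrow> strict_mono s \<Longrightarrow> weakly_null (\<lambda>n. x (s n))"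
  unfolding weakly_null_def using LIMSEQ_subseq_LIMSEQ[unfolded o_def] by blast

lemma weakly_null_uminus: "weakly_null x \<Longrightarrow> weakly_null (\<lambda>n. - x n)"
  unfolding weakly_null_def by (auto simp: blinfun.minus_right intro: tendsto_minus_cancel_left[THEN iffD1])

section \<open>Positive functionals\<close>

definition posf :: "('a::banach_lattice \<Rightarrow>\<^sub>L real) \<Rightarrow> bool" where
  "posf f \<longleftrightarrow> (\<forall>x. 0 \<le> x \<longrightarrow> 0 \<le> blinfun_apply f x)"

lemma posfD: "posf f \<Longrightarrow> 0 \<le> x \<Longrightarrow> 0 \<le> blinfun_apply f x"
  by (simp add: posf_def)

lemma posf_mono: "posf f \<Longrightarrow> x \<le> y \<Longrightarrow> blinfun_apply f x \<le> blinfun_apply f y"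
  using posfD[of f "y - x"] by (simp add: blinfun.diff_right)

lemma apply_le_norm: "blinfun_apply f x \<le> norm f * norm x" for f :: "'v::real_normed_vector \<Rightarrow>\<^sub>L real"
  using norm_blinfun[of f x] by simp

lemma pprt_add_le: "pprt (x + y) \<le> pprt x + pprt (y::'a::banach_lattice)"
  unfolding pprt_le_iff by (auto intro: add_mono le_pprt add_nonneg_nonneg)

text \<open>The norm is replaced by \<open>norm (pprt x)\<close>, which vanishes on negative
  elements, so that any functional below it is positive.\<close>

lemma positive_norming_functional:
  fixes w :: "'a::banach_lattice"
  assumes "0 \<le> w"
  obtains f where "posf f" "norm f \<le> 1" "blinfun_apply f w = norm w"
proof -
  define p where "p x = norm (pprt x)" for x :: 'a
  have sub: "sublinear p"
    unfolding sublinear_def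
  proof (intro conjI allI impI)
    show "p (x + y) \<le> p x + p y" for x y
      using norm_mono_nonneg[OF zero_le_pprt pprt_add_le[of x y]] norm_triangle_ineq[of "pprt x" "pprt y"]
      by (simp add: p_def)
  qed (simp add: p_def pprt_scaleR)
  have le: "p x \<le> 1 * norm x" for x by (simp add: p_def norm_pprt_le)
  obtain f :: "'a \<Rightarrow>\<^sub>L real" where f: "\<And>x. f x \<le> p x" "\<And>y. y \<in> {w} \<Longrightarrow> norm w \<le> f y"
    using mazur_orlicz[OF sub le, of "{w}" "norm w"] assms by (auto simp: p_def)
  show thesis
  proof (rule that)
    show "posf f"
      unfolding posf_def
    proof (intro allI impI)
      fix x :: 'a assume "0 \<le> x"
      then show "0 \<le> f x" using f(1)[of "- x"] by (simp add: p_def blinfun.minus_right)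
    qed
    show n: "norm f \<le> 1"
      by (rule norm_blinfun_le_of_le) (use order_trans[OF f(1) le] in auto)
    have "f w \<le> norm w" using f(1)[of w] le[of w] by simp
    then show "f w = norm w" using f(2)[of w] by simp
  qed
qed

lemma eq_zero_if_posf_zero:
  fixes w :: "'a::banach_lattice"
  assumes "0 \<le> w" "\<And>f. posf f \<Longrightarrow> blinfun_apply f w = 0"
  shows "w = 0"
  using positive_norming_functional[OF assms(1)] assms(2) by (metis norm_eq_zero)

text \<open>Kantorovich extension: \<open>\<phi> a - \<phi> b\<close> has the same value for all
  decompositions \<open>x = a - b\<close> into positive elements, so linearity can be checked on
  convenient ones.\<close>

lemma extend_from_cone:
  fixes \<phi> :: "'a::banach_lattice \<Rightarrow> real"
  assumes add: "\<And>x y. 0 \<le> x \<Longrightarrow> 0 \<le> y \<Longrightarrow> \<phi> (x + y) = \<phi> x + \<phi> y"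
    and scale: "\<And>c x. 0 \<le> c \<Longrightarrow> 0 \<le> x \<Longrightarrow> \<phi> (c *\<^sub>R x) = c * \<phi> x"
    and nonneg: "\<And>x. 0 \<le> x \<Longrightarrow> 0 \<le> \<phi> x"
    and bound: "\<And>x. 0 \<le> x \<Longrightarrow> \<phi> x \<le> C * norm x"
  obtains g where "posf g" "\<And>x. 0 \<le> x \<Longrightarrow> blinfun_apply g x = \<phi> x"
proof -
  define g where "g x = \<phi> (pprt x) - \<phi> (pprt (- x))" for x
  have eq: "g x = \<phi> a - \<phi> b" if "0 \<le> a" "0 \<le> b" "x = a - b" for x a b
  proof -
    have swap: "p + b = q + a" if "p - q = a - b" for p q :: 'a using that by (simp add: algebra_simps)
    have "pprt x + b = pprt (- x) + a" by (rule swap) (simp only: pprt_minus_pprt that(3))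
    then have "\<phi> (pprt x) + \<phi> b = \<phi> (pprt (- x)) + \<phi> a" using add that by (metis zero_le_pprt)
    then show ?thesis by (simp add: g_def)
  qed
  have "bounded_linear g"
  proof (rule bounded_linear_intro)
    fix x y
    have "g (x + y) = \<phi> (pprt x + pprt y) - \<phi> (pprt (- x) + pprt (- y))"
    proof (rule eq)
      show "x + y = pprt x + pprt y - (pprt (- x) + pprt (- y))"
        using pprt_minus_pprt[of x] pprt_minus_pprt[of y] by (metis add_diff_add)
    qed (auto intro: add_nonneg_nonneg)
    then show "g (x + y) = g x + g y" by (simp add: add g_def)
  next
    fix c x
    show "g (c *\<^sub>R x) = c *\<^sub>R g x"
    proof (cases "0 \<le> c")
      case True
      have "g (c *\<^sub>R x) = \<phi> (c *\<^sub>R pprt x) - \<phi> (c *\<^sub>R pprt (- x))"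
        by (rule eq) (use True in \<open>auto intro: scaleR_nonneg_nonneg simp: scaleR_diff_right[symmetric] pprt_minus_pprt\<close>)
      then show ?thesis using True by (simp add: scale g_def algebra_simps)
    next
      case False
      have "g (c *\<^sub>R x) = \<phi> ((- c) *\<^sub>R pprt (- x)) - \<phi> ((- c) *\<^sub>R pprt x)"
      proof (rule eq)
        have "- c *\<^sub>R pprt (- x) - - c *\<^sub>R pprt x = c *\<^sub>R (pprt x - pprt (- x))"
          by (simp only: scaleR_diff_right scaleR_minus_left) simp
        then show "c *\<^sub>R x = - c *\<^sub>R pprt (- x) - - c *\<^sub>R pprt x" by (simp only: pprt_minus_pprt)
      qed (use False in \<open>auto intro!: scaleR_nonneg_nonneg simp del: scaleR_minus_left\<close>)
      also have "\<dots> = c * g x"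
        using False scale[of "- c" "pprt (- x)"] scale[of "- c" "pprt x"] by (simp add: g_def algebra_simps)
      finally show ?thesis by simp
    qed
  next
    fix x
    have "\<bar>g x\<bar> \<le> \<phi> (pprt x) + \<phi> (pprt (- x))"
      unfolding g_def using nonneg[of "pprt x"] nonneg[of "pprt (- x)"] by simp
    also have "\<dots> = \<phi> (labs x)" by (simp add: add labs_eq)
    also have "\<dots> \<le> C * norm (labs x)" by (rule bound) simp
    finally show "norm (g x) \<le> norm x * C" by (simp add: mult.commute)
  qed
  then have ap: "blinfun_apply (Blinfun g) = g" by (rule bounded_linear_Blinfun_apply)
  have g: "g x = \<phi> x" if "0 \<le> x" for x using eq[OF that order_refl] scale[of 0 0] by simp
  show thesis
    by (rule that[of "Blinfun g"]) (simp_all add: posf_def ap g nonneg)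
qed

text \<open>The Riesz-Kantorovich formula: on the cone, \<open>g x\<close> is the supremum of
  \<open>f y\<close> over \<open>labs y \<le> x\<close>. The third conclusion keeps the supremum
  property, from which upper bounds for the modulus are read off.\<close>

lemma modulus_functional:
  fixes f :: "'a::banach_lattice \<Rightarrow>\<^sub>L real"
  obtains g where "posf g" "\<And>x. \<bar>blinfun_apply f x\<bar> \<le> blinfun_apply g (labs x)"
    "\<And>x B. 0 \<le> x \<Longrightarrow> (\<And>y. labs y \<le> x \<Longrightarrow> blinfun_apply f y \<le> B) \<Longrightarrow> blinfun_apply g x \<le> B"
    "norm g \<le> norm f"
proof -
  define S where "S x = blinfun_apply f ` {y. labs y \<le> x}" for x
  define \<phi> where "\<phi> x = Sup (S x)" for x
  have ub: "f y \<le> norm f * norm x" if "labs y \<le> x" for x y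
    using apply_le_norm[of f y] mult_left_mono[OF norm_le_of_labs_le[OF that], of "norm f"] by simp
  have bdd: "bdd_above (S x)" for x unfolding S_def using ub by (auto intro!: bdd_aboveI2)
  have ne: "S x \<noteq> {}" if "0 \<le> x" for x unfolding S_def using that by (auto intro!: exI[of _ 0])
  have up: "f y \<le> \<phi> x" if "labs y \<le> x" for x y
    unfolding \<phi>_def by (rule cSup_upper[OF _ bdd]) (use that in \<open>auto simp: S_def\<close>)
  have low: "\<phi> x \<le> B" if "0 \<le> x" "\<And>y. labs y \<le> x \<Longrightarrow> f y \<le> B" for x B
    unfolding \<phi>_def by (rule cSup_least[OF ne]) (use that in \<open>auto simp: S_def\<close>)
  have add: "\<phi> (x + y) = \<phi> x + \<phi> y" if x: "0 \<le> x" and y: "0 \<le> y" for x y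
  proof (rule antisym)
    show "\<phi> (x + y) \<le> \<phi> x + \<phi> y"
    proof (rule low)
      show "0 \<le> x + y" using x y by simp
      fix z assume z: "labs z \<le> x + y"
      \<comment> \<open>Riesz decomposition: \<open>z1\<close> is \<open>z\<close> clipped to the
        interval from \<open>- x\<close> to \<open>x\<close>, and the remainder is then bounded by
        \<open>y\<close>.\<close>
      define z1 where "z1 = inf (sup z (- x)) x"
      have nx: "- x \<le> x" using x by (metis neg_le_0_iff_le order_trans)
      have "labs z1 \<le> x"
      proof (rule labs_leI)
        show "z1 \<le> x" by (simp add: z1_def)
        have "- x \<le> z1" using nx by (simp add: z1_def)
        then show "- z1 \<le> x" by (simp add: minus_le_iff)
      qed
      moreover have "labs (z - z1) \<le> y"
      proof (rule labs_leI)
        have zz: "z \<le> x + y" "- z \<le> x + y" using z by (auto simp: labs_le_iff)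
        have "z - y \<le> sup z (- x)" using y by (intro le_supI1) (simp add: diff_le_eq)
        moreover have "z - y \<le> x" using zz by (simp add: diff_le_eq)
        ultimately have "z - y \<le> z1" by (simp add: z1_def)
        then show "z - z1 \<le> y" by (simp add: diff_le_eq add.commute)
        have "z1 \<le> sup z (- x)" by (simp add: z1_def)
        also have "\<dots> \<le> z + y"
        proof (rule sup_least)
          show "z \<le> z + y" using y by simp
          show "- x \<le> z + y" using zz(2) by (metis add.commute add_le_cancel_left diff_add_cancel minus_add_cancel minus_le_iff uminus_add_conv_diff neg_le_iff_le minus_add_distrib diff_le_eq)
        qed
        finally show "- (z - z1) \<le> y" by (simp add: diff_le_eq add.commute)
      qed
      ultimately have "f z1 + f (z - z1) \<le> \<phi> x + \<phi> y" using up by (intro add_mono) auto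
      then show "f z \<le> \<phi> x + \<phi> y" by (simp add: blinfun.diff_right)
    qed
    have "\<phi> x \<le> \<phi> (x + y) - \<phi> y"
    proof (rule low[OF x])
      fix z1 assume z1: "labs z1 \<le> x"
      have "\<phi> y \<le> \<phi> (x + y) - f z1"
      proof (rule low[OF y])
        fix z2 assume z2: "labs z2 \<le> y"
        have "labs (z1 + z2) \<le> x + y" using labs_triangle add_mono[OF z1 z2] order_trans by blast
        then show "f z2 \<le> \<phi> (x + y) - f z1" using up[of "z1 + z2" "x + y"] by (simp add: blinfun.add_right)
      qed
      then show "f z1 \<le> \<phi> (x + y) - \<phi> y" by simp
    qed
    then show "\<phi> x + \<phi> y \<le> \<phi> (x + y)" by simp
  qed
  have nonneg: "0 \<le> \<phi> x" if "0 \<le> x" for x using up[of 0 x] that by simp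
  have \<phi>le: "\<phi> x \<le> norm f * norm x" if "0 \<le> x" for x by (rule low[OF that ub])
  have scale_le: "\<phi> (c *\<^sub>R x) \<le> c * \<phi> x" if c: "0 < c" and x: "0 \<le> x" for c x
  proof (rule low)
    show "0 \<le> c *\<^sub>R x" using c x by (simp add: scaleR_nonneg_nonneg)
    fix y assume "labs y \<le> c *\<^sub>R x"
    then have "labs (inverse c *\<^sub>R y) \<le> x"
      using scaleR_left_mono[of "labs y" "c *\<^sub>R x" "inverse c"] c by (simp add: labs_scaleR)
    from up[OF this] show "f y \<le> c * \<phi> x" using c by (simp add: blinfun.scaleR_right field_simps)
  qed
  have scale: "\<phi> (c *\<^sub>R x) = c * \<phi> x" if "0 \<le> c" "0 \<le> x" for c x
  proof (cases "c = 0")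
    case True
    then show ?thesis using nonneg[of 0] \<phi>le[of 0] by simp
  next
    case False
    with that have c: "0 < c" by simp
    have "\<phi> x \<le> inverse c * \<phi> (c *\<^sub>R x)"
      using scale_le[of "inverse c" "c *\<^sub>R x"] c that by (simp add: scaleR_nonneg_nonneg)
    then show ?thesis using scale_le[OF c that(2)] c by (simp add: field_simps)
  qed
  obtain g where g: "posf g" "\<And>x. 0 \<le> x \<Longrightarrow> blinfun_apply g x = \<phi> x"
    using extend_from_cone[of \<phi> "norm f", OF add scale nonneg \<phi>le] by blast
  show thesis
  proof (rule that)
    show "posf g" by (rule g)
    show "\<bar>f x\<bar> \<le> g (labs x)" for x
      using up[of x "labs x"] up[of "- x" "labs x"] by (simp add: g blinfun.minus_right abs_le_iff)
    show "g x \<le> B" if "0 \<le> x" "\<And>y. labs y \<le> x \<Longrightarrow> f y \<le> B" for x B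
      using low[of x B] that g(2) by simp
    show "norm g \<le> norm f"
    proof (rule norm_blinfun_le_of_le)
      fix x
      have "g x \<le> g (labs x)" by (rule posf_mono[OF g(1) le_labs])
      also have "\<dots> \<le> norm f * norm x" using \<phi>le[of "labs x"] g(2)[of "labs x"] by simp
      finally show "g x \<le> norm f * norm x" .
    qed simp
  qed
qed

section \<open>Positive series with bounded partial sums\<close>

text \<open>Taking the signs of \<open>f (d n)\<close> as coefficients turns the sum of moduli into
  a single value of \<open>f\<close>.\<close>

lemma sum_abs_le_of_signs:
  fixes f :: "'v::real_normed_vector \<Rightarrow>\<^sub>L real"
  assumes "\<And>c. (\<And>n. n \<in> A \<Longrightarrow> \<bar>c n\<bar> \<le> (1::real)) \<Longrightarrow> norm (\<Sum>n\<in>A. c n *\<^sub>R d n) \<le> C"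
  shows "(\<Sum>n\<in>A. \<bar>blinfun_apply f (d n)\<bar>) \<le> norm f * C"
proof -
  let ?c = "\<lambda>n. sgn (f (d n))"
  have "(\<Sum>n\<in>A. \<bar>blinfun_apply f (d n)\<bar>) = f (\<Sum>n\<in>A. ?c n *\<^sub>R d n)"
    by (simp add: blinfun.sum_right blinfun.scaleR_right abs_sgn mult.commute)
  also have "\<dots> \<le> norm f * norm (\<Sum>n\<in>A. ?c n *\<^sub>R d n)" by (rule apply_le_norm)
  also have "\<dots> \<le> norm f * C"
    by (intro mult_left_mono assms) (auto simp: sgn_real_def)
  finally show ?thesis .
qed

lemma labs_signed_sum_le:
  fixes d :: "'b \<Rightarrow> 'a::banach_lattice"
  assumes "\<And>n. n \<in> A \<Longrightarrow> 0 \<le> d n" "\<And>n. n \<in> A \<Longrightarrow> \<bar>c n\<bar> \<le> b"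
  shows "labs (\<Sum>n\<in>A. c n *\<^sub>R d n) \<le> b *\<^sub>R (\<Sum>n\<in>A. d n)"
proof -
  have "labs (\<Sum>n\<in>A. c n *\<^sub>R d n) \<le> (\<Sum>n\<in>A. labs (c n *\<^sub>R d n))" by (rule labs_sum)
  also have "\<dots> \<le> (\<Sum>n\<in>A. b *\<^sub>R d n)"
    using assms by (intro sum_mono) (simp add: labs_scaleR scaleR_right_mono)
  finally show ?thesis by (simp add: scaleR_sum_right)
qed

text \<open>Signed sums of positive elements are dominated by the unsigned sum, so one norm bound
  serves all choices of signs: such series are weakly unconditionally Cauchy.\<close>

lemma sum_abs_functional_le:
  fixes f :: "'a::banach_lattice \<Rightarrow>\<^sub>L real" and d :: "'b \<Rightarrow> 'a::banach_lattice"
  assumes "\<And>n. n \<in> A \<Longrightarrow> 0 \<le> d n" "norm (\<Sum>n\<in>A. d n) \<le> C"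
  shows "(\<Sum>n\<in>A. \<bar>blinfun_apply f (d n)\<bar>) \<le> norm f * C"
proof (rule sum_abs_le_of_signs)
  fix c assume "\<And>n. n \<in> A \<Longrightarrow> \<bar>c n\<bar> \<le> (1::real)"
  then have "labs (\<Sum>n\<in>A. c n *\<^sub>R d n) \<le> (\<Sum>n\<in>A. d n)"
    using labs_signed_sum_le[of A d c 1] assms by simp
  then show "norm (\<Sum>n\<in>A. c n *\<^sub>R d n) \<le> C" using norm_le_of_labs_le assms(2) order_trans by blast
qed

lemma bounded_sums_summable:
  fixes f :: "'a::banach_lattice \<Rightarrow>\<^sub>L real" and d :: "nat \<Rightarrow> 'a::banach_lattice"
  assumes "\<And>n. 0 \<le> d n" "\<And>N. norm (\<Sum>n<N. d n) \<le> C"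
  shows "summable (\<lambda>n. \<bar>blinfun_apply f (d n)\<bar>)"
proof (rule bounded_imp_summable[where B="norm f * C"])
  show "(\<Sum>k\<le>n. \<bar>f (d k)\<bar>) \<le> norm f * C" for n
    using assms(1) assms(2)[of "Suc n"] by (intro sum_abs_functional_le) (auto simp: lessThan_Suc_atMost)
qed simp

lemma bounded_sums_weakly_null:
  fixes d :: "nat \<Rightarrow> 'a::banach_lattice"
  assumes "\<And>n. 0 \<le> d n" "\<And>N. norm (\<Sum>n<N. d n) \<le> C"
  shows "weakly_null d"
  unfolding weakly_null_def
  using bounded_sums_summable[OF assms] summable_LIMSEQ_zero tendsto_rabs_zero_iff by blast

lemma bounded_sums_uaw_null:
  fixes d :: "nat \<Rightarrow> 'a::banach_lattice"
  assumes "\<And>n. 0 \<le> d n" "\<And>N. norm (\<Sum>n<N. d n) \<le> C"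
  shows "uaw_null d"
  unfolding uaw_null_def
proof (intro allI impI bounded_sums_weakly_null)
  fix u :: 'a assume u: "0 \<le> u"
  show "0 \<le> inf (labs (d n)) u" for n using u by simp
  show "norm (\<Sum>n<N. inf (labs (d n)) u) \<le> C" for N
  proof -
    have "(\<Sum>n<N. inf (labs (d n)) u) \<le> (\<Sum>n<N. d n)" using assms(1) by (intro sum_mono) (simp add: le_infI1)
    then have "norm (\<Sum>n<N. inf (labs (d n)) u) \<le> norm (\<Sum>n<N. d n)"
      using u by (intro norm_mono_nonneg sum_nonneg) auto
    with assms(2) show ?thesis using order_trans by blast
  qed
qed

text \<open>The truncations at \<open>u\<close> are still disjoint and lie below \<open>u\<close>,
  so their sums stay below \<open>u\<close> as well.\<close>

lemma disjoint_uaw_null: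
  fixes v :: "nat \<Rightarrow> 'a::banach_lattice"
  assumes "\<And>n. 0 \<le> v n" "\<And>n m. n \<noteq> m \<Longrightarrow> inf (v n) (v m) = 0"
  shows "uaw_null v"
  unfolding uaw_null_def
proof (intro allI impI bounded_sums_weakly_null)
  fix u :: 'a assume u: "0 \<le> u"
  show nn: "0 \<le> inf (labs (v n)) u" for n using u by simp
  have "(\<Sum>n<N. inf (labs (v n)) u) \<le> u" for N
  proof (rule disjoint_sum_le[OF nn])
    show "inf (inf (labs (v n)) u) (inf (labs (v m)) u) = 0" if "n \<noteq> m" for n m
      using assms(1)[of n] assms(1)[of m] u
      by (intro disjoint_mono[OF nn _ nn _ assms(2)[OF that]]) (auto intro: le_infI1)
  qed simp
  then show "norm (\<Sum>n<N. inf (labs (v n)) u) \<le> norm u" for N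
    using nn by (intro norm_mono_nonneg sum_nonneg)
qed

text \<open>By Sokal's gliding hump argument.\<close>

lemma uniform_boundedness:
  fixes f :: "nat \<Rightarrow> ('v::banach \<Rightarrow>\<^sub>L real)"
  assumes pw: "\<And>x. \<exists>B. \<forall>n. \<bar>f n x\<bar> \<le> B"
  shows "\<exists>C. \<forall>n. norm (f n) \<le> C"
proof (rule ccontr)
  assume "\<not> ?thesis"
  then have "\<forall>k. \<exists>n. 4^k < norm (f n)" by (meson not_le)
  then obtain s where s: "\<And>k::nat. 4^k < norm (f (s k))" by metis
  have step: "\<exists>y. norm (y - x) \<le> r \<and> (2/3) * r * norm g \<le> \<bar>g y\<bar>"
    if "0 < r" "0 < norm g" for x r and g :: "'v \<Rightarrow>\<^sub>L real"
  proof -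
    have "\<exists>z. norm (g z) > (2/3) * norm g * norm z"
    proof (rule ccontr)
      assume "\<not> ?thesis"
      then have "norm g \<le> (2/3) * norm g" by (intro norm_blinfun_bound) (auto simp: not_less)
      with that show False by simp
    qed
    then obtain z where z: "(2/3) * norm g * norm z < \<bar>g z\<bar>" by auto
    then have z0: "z \<noteq> 0" by auto
    define h where "h = (r / norm z) *\<^sub>R z"
    have nh: "norm h = r" using z0 that by (simp add: h_def)
    have gh: "(2/3) * r * norm g \<le> \<bar>g h\<bar>"
      using z z0 that by (simp add: h_def blinfun.scaleR_right abs_mult field_simps)
    \<comment> \<open>\<open>2 * g h = g (x + h) - g (x - h)\<close>, so at one of the two points
      \<open>g\<close> is at least \<open>\<bar>g h\<bar>\<close> in modulus.\<close>
    have "\<bar>g h\<bar> \<le> \<bar>g (x + h)\<bar> \<or> \<bar>g h\<bar> \<le> \<bar>g (x - h)\<bar>"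
      by (simp add: blinfun.add_right blinfun.diff_right) linarith
    then show ?thesis
    proof
      assume "\<bar>g h\<bar> \<le> \<bar>g (x + h)\<bar>"
      then show ?thesis using nh gh by (intro exI[of _ "x + h"]) auto
    next
      assume "\<bar>g h\<bar> \<le> \<bar>g (x - h)\<bar>"
      then show ?thesis using nh gh by (intro exI[of _ "x - h"]) auto
    qed
  qed
  \<comment> \<open>Radii \<open>(1/3)^k\<close> against norms above \<open>4^k\<close>: after
    \<open>x (Suc k)\<close> the point moves by at most \<open>(1/3)^k / 2\<close> in total, less
    than the \<open>(2/3) * (1/3)^k\<close> gained, and a sixth of \<open>(4/3)^k\<close> is left at
    the limit.\<close>
  have "\<exists>x. \<forall>k. True \<and> norm (x (Suc k) - x k) \<le> (1/3)^k \<and> (2/3) * (1/3)^k * norm (f (s k)) \<le> \<bar>f (s k) (x (Suc k))\<bar>"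
  proof (rule dependent_nat_choice)
    fix x k
    have "0 < norm (f (s k))" using s[of k] by (meson less_trans zero_less_power zero_less_numeral)
    then show "\<exists>y. True \<and> norm (y - x) \<le> (1/3)^k \<and> (2/3) * (1/3)^k * norm (f (s k)) \<le> \<bar>f (s k) y\<bar>"
      using step[of "(1/3)^k" "f (s k)" x] by auto
  qed auto
  then obtain x where x1: "\<And>k. norm (x (Suc k) - x k) \<le> (1/3)^k"
    and x2: "\<And>k. (2/3) * (1/3)^k * norm (f (s k)) \<le> \<bar>f (s k) (x (Suc k))\<bar>" by blast
  have dist: "norm (x (k + m) - x k) \<le> (1/3)^k * (3/2) * (1 - (1/3)^m)" for k m
  proof (induction m)
    case (Suc m)
    have "norm (x (k + Suc m) - x k) \<le> norm (x (Suc (k + m)) - x (k + m)) + norm (x (k + m) - x k)"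
      using norm_triangle_ineq[of "x (Suc (k + m)) - x (k + m)" "x (k + m) - x k"] by simp
    also have "\<dots> \<le> (1/3)^(k+m) + (1/3)^k * (3/2) * (1 - (1/3)^m)" using x1 Suc by (intro add_mono) auto
    finally have *: "norm (x (k + Suc m) - x k) \<le> (1/3)^(k+m) + (1/3)^k * (3/2) * (1 - (1/3)^m)" .
    have "(1/3)^(k+m) + (1/3)^k * (3/2) * (1 - (1/3)^m) = (1/3)^k * (3/2) * (1 - (1/3::real)^Suc m)"
      by (simp add: power_add field_simps)
    with * show ?case by simp
  qed simp
  have dist': "norm (x (k + m) - x k) \<le> (1/3)^k * (3/2)" for k m
  proof -
    have "(1/3)^k * (3/2) * (1 - (1/3)^m) \<le> (1/3)^k * (3/2) * (1::real)" by (intro mult_left_mono) auto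
    with dist[of k m] show ?thesis by (simp only: mult_1_right)
  qed
  have "Cauchy x"
  proof (rule CauchyI')
    fix e :: real assume e: "0 < e"
    obtain M where M: "(1/3)^M < e / (3/2)" using real_arch_pow_inv[of "e / (3/2)" "1/3"] e by auto
    show "\<exists>M. \<forall>m\<ge>M. \<forall>n>m. dist (x m) (x n) < e"
    proof (intro exI[of _ M] allI impI)
      fix m n assume "M \<le> m" "m < n"
      then have "norm (x n - x m) \<le> (1/3)^m * (3/2)" using dist'[of m "n - m"] by simp
      also have "\<dots> \<le> (1/3)^M * (3/2)" using \<open>M \<le> m\<close> by (intro mult_right_mono power_decreasing) auto
      also have "\<dots> < e" using M by (simp add: field_simps)
      finally show "dist (x m) (x n) < e" by (simp add: dist_norm norm_minus_commute)
    qed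
  qed
  then obtain l where l: "x \<longlonglongrightarrow> l" using Cauchy_convergent convergent_def by blast
  have lim: "norm (l - x k) \<le> (1/3)^k * (3/2)" for k
  proof (rule LIMSEQ_le_const2)
    show "(\<lambda>m. norm (x (m + k) - x k)) \<longlonglongrightarrow> norm (l - x k)"
      by (intro tendsto_intros LIMSEQ_ignore_initial_segment l)
    show "\<exists>N. \<forall>n\<ge>N. norm (x (n + k) - x k) \<le> (1/3)^k * (3/2)"
      using dist'[of k] by (auto simp only: add.commute[of _ k])
  qed
  obtain B where B: "\<And>n. \<bar>f n l\<bar> \<le> B" using pw by blast
  have "(4/3)^k / 6 \<le> B" for k :: nat
  proof -
    let ?g = "f (s k)"
    have "\<bar>?g (l - x (Suc k))\<bar> \<le> norm ?g * norm (l - x (Suc k))" using norm_blinfun[of ?g] by simp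
    also have "\<dots> \<le> norm ?g * ((1/3)^Suc k * (3/2))" by (intro mult_left_mono lim) auto
    finally have "\<bar>?g l - ?g (x (Suc k))\<bar> \<le> norm ?g * (1/3)^k / 2" by (simp add: blinfun.diff_right)
    moreover have "(2/3) * (norm ?g * (1/3)^k) \<le> \<bar>?g (x (Suc k))\<bar>" using x2[of k] by (simp add: mult_ac)
    ultimately have 1: "norm ?g * (1/3)^k / 6 \<le> B" using B[of "s k"] by linarith
    have "4^k * (1/3)^k \<le> norm ?g * (1/3)^k" using s[of k] by (intro mult_right_mono) auto
    moreover have "(4/3::real)^k = 4^k * (1/3)^k" by (simp add: power_mult_distrib[symmetric])
    ultimately show ?thesis using 1 by linarith
  qed
  moreover obtain k where "6 * B < (4/3)^k" using real_arch_pow[of "4/3" "6 * B"] by auto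
  ultimately show False by (metis (no_types) less_divide_eq_numeral1(1) mult.commute not_le)
qed

text \<open>Uniform boundedness for the evaluations at \<open>x n\<close>, which live on the dual;
  the dual is complete even if the space is not.\<close>

lemma weakly_null_bounded:
  fixes x :: "nat \<Rightarrow> 'v::real_normed_vector"
  assumes "weakly_null x"
  shows "\<exists>C. \<forall>n. norm (x n) \<le> C"
proof -
  have "\<exists>C. \<forall>n. norm (eval_at (x n)) \<le> C"
  proof (rule uniform_boundedness)
    fix f :: "'v \<Rightarrow>\<^sub>L real"
    have "Bseq (\<lambda>n. f (x n))" using weakly_nullD[OF assms] convergentI convergent_imp_Bseq by blast
    then show "\<exists>B. \<forall>n. \<bar>eval_at (x n) f\<bar> \<le> B" by (auto simp: Bseq_def)
  qed
  then show ?thesis by simp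
qed

lemma tendsto_zero_subseqI:
  fixes a :: "nat \<Rightarrow> real"
  assumes "\<And>s::nat\<Rightarrow>nat. \<And>e. strict_mono s \<Longrightarrow> 0 < e \<Longrightarrow> (\<And>k. e \<le> \<bar>a (s k)\<bar>) \<Longrightarrow> False"
  shows "a \<longlonglongrightarrow> 0"
proof (rule ccontr)
  assume "\<not> ?thesis"
  then obtain e where e: "0 < e" and "\<forall>N. \<exists>n\<ge>N. e \<le> \<bar>a n\<bar>" by (auto simp: LIMSEQ_iff not_less)
  then have "infinite {n. e \<le> \<bar>a n\<bar>}" by (auto simp: infinite_nat_iff_unbounded_le)
  then obtain s :: "nat \<Rightarrow> nat" where "strict_mono s" "\<forall>k. s k \<in> {n. e \<le> \<bar>a n\<bar>}"
    using infinite_enumerate by blast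
  with assms[of s e] e show False by simp
qed

section \<open>The Schur property and sets with the finite intersection property\<close>

text \<open>Gliding hump: the signs of the \<open>k\<close>-th hump are prescribed by the row \<open>m k\<close>.\<close>

lemma schur_rows:
  fixes a :: "nat \<Rightarrow> nat \<Rightarrow> real"
  assumes sm: "\<And>m. summable (\<lambda>n. \<bar>a m n\<bar>)"
    and wk: "\<And>c. (\<And>n. \<bar>c n\<bar> \<le> 1) \<Longrightarrow> (\<lambda>m. \<Sum>n. c n * a m n) \<longlonglongrightarrow> 0"
  shows "(\<lambda>m. \<Sum>n. \<bar>a m n\<bar>) \<longlonglongrightarrow> 0"
proof (rule tendsto_zero_subseqI)
  fix s :: "nat \<Rightarrow> nat" and e :: real
  assume s: "strict_mono s" and e: "0 < e" and big: "\<And>k. e \<le> \<bar>\<Sum>n. \<bar>a (s k) n\<bar>\<bar>"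
  define b where "b k = a (s k)" for k
  have smb: "summable (\<lambda>n. \<bar>b k n\<bar>)" for k using sm by (simp add: b_def)
  have bigb: "e \<le> (\<Sum>n. \<bar>b k n\<bar>)" for k using big[of k] suminf_nonneg[OF smb[of k]] by (simp add: b_def)
  have wkb: "(\<lambda>k. \<Sum>n. c n * b k n) \<longlonglongrightarrow> 0" if "\<And>n. \<bar>c n\<bar> \<le> 1" for c
    using LIMSEQ_subseq_LIMSEQ[OF wk[OF that] s] by (simp add: o_def b_def)
  have pt: "(\<lambda>k. b k n) \<longlonglongrightarrow> 0" for n
  proof -
    have "(\<lambda>k. \<Sum>j. (if j = n then 1 else 0) * b k j) \<longlonglongrightarrow> 0" by (rule wkb) simp
    moreover have "(\<Sum>j. (if j = n then 1 else 0) * b k j) = b k n" for k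
      using suminf_finite[of "{n}" "\<lambda>j. (if j = n then 1 else 0) * b k j"] by auto
    ultimately show ?thesis by simp
  qed
  have head: "\<exists>m'>m. (\<Sum>n<N. \<bar>b m' n\<bar>) < e / 5" for m N
  proof -
    have "(\<lambda>k. \<Sum>n<N. \<bar>b k n\<bar>) \<longlonglongrightarrow> (\<Sum>n<N. \<bar>0::real\<bar>)"
      by (intro tendsto_intros pt)
    then have "\<forall>\<^sub>F k in sequentially. (\<Sum>n<N. \<bar>b k n\<bar>) < e / 5"
      by (rule order_tendstoD) (use e in simp)
    then have "\<forall>\<^sub>F k in sequentially. m < k \<and> (\<Sum>n<N. \<bar>b k n\<bar>) < e / 5"
      by (intro eventually_conj eventually_gt_at_top)
    then show ?thesis by (auto dest: eventually_happens)
  qed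
  have tail: "\<exists>N'>N. (\<Sum>n. \<bar>b m n\<bar>) - (\<Sum>n<N'. \<bar>b m n\<bar>) < e / 5" for m N
  proof -
    have "(\<lambda>N'. (\<Sum>n. \<bar>b m n\<bar>) - (\<Sum>n<N'. \<bar>b m n\<bar>)) \<longlonglongrightarrow> (\<Sum>n. \<bar>b m n\<bar>) - (\<Sum>n. \<bar>b m n\<bar>)"
      by (intro tendsto_intros summable_LIMSEQ smb)
    then have "\<forall>\<^sub>F N' in sequentially. (\<Sum>n. \<bar>b m n\<bar>) - (\<Sum>n<N'. \<bar>b m n\<bar>) < e / 5"
      by (rule order_tendstoD) (use e in simp)
    then have "\<forall>\<^sub>F N' in sequentially. N < N' \<and> (\<Sum>n. \<bar>b m n\<bar>) - (\<Sum>n<N'. \<bar>b m n\<bar>) < e / 5"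
      by (intro eventually_conj eventually_gt_at_top)
    then show ?thesis by (auto dest: eventually_happens)
  qed
  \<comment> \<open>A triple is a row \<open>m\<close> with a block from \<open>N\<close> to
    \<open>N'\<close> that carries its mass up to \<open>e / 5\<close> before and
    \<open>e / 5\<close> after the block; \<open>Q\<close> lets the next block begin where this one
    ends.\<close>
  define P where "P = (\<lambda>(m, N, N'). N < N' \<and> (\<Sum>n<N. \<bar>b m n\<bar>) < e / 5
      \<and> (\<Sum>n. \<bar>b m n\<bar>) - (\<Sum>n<N'. \<bar>b m n\<bar>) < e / 5)"
  define Q :: "nat \<times> nat \<times> nat \<Rightarrow> nat \<times> nat \<times> nat \<Rightarrow> bool"
    where "Q = (\<lambda>(m, N, N') (m1, N1, N1'). m < m1 \<and> N1 = N')"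
  have "\<exists>f. \<forall>k. P (f k) \<and> Q (f k) (f (Suc k))"
  proof (rule dependent_nat_choice)
    obtain N' where "0 < N'" "(\<Sum>n. \<bar>b 0 n\<bar>) - (\<Sum>n<N'. \<bar>b 0 n\<bar>) < e / 5" using tail[of 0 0] by auto
    then have "P (0, 0, N')" using e by (simp add: P_def)
    then show "\<exists>x. P x" ..
  next
    fix x :: "nat \<times> nat \<times> nat" and n :: nat
    obtain m N N' where x: "x = (m, N, N')" by (cases x) auto
    obtain m1 where m1: "m < m1" "(\<Sum>n<N'. \<bar>b m1 n\<bar>) < e / 5" using head by blast
    obtain N1 where "N' < N1" "(\<Sum>n. \<bar>b m1 n\<bar>) - (\<Sum>n<N1. \<bar>b m1 n\<bar>) < e / 5" using tail by blast
    with m1 have "P (m1, N', N1)" "Q x (m1, N', N1)" using x by (simp_all add: P_def Q_def)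
    then show "\<exists>y. P y \<and> Q x y" by blast
  qed
  then obtain f where f1: "\<And>k. P (f k)" and f2: "\<And>k. Q (f k) (f (Suc k))" by blast
  define m where "m k = fst (f k)" for k
  define N where "N k = fst (snd (f k))" for k
  have N': "snd (snd (f k)) = N (Suc k)" for k
    using f2[of k] by (auto simp: N_def Q_def split: prod.splits)
  have fk: "f k = (m k, N k, N (Suc k))" for k by (metis N' N_def m_def prod.collapse)
  have mm: "strict_mono m" unfolding strict_mono_Suc_iff using f2 by (simp add: fk Q_def)
  have NN: "N k < N (Suc k)" and hd: "(\<Sum>n<N k. \<bar>b (m k) n\<bar>) < e / 5"
    and tl: "(\<Sum>n. \<bar>b (m k) n\<bar>) - (\<Sum>n<N (Suc k). \<bar>b (m k) n\<bar>) < e / 5" for k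
    using f1[of k] by (simp_all add: fk P_def)
  have mN: "strict_mono N" unfolding strict_mono_Suc_iff using NN by simp
  \<comment> \<open>Blocks are consecutive, so each index from \<open>N 0\<close> on lies in exactly
    one of them. Indices below \<open>N 0\<close> are assigned to block 0 and count as head.\<close>
  define blk where "blk n = (LEAST k. n < N (Suc k))" for n
  have blk: "blk n = k" if "N k \<le> n" "n < N (Suc k)" for n k
    unfolding blk_def
  proof (rule Least_equality)
    show "k \<le> j" if "n < N (Suc j)" for j
    proof (rule ccontr)
      assume "\<not> k \<le> j"
      then have "N (Suc j) \<le> N k" using strict_mono_less_eq[OF mN] by simp
      with that \<open>N k \<le> n\<close> show False by simp
    qed
  qed (rule that)
  define c where "c n = sgn (b (m (blk n)) n)" for n
  have c1: "\<bar>c n\<bar> \<le> 1" for n by (simp add: c_def sgn_real_def)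
  have "e / 5 \<le> \<bar>\<Sum>n. c n * b (m k) n\<bar>" for k
  proof -
    let ?b = "b (m k)"
    have sc: "summable (\<lambda>n. c n * ?b n)"
      by (rule summable_comparison_test'[OF smb[of "m k"]])
        (use c1 in \<open>auto simp: abs_mult intro: mult_left_le_one_le\<close>)
    have sd: "summable (\<lambda>n. \<bar>?b n\<bar> - c n * ?b n)" by (intro summable_diff smb sc)
    have d2: "\<bar>?b n\<bar> - c n * ?b n \<le> 2 * \<bar>?b n\<bar>" for n
    proof -
      have "\<bar>c n * ?b n\<bar> \<le> \<bar>?b n\<bar>" using c1[of n] by (auto simp: abs_mult intro: mult_left_le_one_le)
      then show ?thesis by linarith
    qed
    have zero: "\<bar>?b n\<bar> - c n * ?b n = 0" if "N k \<le> n" "n < N (Suc k)" for n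
      using blk[OF that] by (simp add: c_def abs_sgn mult.commute)
    have le: "N k \<le> N (Suc k)" using NN[of k] by simp
    \<comment> \<open>The loss \<open>\<bar>?b n\<bar> - c n * ?b n\<close> vanishes on the block
      and is at most \<open>2 * \<bar>?b n\<bar>\<close> elsewhere. Head and tail cost
      \<open>2 * (e / 5)\<close> each, which leaves \<open>e / 5\<close> of the mass
      \<open>e\<close>.\<close>
    have "(\<Sum>n. \<bar>?b n\<bar>) - (\<Sum>n. c n * ?b n) = (\<Sum>n. \<bar>?b n\<bar> - c n * ?b n)"
      by (rule suminf_diff[OF smb sc])
    also have "\<dots> = (\<Sum>n. \<bar>?b (n + N (Suc k))\<bar> - c (n + N (Suc k)) * ?b (n + N (Suc k)))
        + (\<Sum>n<N (Suc k). \<bar>?b n\<bar> - c n * ?b n)"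
      by (rule suminf_split_initial_segment[OF sd])
    also have "(\<Sum>n<N (Suc k). \<bar>?b n\<bar> - c n * ?b n) = (\<Sum>n<N k. \<bar>?b n\<bar> - c n * ?b n)"
      using le zero by (intro sum.mono_neutral_right) auto
    also have "\<dots> \<le> (\<Sum>n<N k. 2 * \<bar>?b n\<bar>)" by (intro sum_mono d2)
    also have "\<dots> = 2 * (\<Sum>n<N k. \<bar>?b n\<bar>)" by (simp add: sum_distrib_left)
    also have "\<dots> \<le> 2 * (e / 5)" using hd[of k] by simp
    also have "(\<Sum>n. \<bar>?b (n + N (Suc k))\<bar> - c (n + N (Suc k)) * ?b (n + N (Suc k)))
        \<le> (\<Sum>n. 2 * \<bar>?b (n + N (Suc k))\<bar>)"
      using sd smb[of "m k"] by (intro suminf_le d2 summable_mult summable_ignore_initial_segment)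
        (simp_all add: summable_iff_shift[of "\<lambda>n. \<bar>?b n\<bar> - c n * ?b n"])
    also have "\<dots> = 2 * (\<Sum>n. \<bar>?b (n + N (Suc k))\<bar>)"
      using smb[of "m k"] by (intro suminf_mult) (simp add: summable_iff_shift[of "\<lambda>n. \<bar>?b n\<bar>"])
    also have "\<dots> \<le> 2 * (e / 5)"
      using tl[of k] suminf_split_initial_segment[OF smb[of "m k"], of "N (Suc k)"] by simp
    finally have "(\<Sum>n. \<bar>?b n\<bar>) - (\<Sum>n. c n * ?b n) \<le> 4 * (e / 5)" by simp
    with bigb[of "m k"] show ?thesis by linarith
  qed
  moreover have "(\<lambda>k. \<Sum>n. c n * b (m k) n) \<longlonglongrightarrow> 0"
    using LIMSEQ_subseq_LIMSEQ[OF wkb[OF c1] mm] by (simp add: o_def)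
  then have "\<exists>k. \<bar>\<Sum>n. c n * b (m k) n\<bar> < e / 5"
    using e LIMSEQ_D[of _ 0 "e / 5"] by fastforce
  ultimately show False by (meson not_le)
qed

text \<open>\<open>g \<mapsto> (\<lambda>n. \<psi> n g)\<close> is a bounded operator into
  \<open>\<ell>\<^sub>1\<close>. Every bounded \<open>c\<close> pulls back to a functional
  \<open>\<Phi>\<close> on the original space, so weak nullity of \<open>f\<close> passes to the
  rows, where the Schur property applies.\<close>

lemma schur:
  fixes f :: "nat \<Rightarrow> 'v::real_normed_vector" and \<psi> :: "nat \<Rightarrow> ('v \<Rightarrow>\<^sub>L real)"
  assumes f: "weakly_null f" and bd: "\<And>g N. (\<Sum>n<N. \<bar>\<psi> n g\<bar>) \<le> C * norm g"
  shows "summable (\<lambda>n. \<bar>\<psi> n g\<bar>)" "(\<lambda>m. \<Sum>n. \<bar>\<psi> n (f m)\<bar>) \<longlonglongrightarrow> 0"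
proof -
  show sm: "summable (\<lambda>n. \<bar>\<psi> n g\<bar>)" for g
  proof (rule bounded_imp_summable[where B="C * norm g"])
    show "(\<Sum>n\<le>N. \<bar>\<psi> n g\<bar>) \<le> C * norm g" for N
      using bd[where N="Suc N" and g=g] by (simp add: lessThan_Suc_atMost)
  qed simp
  have le: "(\<Sum>n. \<bar>\<psi> n g\<bar>) \<le> C * norm g" for g
    by (rule suminf_le_const[OF sm bd])
  show "(\<lambda>m. \<Sum>n. \<bar>\<psi> n (f m)\<bar>) \<longlonglongrightarrow> 0"
  proof (rule schur_rows[OF sm])
    fix c :: "nat \<Rightarrow> real" assume c: "\<And>n. \<bar>c n\<bar> \<le> 1"
    have cle: "\<bar>c n * \<psi> n g\<bar> \<le> \<bar>\<psi> n g\<bar>" for n g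
      using c[of n] by (auto simp: abs_mult intro: mult_left_le_one_le)
    have sa: "summable (\<lambda>n. \<bar>c n * \<psi> n g\<bar>)" for g
      by (rule summable_comparison_test'[OF sm[of g]]) (use cle in auto)
    have sc: "summable (\<lambda>n. c n * \<psi> n g)" for g
      by (rule summable_rabs_cancel[OF sa])
    define \<Phi> where "\<Phi> g = (\<Sum>n. c n * \<psi> n g)" for g
    have "bounded_linear \<Phi>"
    proof (rule bounded_linear_intro)
      show "\<Phi> (x + y) = \<Phi> x + \<Phi> y" for x y
        unfolding \<Phi>_def by (simp add: blinfun.add_right distrib_left suminf_add[OF sc sc])
      show "\<Phi> (r *\<^sub>R x) = r *\<^sub>R \<Phi> x" for r x
        using suminf_mult[OF sc[of x], of r] by (simp add: \<Phi>_def blinfun.scaleR_right mult.left_commute)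
      show "norm (\<Phi> x) \<le> norm x * C" for x
      proof -
        have "\<bar>\<Phi> x\<bar> \<le> (\<Sum>n. \<bar>c n * \<psi> n x\<bar>)" unfolding \<Phi>_def by (rule summable_rabs[OF sa])
        also have "\<dots> \<le> (\<Sum>n. \<bar>\<psi> n x\<bar>)" by (rule suminf_le[OF cle sa sm])
        also note le
        finally show ?thesis by (simp add: mult.commute)
      qed
    qed
    then have "blinfun_apply (Blinfun \<Phi>) = \<Phi>" by (rule bounded_linear_Blinfun_apply)
    with weakly_nullD[OF f, of "Blinfun \<Phi>"] show "(\<lambda>m. \<Sum>n. c n * \<psi> n (f m)) \<longlonglongrightarrow> 0"
      by (simp add: \<Phi>_def)
  qed
qed

text \<open>Otherwise a greedy choice gives many sets whose pairwise intersections are so small that the measure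
  of their union exceeds \<open>\<mu> UNIV\<close>.\<close>

lemma infinite_intersecting_step:
  fixes \<mu> :: "'b set \<Rightarrow> real" and A :: "nat \<Rightarrow> 'b set"
  assumes add: "\<And>X Y. X \<inter> Y = {} \<Longrightarrow> \<mu> (X \<union> Y) = \<mu> X + \<mu> Y"
    and nn: "\<And>X. 0 \<le> \<mu> X"
    and M: "infinite M" and d: "0 < d" and ge: "\<And>m. m \<in> M \<Longrightarrow> d \<le> \<mu> (B \<inter> A m)"
  shows "\<exists>m\<in>M. \<exists>M'\<subseteq>M. \<exists>d'>0. infinite M' \<and> (\<forall>j\<in>M'. d' \<le> \<mu> (B \<inter> A m \<inter> A j))"
proof (rule ccontr)
  assume no: "\<not> ?thesis"
  have mono: "\<mu> X \<le> \<mu> Y" if "X \<subseteq> Y" for X Y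
    using add[of X "Y - X"] nn[of "Y - X"] that by (simp add: Un_absorb1)
  have sub: "\<mu> (X \<union> Y) \<le> \<mu> X + \<mu> Y" for X Y
    using add[of X "Y - X"] mono[of "Y - X" Y] by simp
  have subs: "\<mu> (\<Union>i\<in>F. X i) \<le> (\<Sum>i\<in>F. \<mu> (X i))" if "finite F" for F :: "nat set" and X
    using that
  proof (induction F rule: finite_induct)
    case empty
    show ?case using add[of "{}" "{}"] by simp
  next
    case (insert a F)
    then show ?case using sub[of "X a" "\<Union>i\<in>F. X i"] by simp
  qed
  obtain N :: nat where N: "2 * \<mu> UNIV / d < N" using reals_Archimedean2 by blast
  have N0: "0 < N"
  proof -
    have "0 \<le> 2 * \<mu> UNIV / d" using nn d by simp
    with N have "0 < real N" by linarith
    then show ?thesis by simp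
  qed
  \<comment> \<open>Overlaps below \<open>\<eta>\<close> with at most \<open>N\<close> chosen sets
    remove at most \<open>N * \<eta> = d / 2\<close> from a new set, so each adds at least
    \<open>d / 2\<close>; \<open>N\<close> of them exceed \<open>\<mu> UNIV\<close> since
    \<open>2 * \<mu> UNIV / d < N\<close>.\<close>
  define \<eta> where "\<eta> = d / (2 * N)"
  have \<eta>: "0 < \<eta>" using d N0 by (simp add: \<eta>_def)
  have fin: "finite {j \<in> M. \<eta> \<le> \<mu> (B \<inter> A m \<inter> A j)}" if "m \<in> M" for m
  proof (rule ccontr)
    assume "infinite {j \<in> M. \<eta> \<le> \<mu> (B \<inter> A m \<inter> A j)}"
    with no \<eta> that show False by (metis (no_types, lifting) mem_Collect_eq subsetI)
  qed
  have "\<exists>F. finite F \<and> F \<subseteq> M \<and> card F = k \<and> k * (d / 2) \<le> \<mu> (\<Union>i\<in>F. B \<inter> A i)" if "k \<le> N" for k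
    using that
  proof (induction k)
    case 0
    show ?case using nn by (intro exI[of _ "{}"]) auto
  next
    case (Suc k)
    then obtain F where F: "finite F" "F \<subseteq> M" "card F = k" "k * (d / 2) \<le> \<mu> (\<Union>i\<in>F. B \<inter> A i)" by auto
    \<comment> \<open>\<open>G\<close> collects the chosen indices and those overlapping a chosen
      set too much. By \<open>fin\<close> it is finite, so the infinite \<open>M\<close> still
      offers an admissible \<open>j\<close>.\<close>
    define G where "G = F \<union> (\<Union>m\<in>F. {j \<in> M. \<eta> \<le> \<mu> (B \<inter> A m \<inter> A j)})"
    have "finite G" using F fin by (auto simp: G_def)
    then obtain j where "j \<in> M" "j \<notin> G" using M by (meson finite_subset subsetI)
    then have j: "j \<in> M" "j \<notin> F" "\<And>m. m \<in> F \<Longrightarrow> \<mu> (B \<inter> A m \<inter> A j) < \<eta>"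
      by (auto simp: G_def not_le[symmetric])
    let ?U = "\<Union>i\<in>F. B \<inter> A i"
    have "\<mu> (B \<inter> A j) = \<mu> ((B \<inter> A j - ?U) \<union> (B \<inter> A j \<inter> ?U))" by (rule arg_cong[where f=\<mu>]) auto
    also have "\<dots> = \<mu> (B \<inter> A j - ?U) + \<mu> (B \<inter> A j \<inter> ?U)" by (rule add) auto
    also have "B \<inter> A j \<inter> ?U = (\<Union>i\<in>F. B \<inter> A i \<inter> A j)" by auto
    also have "\<mu> \<dots> \<le> (\<Sum>i\<in>F. \<mu> (B \<inter> A i \<inter> A j))" by (rule subs[OF F(1)])
    also have "\<dots> \<le> (\<Sum>i\<in>F. \<eta>)" by (intro sum_mono) (use j in force)
    also have "\<dots> = k * \<eta>" using F by simp
    also have "\<dots> \<le> N * \<eta>" using Suc.prems \<eta> by (intro mult_right_mono) auto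
    also have "\<dots> = d / 2" using N0 by (simp add: \<eta>_def)
    finally have "d / 2 \<le> \<mu> (B \<inter> A j - ?U)" using ge[OF j(1)] by simp
    moreover have "\<mu> (?U \<union> (B \<inter> A j - ?U)) = \<mu> ?U + \<mu> (B \<inter> A j - ?U)" by (rule add) auto
    moreover have "?U \<union> (B \<inter> A j - ?U) = (\<Union>i\<in>insert j F. B \<inter> A i)" by auto
    ultimately have "Suc k * (d / 2) \<le> \<mu> (\<Union>i\<in>insert j F. B \<inter> A i)" using F(4) by (simp add: algebra_simps)
    then show ?case using F j by (intro exI[of _ "insert j F"]) auto
  qed
  then obtain F where "N * (d / 2) \<le> \<mu> (\<Union>i\<in>F. B \<inter> A i)" by blast
  also have "\<dots> \<le> \<mu> UNIV" by (rule mono) simp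
  finally show False using N d by (simp add: field_simps)
qed

text \<open>The state holds the intersection \<open>B\<close> of the sets chosen before
  \<open>m\<close> and an infinite reservoir \<open>M'\<close> of indices whose sets meet
  \<open>B \<inter> A m\<close> in measure at least \<open>d'\<close>. The bound \<open>d'\<close>
  may shrink at every stage; its positivity keeps the finite intersections nonempty.\<close>

lemma infinite_finite_intersection:
  fixes \<mu> :: "'b set \<Rightarrow> real" and A :: "nat \<Rightarrow> 'b set"
  assumes add: "\<And>X Y. X \<inter> Y = {} \<Longrightarrow> \<mu> (X \<union> Y) = \<mu> X + \<mu> Y"
    and nn: "\<And>X. 0 \<le> \<mu> X"
    and M: "infinite M" and d: "0 < d" and ge: "\<And>m. m \<in> M \<Longrightarrow> d \<le> \<mu> (A m)"
  obtains s :: "nat \<Rightarrow> nat" where "strict_mono s" "\<And>k. s k \<in> M" "\<And>n. (\<Inter>k<n. A (s k)) \<noteq> {}"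
proof -
  define P :: "nat \<times> 'b set \<times> nat set \<times> real \<Rightarrow> bool"
    where "P = (\<lambda>(m, B, M', d'). m \<in> M \<and> infinite M' \<and> M' \<subseteq> M \<and> (0::real) < d'
      \<and> (\<forall>j\<in>M'. d' \<le> \<mu> (B \<inter> A m \<inter> A j) \<and> m < j))"
  define Q :: "nat \<times> 'b set \<times> nat set \<times> real \<Rightarrow> nat \<times> 'b set \<times> nat set \<times> real \<Rightarrow> bool"
    where "Q = (\<lambda>(m, B, M', d') (m1, B1, M1, d1). m1 \<in> M' \<and> B1 = B \<inter> A m)"
  have step: "\<exists>m\<in>M'. \<exists>M1 d1. P (m, B, M1, d1)"
    if "infinite M'" "M' \<subseteq> M" "0 < d'" "\<And>j. j \<in> M' \<Longrightarrow> d' \<le> \<mu> (B \<inter> A j)" for M' B d'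
  proof -
    note hyps = that
    have "\<exists>m\<in>M'. \<exists>M1\<subseteq>M'. \<exists>d1>0. infinite M1 \<and> (\<forall>j\<in>M1. d1 \<le> \<mu> (B \<inter> A m \<inter> A j))"
      by (rule infinite_intersecting_step[OF _ nn hyps(1,3)]) (simp_all add: add hyps(4))
    then obtain m M1 d1 where 1: "m \<in> M'" "M1 \<subseteq> M'" "0 < d1" "infinite M1" "\<And>j. j \<in> M1 \<Longrightarrow> d1 \<le> \<mu> (B \<inter> A m \<inter> A j)"
      by blast
    \<comment> \<open>Discarding the indices up to \<open>m\<close> makes the selected sequence
      strictly increasing.\<close>
    have "infinite (M1 - {..m})" using 1 by simp
    then have "P (m, B, M1 - {..m}, d1)" using 1 hyps(2) unfolding P_def by auto
    then show ?thesis using 1 by blast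
  qed
  have "\<exists>f. \<forall>k. P (f k) \<and> Q (f k) (f (Suc k))"
  proof (rule dependent_nat_choice)
    show "\<exists>x. P x" using step[of M d UNIV] M d ge by auto
  next
    fix x :: "nat \<times> 'b set \<times> nat set \<times> real" and n :: nat assume Px: "P x"
    obtain m B M' d' where x: "x = (m, B, M', d')" by (cases x) auto
    have P': "infinite M'" "M' \<subseteq> M" "0 < d'" "\<And>j. j \<in> M' \<Longrightarrow> d' \<le> \<mu> (B \<inter> A m \<inter> A j)"
      using Px by (auto simp: x P_def)
    obtain m1 M1 d1 where "m1 \<in> M'" "P (m1, B \<inter> A m, M1, d1)" using step[OF P'] by blast
    moreover from this have "Q x (m1, B \<inter> A m, M1, d1)" by (simp add: Q_def x)
    ultimately show "\<exists>y. P y \<and> Q x y" by blast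
  qed
  then obtain f where P: "\<And>k. P (f k)" and Q: "\<And>k. Q (f k) (f (Suc k))" by blast
  define s where "s k = fst (f k)" for k
  define B where "B k = fst (snd (f k))" for k
  define M' where "M' k = fst (snd (snd (f k)))" for k
  define d' where "d' k = snd (snd (snd (f k)))" for k
  have f: "f k = (s k, B k, M' k, d' k)" for k by (simp add: s_def B_def M'_def d'_def)
  have sM: "s k \<in> M" and inf: "infinite (M' k)" and dp: "0 < d' k"
    and ge': "\<And>j. j \<in> M' k \<Longrightarrow> d' k \<le> \<mu> (B k \<inter> A (s k) \<inter> A j)"
    and lt': "\<And>j. j \<in> M' k \<Longrightarrow> s k < j" for k
    using P[of k] by (simp_all add: f P_def)
  have s': "s (Suc k) \<in> M' k" and BS: "B (Suc k) = B k \<inter> A (s k)" for k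
    using Q[of k] by (simp_all add: f Q_def)
  have B: "B k \<subseteq> (\<Inter>j<k. A (s j))" for k
  proof (induction k)
    case (Suc k)
    then have "B (Suc k) \<subseteq> A (s k) \<inter> (\<Inter>j<k. A (s j))" by (auto simp only: BS)
    also have "\<dots> = (\<Inter>j<Suc k. A (s j))" by (simp add: lessThan_Suc)
    finally show ?case .
  qed simp
  show thesis
  proof (rule that)
    show "strict_mono s" unfolding strict_mono_Suc_iff using lt' s' by simp
    show "s k \<in> M" for k by (rule sM)
    show "(\<Inter>k<n. A (s k)) \<noteq> {}" for n
    proof
      assume "(\<Inter>k<n. A (s k)) = {}"
      then have "B n = {}" using B[of n] by auto
      moreover have "\<mu> {} = 0" using add[of "{}" "{}"] by simp
      moreover obtain j where "j \<in> M' n" using infinite_imp_nonempty[OF inf] by blast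
      ultimately show False using ge'[of j n] dp[of n] by simp
    qed
  qed
qed

section \<open>Operators factoring through \<open>\<ell>\<^sub>\<infinity>\<close>\<close>

lemma bounded_linear_real_limit:
  fixes \<alpha> :: "nat \<Rightarrow> 'v::real_normed_vector \<Rightarrow>\<^sub>L real"
  assumes conv: "\<And>g. convergent (\<lambda>L. \<alpha> L g)" and le: "\<And>L g. \<bar>\<alpha> L g\<bar> \<le> C * norm g"
  obtains \<psi> :: "'v \<Rightarrow>\<^sub>L real" where "\<And>g. (\<lambda>L. \<alpha> L g) \<longlonglongrightarrow> \<psi> g"
proof -
  define \<psi> where "\<psi> g = lim (\<lambda>L. \<alpha> L g)" for g
  have lim: "(\<lambda>L. \<alpha> L g) \<longlonglongrightarrow> \<psi> g" for g using conv by (simp add: \<psi>_def convergent_LIMSEQ_iff)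
  have "bounded_linear \<psi>"
  proof (rule bounded_linear_intro)
    show "\<psi> (x + y) = \<psi> x + \<psi> y" for x y
      using tendsto_add[OF lim lim, of x y] lim[of "x + y"] LIMSEQ_unique by (simp add: blinfun.add_right) blast
    show "\<psi> (r *\<^sub>R x) = r *\<^sub>R \<psi> x" for r x
      using tendsto_mult_left[OF lim, of r x] lim[of "r *\<^sub>R x"] LIMSEQ_unique by (simp add: blinfun.scaleR_right) blast
    show "norm (\<psi> x) \<le> norm x * C" for x
      by (rule LIMSEQ_le_const2[OF tendsto_norm[OF lim]]) (use le[of _ x] in \<open>auto simp: mult.commute\<close>)
  qed
  then have "blinfun_apply (Blinfun \<psi>) = \<psi>" by (rule bounded_linear_Blinfun_apply)
  with lim that[of "Blinfun \<psi>"] show thesis by simp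
qed

text \<open>The data of a positive operator \<open>J\<close> from
  \<open>\<ell>\<^sub>\<infinity>\<close> into the lattice that sends the unit vectors to the
  \<open>d n\<close> and the constant 1 to an element below \<open>u\<close>. Elements of
  \<open>\<ell>\<^sub>\<infinity>\<close> are plain functions satisfying \<open>bseq\<close>, and
  their order is pointwise.\<close>

locale order_bounded_series =
  fixes d :: "nat \<Rightarrow> 'a::banach_lattice" and u :: 'a
  assumes complete: "dedekind_sigma_complete TYPE('a)"
    and d_nonneg: "0 \<le> d n" and d_sum_le: "(\<Sum>n<N. d n) \<le> u"
begin

definition partial :: "(nat \<Rightarrow> real) \<Rightarrow> nat \<Rightarrow> 'a" where
  "partial a N = (\<Sum>n<N. a n *\<^sub>R d n)"

definition S :: "(nat \<Rightarrow> real) \<Rightarrow> 'a" where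
  "S a = (SOME s. (\<forall>N. partial a N \<le> s) \<and> (\<forall>b. (\<forall>N. partial a N \<le> b) \<longrightarrow> s \<le> b))"

definition bseq :: "(nat \<Rightarrow> real) \<Rightarrow> bool" where
  "bseq a \<longleftrightarrow> (\<exists>c. \<forall>n. \<bar>a n\<bar> \<le> c)"

text \<open>\<open>S\<close> is the order sum where the partial sums increase, that is, for
  nonnegative bounded coefficients; \<open>J\<close> extends it linearly by splitting into positive
  and negative parts.\<close>

definition J :: "(nat \<Rightarrow> real) \<Rightarrow> 'a" where
  "J a = S (\<lambda>n. max (a n) 0) - S (\<lambda>n. max (- a n) 0)"

lemma u_nonneg: "0 \<le> u"
  using d_sum_le[of 0] by simp

lemma bseqI: "(\<And>n. \<bar>a n\<bar> \<le> c) \<Longrightarrow> bseq a"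
  by (auto simp: bseq_def)

lemma bseq_add: "bseq a \<Longrightarrow> bseq b \<Longrightarrow> bseq (\<lambda>n. a n + b n)"
  unfolding bseq_def by (meson abs_triangle_ineq add_mono order_trans)

lemma bseq_scale: "bseq a \<Longrightarrow> bseq (\<lambda>n. r * a n)"
  unfolding bseq_def by (metis abs_ge_zero abs_mult mult_left_mono)

lemma bseq_diff: "bseq a \<Longrightarrow> bseq b \<Longrightarrow> bseq (\<lambda>n. a n - b n)"
  using bseq_add[of a "\<lambda>n. - 1 * b n"] bseq_scale[of b "-1"] by simp

lemma bseq_sum: "finite I \<Longrightarrow> (\<And>i. i \<in> I \<Longrightarrow> bseq (a i)) \<Longrightarrow> bseq (\<lambda>n. \<Sum>i\<in>I. a i n)"
proof (induction I rule: finite_induct)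
  case empty
  show ?case by (rule bseqI[of _ 0]) simp
next
  case (insert i I)
  then show ?case using bseq_add[of "a i" "\<lambda>n. \<Sum>i\<in>I. a i n"] by simp
qed

lemma bseq_mono: "bseq b \<Longrightarrow> (\<And>n. \<bar>a n\<bar> \<le> \<bar>b n\<bar>) \<Longrightarrow> bseq a"
  unfolding bseq_def using order_trans by blast

lemma bseq_indicator: "bseq (indicat_real A)"
  by (rule bseqI[where c=1]) (simp add: indicator_def)

lemma partial_le:
  assumes "\<And>n. 0 \<le> a n" "\<And>n. a n \<le> c"
  shows "partial a N \<le> c *\<^sub>R u"
proof -
  have c: "0 \<le> c" using assms order_trans by blast
  have "partial a N \<le> c *\<^sub>R (\<Sum>n<N. d n)"
    unfolding partial_def scaleR_sum_right using assms d_nonneg by (intro sum_mono scaleR_right_mono) auto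
  also have "\<dots> \<le> c *\<^sub>R u" using c d_sum_le by (rule scaleR_left_mono[rotated])
  finally show ?thesis .
qed

lemma partial_mono:
  assumes "\<And>n. 0 \<le> a n" "N \<le> M"
  shows "partial a N \<le> partial a M"
  unfolding partial_def using assms d_nonneg by (intro sum_mono2) (auto intro: scaleR_nonneg_nonneg)

lemma S_lub:
  assumes nn: "\<And>n. 0 \<le> a n" and b: "bseq a"
  shows "partial a N \<le> S a" "(\<And>N. partial a N \<le> z) \<Longrightarrow> S a \<le> z"
proof -
  obtain c where c: "\<And>n. a n \<le> c" using b unfolding bseq_def by (meson abs_le_D1)
  have "countable (range (partial a)) \<and> range (partial a) \<noteq> {} \<and> bdd_above (range (partial a))"
    using partial_le[OF nn c] by (auto intro!: bdd_aboveI2)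
  then obtain s where "\<forall>x\<in>range (partial a). x \<le> s" "\<forall>b. (\<forall>x\<in>range (partial a). x \<le> b) \<longrightarrow> s \<le> b"
    using complete unfolding dedekind_sigma_complete_def by meson
  then have "\<exists>s. (\<forall>N. partial a N \<le> s) \<and> (\<forall>b. (\<forall>N. partial a N \<le> b) \<longrightarrow> s \<le> b)" by auto
  from someI_ex[OF this] have "(\<forall>N. partial a N \<le> S a) \<and> (\<forall>b. (\<forall>N. partial a N \<le> b) \<longrightarrow> S a \<le> b)"
    unfolding S_def .
  then show "partial a N \<le> S a" "(\<And>N. partial a N \<le> z) \<Longrightarrow> S a \<le> z" by auto
qed

lemma S_nonneg: "(\<And>n. 0 \<le> a n) \<Longrightarrow> bseq a \<Longrightarrow> 0 \<le> S a"
  using S_lub(1)[of a 0] by (simp add: partial_def)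

lemma S_le: "(\<And>n. 0 \<le> a n) \<Longrightarrow> (\<And>n. a n \<le> c) \<Longrightarrow> S a \<le> c *\<^sub>R u"
  by (rule S_lub(2)) (auto intro: partial_le bseqI[of a c])

lemma S_add:
  assumes a: "\<And>n. 0 \<le> a n" "bseq a" and b: "\<And>n. 0 \<le> b n" "bseq b"
  shows "S (\<lambda>n. a n + b n) = S a + S b"
proof (rule antisym)
  have pa: "partial (\<lambda>n. a n + b n) N = partial a N + partial b N" for N
    by (simp add: partial_def scaleR_add_left sum.distrib)
  have nn: "0 \<le> a n + b n" for n using a b by simp
  show "S (\<lambda>n. a n + b n) \<le> S a + S b"
    by (rule S_lub(2)[OF nn bseq_add[OF a(2) b(2)]]) (auto simp: pa intro!: add_mono S_lub(1) a b)
  \<comment> \<open>Two independent indices, because the suprema \<open>S a\<close> and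
    \<open>S b\<close> are taken one after the other.\<close>
  have *: "partial a N + partial b M \<le> S (\<lambda>n. a n + b n)" for N M
  proof -
    have "partial a N + partial b M \<le> partial a (max N M) + partial b (max N M)"
      by (intro add_mono partial_mono a b) auto
    also have "\<dots> \<le> S (\<lambda>n. a n + b n)"
      using S_lub(1)[OF nn bseq_add[OF a(2) b(2)]] by (simp add: pa)
    finally show ?thesis .
  qed
  have "S a \<le> S (\<lambda>n. a n + b n) - S b"
  proof (rule S_lub(2)[OF a])
    fix N
    have "S b \<le> S (\<lambda>n. a n + b n) - partial a N"
      by (rule S_lub(2)[OF b]) (use * in \<open>simp add: le_diff_eq add.commute\<close>)
    then show "partial a N \<le> S (\<lambda>n. a n + b n) - S b" by (simp add: le_diff_eq add.commute)
  qed
  then show "S a + S b \<le> S (\<lambda>n. a n + b n)" by (simp add: le_diff_eq)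
qed

lemma S_scale:
  assumes a: "\<And>n. 0 \<le> a n" "bseq a" and r: "0 \<le> r"
  shows "S (\<lambda>n. r * a n) = r *\<^sub>R S a"
proof -
  have pa: "partial (\<lambda>n. r * a n) N = r *\<^sub>R partial a N" for r a N
    by (simp add: partial_def scaleR_sum_right)
  have le: "S (\<lambda>n. r * a n) \<le> r *\<^sub>R S a" if a: "\<And>n. 0 \<le> a n" "bseq a" and r: "0 \<le> r" for r a
    by (rule S_lub(2)[OF _ bseq_scale[OF a(2)]]) (auto simp: pa a r intro!: scaleR_left_mono S_lub(1))
  show ?thesis
  proof (cases "r = 0")
    case True
    have "0 \<le> S (\<lambda>n. r * a n)" by (rule S_nonneg) (use a r bseq_scale in auto)
    with le[OF a r] True show ?thesis by simp
  next
    case False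
    with r have r: "0 < r" by simp
    have "S (\<lambda>n. inverse r * (r * a n)) \<le> inverse r *\<^sub>R S (\<lambda>n. r * a n)"
      by (rule le) (use a r bseq_scale in auto)
    also have "(\<lambda>n. inverse r * (r * a n)) = a" using r by auto
    finally have "r *\<^sub>R S a \<le> r *\<^sub>R (inverse r *\<^sub>R S (\<lambda>n. r * a n))" using r by (intro scaleR_left_mono) auto
    then have "r *\<^sub>R S a \<le> S (\<lambda>n. r * a n)" using r by simp
    then show ?thesis using le[OF a] r by (intro antisym) auto
  qed
qed

lemma J_eq:
  assumes p: "\<And>n. 0 \<le> p n" "bseq p" and q: "\<And>n. 0 \<le> q n" "bseq q" and a: "\<And>n. a n = p n - q n"
  shows "J a = S p - S q"
proof -
  have ba: "bseq a" using bseq_diff[OF p(2) q(2)] a by (simp add: bseq_def)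
  have bm: "bseq (\<lambda>n. max (a n) 0)" "bseq (\<lambda>n. max (- a n) 0)" by (auto intro!: bseq_mono[OF ba])
  have "S (\<lambda>n. max (a n) 0 + q n) = S (\<lambda>n. max (- a n) 0 + p n)"
    by (rule arg_cong[where f=S]) (auto simp: a max_def)
  then have "S (\<lambda>n. max (a n) 0) + S q = S (\<lambda>n. max (- a n) 0) + S p"
    using S_add[OF _ bm(1) q] S_add[OF _ bm(2) p] by simp
  then show ?thesis by (simp add: J_def algebra_simps)
qed

lemma J_nonneg_eq:
  assumes "\<And>n. 0 \<le> a n" "bseq a"
  shows "J a = S a"
proof -
  have "S (\<lambda>n. 0 * a n) = 0" using S_scale[OF assms, of 0] by simp
  then have "S (\<lambda>n. 0) = 0" by simp
  then show ?thesis using J_eq[OF assms, of "\<lambda>n. 0" a] by (simp add: bseq_def exI[of _ 0])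
qed

lemma bseq_max: "bseq a \<Longrightarrow> bseq (\<lambda>n. max (a n) 0)" "bseq a \<Longrightarrow> bseq (\<lambda>n. max (- a n) 0)"
  by (auto intro: bseq_mono)

lemma J_add:
  assumes "bseq a" "bseq b"
  shows "J (\<lambda>n. a n + b n) = J a + J b"
proof -
  note bm = bseq_max[OF assms(1)] bseq_max[OF assms(2)]
  have "J (\<lambda>n. a n + b n) = S (\<lambda>n. max (a n) 0 + max (b n) 0) - S (\<lambda>n. max (- a n) 0 + max (- b n) 0)"
    by (rule J_eq) (auto intro!: bseq_add bm)
  also have "S (\<lambda>n. max (a n) 0 + max (b n) 0) = S (\<lambda>n. max (a n) 0) + S (\<lambda>n. max (b n) 0)"
    by (rule S_add) (auto intro: bm)
  also have "S (\<lambda>n. max (- a n) 0 + max (- b n) 0) = S (\<lambda>n. max (- a n) 0) + S (\<lambda>n. max (- b n) 0)"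
    by (rule S_add) (auto intro: bm)
  finally show ?thesis by (simp add: J_def)
qed

lemma J_scale:
  assumes "bseq a"
  shows "J (\<lambda>n. r * a n) = r *\<^sub>R J a"
proof (cases "0 \<le> r")
  case True
  have "J (\<lambda>n. r * a n) = S (\<lambda>n. r * max (a n) 0) - S (\<lambda>n. r * max (- a n) 0)"
    using True by (intro J_eq bseq_scale bseq_max assms) (auto simp: max_def)
  also have "\<dots> = r *\<^sub>R J a"
    using True bseq_max[OF assms] by (simp add: S_scale J_def scaleR_diff_right)
  finally show ?thesis .
next
  case False
  have "J (\<lambda>n. r * a n) = S (\<lambda>n. (- r) * max (- a n) 0) - S (\<lambda>n. (- r) * max (a n) 0)"
    using False by (intro J_eq bseq_scale bseq_max assms) (auto simp: max_def mult_nonpos_nonneg)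
  also have "\<dots> = (- r) *\<^sub>R S (\<lambda>n. max (- a n) 0) - (- r) *\<^sub>R S (\<lambda>n. max (a n) 0)"
    using False bseq_max[OF assms] by (intro arg_cong2[where f="(-)"] S_scale) auto
  also have "\<dots> = r *\<^sub>R J a" by (simp add: J_def scaleR_diff_right)
  finally show ?thesis .
qed

lemma J_diff:
  assumes "bseq a" "bseq b"
  shows "J (\<lambda>n. a n - b n) = J a - J b"
  using J_add[OF assms(1) bseq_scale[OF assms(2), of "-1"]] J_scale[OF assms(2), of "-1"] by simp

lemma J_nonneg: "(\<And>n. 0 \<le> a n) \<Longrightarrow> bseq a \<Longrightarrow> 0 \<le> J a"
  by (simp add: J_nonneg_eq S_nonneg)

lemma J_mono: "bseq a \<Longrightarrow> bseq b \<Longrightarrow> (\<And>n. a n \<le> b n) \<Longrightarrow> J a \<le> J b"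
  using J_nonneg[of "\<lambda>n. b n - a n"] by (simp add: J_diff bseq_diff)

lemma J_sum:
  "finite I \<Longrightarrow> (\<And>i. i \<in> I \<Longrightarrow> bseq (a i)) \<Longrightarrow> J (\<lambda>n. \<Sum>i\<in>I. a i n) = (\<Sum>i\<in>I. J (a i))"
proof (induction I rule: finite_induct)
  case empty
  show ?case using J_scale[of "\<lambda>n. 0" 0] by (simp add: bseq_def exI[of _ 0])
next
  case (insert i I)
  then show ?case using J_add[of "a i" "\<lambda>n. \<Sum>i\<in>I. a i n"] by (simp add: bseq_sum)
qed

lemma labs_J_le:
  assumes "bseq b" "\<And>n. \<bar>a n\<bar> \<le> b n"
  shows "labs (J a) \<le> J b"
proof -
  have a: "bseq a" by (rule bseq_mono[OF assms(1)]) (use assms(2) abs_ge_self order_trans in blast)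
  have "a n \<le> b n" "- 1 * a n \<le> b n" for n using assms(2)[of n] by auto
  then have "J a \<le> J b" "J (\<lambda>n. - 1 * a n) \<le> J b"
    by (intro J_mono a assms(1) bseq_scale; simp)+
  then show ?thesis using J_scale[OF a, of "-1"] by (simp add: labs_le_iff)
qed

lemma norm_J_le:
  assumes "\<And>n. \<bar>a n\<bar> \<le> c"
  shows "norm (J a) \<le> c * norm u"
proof -
  have c: "0 \<le> c" using assms abs_ge_zero order_trans by blast
  have "labs (J a) \<le> J (\<lambda>n. c)" by (rule labs_J_le) (use assms in \<open>auto simp: bseq_def\<close>)
  also have "J (\<lambda>n. c) \<le> c *\<^sub>R u"
    using c S_le[of "\<lambda>n. c" c] by (subst J_nonneg_eq) (auto simp: bseq_def)
  finally show ?thesis using norm_le_of_labs_le[of "J a" "c *\<^sub>R u"] c by simp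
qed

lemma J_ge:
  assumes "\<And>n. 0 \<le> a n" "bseq a"
  shows "a n *\<^sub>R d n \<le> J a"
proof -
  have "(\<Sum>k\<in>{n}. a k *\<^sub>R d k) \<le> partial a (Suc n)"
    unfolding partial_def using assms d_nonneg by (intro sum_mono2) (auto intro: scaleR_nonneg_nonneg)
  also have "\<dots> \<le> J a" using S_lub(1)[OF assms] J_nonneg_eq[OF assms] by simp
  finally show ?thesis by simp
qed

end

section \<open>The Dunford-Pettis property\<close>

text \<open>\<open>g (J (indicat_real A))\<close> is a finitely additive measure of
  \<open>A\<close>. If the level sets kept their measure, a subsequence of them would have the
  finite intersection property. A common index \<open>t\<close> of finitely many sets then shows
  that the supremum of the \<open>\<phi> n\<close> is at least \<open>e\<close> on every convex
  combination, and Mazur-Orlicz yields one functional that is at least \<open>e\<close> along the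
  subsequence, against weak nullity.\<close>

lemma (in order_bounded_series) small_on_level_sets:
  fixes \<phi> :: "nat \<Rightarrow> 'a \<Rightarrow>\<^sub>L real"
  assumes \<phi>: "\<And>n. norm (\<phi> n) \<le> 1" and x: "weakly_null x" and g: "posf g" and e: "0 < e"
  shows "(\<lambda>m. g (J (indicat_real {n. e < \<phi> n (x m)}))) \<longlonglongrightarrow> 0"
proof (rule tendsto_zero_subseqI)
  fix s :: "nat \<Rightarrow> nat" and \<delta> :: real
  assume s: "strict_mono s" and \<delta>: "0 < \<delta>"
    and big: "\<And>k. \<delta> \<le> \<bar>g (J (indicat_real {n. e < \<phi> n (x (s k))}))\<bar>"
  define \<mu> where "\<mu> A = g (J (indicat_real A))" for A
  define A where "A k = {n. e < \<phi> n (x (s k))}" for k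
  have add: "\<mu> (X \<union> Y) = \<mu> X + \<mu> Y" if "X \<inter> Y = {}" for X Y
  proof -
    have "indicat_real (X \<union> Y) = (\<lambda>n. indicat_real X n + indicat_real Y n)"
      using that by (auto simp: indicator_def fun_eq_iff)
    then show ?thesis by (simp add: \<mu>_def J_add bseq_indicator blinfun.add_right)
  qed
  have nn: "0 \<le> \<mu> X" for X
    unfolding \<mu>_def by (intro posfD[OF g] J_nonneg bseq_indicator) auto
  have ge: "\<delta> \<le> \<mu> (A k)" for k
    using big[of k] nn[of "A k"] unfolding A_def \<mu>_def by simp
  obtain r :: "nat \<Rightarrow> nat" where r: "strict_mono r" "\<And>n. (\<Inter>k<n. A (r k)) \<noteq> {}"
    using infinite_finite_intersection[of \<mu> UNIV \<delta> A] add nn \<delta> ge by auto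
  define y where "y k = x (s (r k))" for k
  have \<phi>le: "\<phi> n z \<le> norm z" for n z
    using apply_le_norm[of "\<phi> n" z] mult_right_mono[OF \<phi>[of n] norm_ge_zero[of z]] by simp
  define p where "p z = (SUP n. \<phi> n z)" for z
  have bdd: "bdd_above (range (\<lambda>n. \<phi> n z))" for z using \<phi>le by (intro bdd_aboveI2)
  have up: "\<phi> n z \<le> p z" for n z unfolding p_def by (rule cSUP_upper[OF _ bdd]) simp
  have low: "p z \<le> B" if "\<And>n. \<phi> n z \<le> B" for z B unfolding p_def by (rule cSUP_least) (use that in auto)
  have sub: "sublinear p"
  proof (rule sublinearI)
    show "p (a + b) \<le> p a + p b" for a b
      by (rule low) (simp add: blinfun.add_right add_mono up)
    show "p 0 = 0" by (simp add: p_def)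
    show "p (c *\<^sub>R a) \<le> c * p a" if "0 < c" for c a
      by (rule low) (use that in \<open>simp add: blinfun.scaleR_right mult_left_mono up\<close>)
  qed
  have ple: "p z \<le> 1 * norm z" for z using low[OF \<phi>le] by simp
  have pe: "e \<le> p z" if "z \<in> convex hull (range y)" for z
  proof -
    \<comment> \<open>A point of \<open>Z\<close> is tested only on a finite intersection, whose
      length \<open>n\<close> depends on the point, since the intersection of all the sets may be
      empty.\<close>
    define Z where "Z = {z. \<exists>n. \<forall>t\<in>(\<Inter>k<n. A (r k)). e \<le> \<phi> t z}"
    have "convex Z"
    proof (rule convexI)
      fix a b :: 'a and v w :: real
      assume "a \<in> Z" "b \<in> Z" and vw: "0 \<le> v" "0 \<le> w" "v + w = 1"
      then obtain m n where mn: "\<forall>t\<in>(\<Inter>k<m. A (r k)). e \<le> \<phi> t a" "\<forall>t\<in>(\<Inter>k<n. A (r k)). e \<le> \<phi> t b"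
        by (auto simp: Z_def)
      have "\<forall>t\<in>(\<Inter>k<max m n. A (r k)). e \<le> \<phi> t (v *\<^sub>R a + w *\<^sub>R b)"
      proof
        fix t assume "t \<in> (\<Inter>k<max m n. A (r k))"
        then have "e \<le> \<phi> t a" "e \<le> \<phi> t b" using mn by auto
        then have "v * e + w * e \<le> v * \<phi> t a + w * \<phi> t b" using vw by (intro add_mono mult_left_mono) auto
        then show "e \<le> \<phi> t (v *\<^sub>R a + w *\<^sub>R b)"
          using vw by (simp add: blinfun.add_right blinfun.scaleR_right distrib_right[symmetric])
      qed
      then show "v *\<^sub>R a + w *\<^sub>R b \<in> Z" unfolding Z_def by blast
    qed
    moreover have "range y \<subseteq> Z"
    proof
      fix z assume "z \<in> range y"
      then obtain k where "z = y k" by blast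
      have "\<forall>t\<in>(\<Inter>j<Suc k. A (r j)). e \<le> \<phi> t z"
      proof
        fix t assume "t \<in> (\<Inter>j<Suc k. A (r j))"
        then have "t \<in> A (r k)" by blast
        then show "e \<le> \<phi> t z" using \<open>z = y k\<close> by (simp add: A_def y_def)
      qed
      then show "z \<in> Z" unfolding Z_def by blast
    qed
    ultimately have "z \<in> Z" using that hull_minimal[of "range y" Z convex] by auto
    then obtain n where n: "\<forall>t\<in>(\<Inter>k<n. A (r k)). e \<le> \<phi> t z" by (auto simp: Z_def)
    obtain t where "t \<in> (\<Inter>k<n. A (r k))" using r(2)[of n] by blast
    then have "e \<le> \<phi> t z" using n by blast
    then show ?thesis using up[of t z] by (rule order_trans)
  qed
  have "convex hull (range y) \<noteq> {}" by simp
  then obtain f where "\<And>z. blinfun_apply f z \<le> p z"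
    and f: "\<And>z. z \<in> convex hull (range y) \<Longrightarrow> e \<le> blinfun_apply f z"
    by (rule mazur_orlicz[OF sub ple convex_convex_hull _ pe]) blast+
  have "weakly_null y"
    unfolding y_def using weakly_null_subseq[OF weakly_null_subseq[OF x s] r(1)] by simp
  then have "(\<lambda>k. f (y k)) \<longlonglongrightarrow> 0" by (rule weakly_nullD)
  moreover have "e \<le> f (y k)" for k by (intro f hull_inc) simp
  ultimately have "e \<le> 0" by (meson LIMSEQ_le_const)
  with e show False by simp
qed

lemma (in order_bounded_series) small_on_abs_level_sets:
  fixes \<phi> :: "nat \<Rightarrow> 'a \<Rightarrow>\<^sub>L real"
  assumes \<phi>: "\<And>n. norm (\<phi> n) \<le> 1" and x: "weakly_null x" and g: "posf g" and e: "0 < e"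
  shows "(\<lambda>m. g (J (indicat_real {n. e < \<bar>\<phi> n (x m)\<bar>}))) \<longlonglongrightarrow> 0"
proof -
  have "indicat_real {n. e < \<bar>\<phi> n (x m)\<bar>}
      = (\<lambda>n. indicat_real {n. e < \<phi> n (x m)} n + indicat_real {n. e < \<phi> n (- x m)} n)" for m
    using e by (auto simp: indicator_def fun_eq_iff blinfun.minus_right abs_if)
  then have "J (indicat_real {n. e < \<bar>\<phi> n (x m)\<bar>})
      = J (indicat_real {n. e < \<phi> n (x m)}) + J (indicat_real {n. e < \<phi> n (- x m)})" for m
    by (simp add: J_add bseq_indicator)
  moreover have "(\<lambda>m. g (J (indicat_real {n. e < \<phi> n (x m)})) + g (J (indicat_real {n. e < \<phi> n (- x m)})))
      \<longlonglongrightarrow> 0 + 0"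
    by (intro tendsto_add small_on_level_sets \<phi> x g e weakly_null_uminus)
  ultimately show ?thesis by (simp add: blinfun.add_right)
qed

lemma half_power_tail_sum: "(\<Sum>j\<in>{k<..<L}. (1/2::real)^j) \<le> (1/2)^k"
proof (cases "k < L")
  case True
  then obtain i where L: "L = Suc k + i" using less_imp_add_positive by (metis Suc_leI le_Suc_ex)
  have "(\<Sum>j\<in>{k<..<Suc k + i}. (1/2::real)^j) = (1/2)^k - (1/2)^(k + i)" for i
  proof (induction i)
    case (Suc i)
    have "{k<..<Suc k + Suc i} = insert (Suc k + i) {k<..<Suc k + i}" by auto
    then show ?case using Suc by simp
  next
    case 0
    have "{k<..<Suc k + 0} = {}" by auto
    then show ?case by (simp only: sum.empty) simp
  qed
  then show ?thesis by (simp add: L)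
next
  case False
  then have "{k<..<L} = {}" by auto
  then show ?thesis by (simp only: sum.empty) simp
qed

text \<open>The Dunford--Pettis property of \<open>\<ell>\<^sub>\<infinity>\<close>, transported along \<open>J\<close>. After passing to a subsequence,
  the sets where \<open>x k\<close> is large are disjoint up to the errors controlled by \<open>H k\<close>; the limit functionals
  \<open>\<psi> k\<close> then map weakly null sequences of functionals to weakly null sequences in \<open>\<ell>\<^sub>1\<close>.\<close>

theorem (in order_bounded_series) dunford_pettis:
  fixes \<phi> :: "nat \<Rightarrow> 'a \<Rightarrow>\<^sub>L real" and f :: "nat \<Rightarrow> 'a \<Rightarrow>\<^sub>L real"
  assumes \<phi>: "\<And>n. norm (\<phi> n) \<le> 1" and x: "weakly_null x" and f: "weakly_null f"
  shows "(\<lambda>m. f m (J (\<lambda>n. \<phi> n (x m)))) \<longlonglongrightarrow> 0"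
proof (rule tendsto_zero_subseqI)
  fix s :: "nat \<Rightarrow> nat" and \<delta> :: real
  assume s: "strict_mono s" and \<delta>: "0 < \<delta>"
    and big: "\<And>k. \<delta> \<le> \<bar>f (s k) (J (\<lambda>n. \<phi> n (x (s k))))\<bar>"
  obtain Mf where Mf: "\<And>m. norm (f m) \<le> Mf" using weakly_null_bounded[OF f] by blast
  obtain Mx where Mx: "\<And>m. norm (x m) \<le> Mx" using weakly_null_bounded[OF x] by blast
  have Mf0: "0 \<le> Mf" and Mx0: "0 \<le> Mx" using Mf Mx norm_ge_zero order_trans by blast+
  \<comment> \<open>Changing the coefficients by at most \<open>\<epsilon>\<close> moves the values
    under the \<open>f m\<close> by at most \<open>\<delta> / 2\<close>; the summand 1 excludes a
    zero denominator.\<close>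
  define \<epsilon> where "\<epsilon> = \<delta> / (2 * (Mf * norm u + 1))"
  have den: "0 < Mf * norm u + 1" using Mf0 by (simp add: add_nonneg_pos)
  have \<epsilon>: "0 < \<epsilon>" using \<delta> den by (simp add: \<epsilon>_def)
  have \<epsilon>': "Mf * (\<epsilon> * norm u) \<le> \<delta> / 2"
  proof -
    have "\<epsilon> * (Mf * norm u) \<le> \<epsilon> * (Mf * norm u + 1)" using \<epsilon> by (intro mult_left_mono) auto
    also have "\<dots> = \<delta> / 2" using den unfolding \<epsilon>_def by (simp add: field_simps)
    finally show ?thesis by (simp add: mult_ac)
  qed
  define A where "A k = {n. \<epsilon> < \<bar>\<phi> n (x (s k))\<bar>}" for k
  have "\<exists>h. posf h \<and> (\<forall>y. \<bar>f (s k) y\<bar> \<le> h (labs y))" for k using modulus_functional[of "f (s k)"] by metis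
  then obtain H where H: "\<And>k. posf (H k)" "\<And>k y. \<bar>f (s k) y\<bar> \<le> H k (labs y)" by metis
  have small: "(\<lambda>k. H i (J (indicat_real (A k)))) \<longlonglongrightarrow> 0" for i
    unfolding A_def by (rule small_on_abs_level_sets[OF \<phi> weakly_null_subseq[OF x s] H(1) \<epsilon>])
  \<comment> \<open>Smallness is demanded for all indices up to \<open>t k\<close>, so that it holds
    for every earlier member of the subsequence and not only for the last one.\<close>
  have "\<exists>t. \<forall>k. True \<and> t k < t (Suc k) \<and> (\<forall>i\<le>t k. H i (J (indicat_real (A (t (Suc k))))) \<le> (1/2)^Suc k)"
  proof (rule dependent_nat_choice)
    fix a k :: nat
    have "\<forall>\<^sub>F b in sequentially. H i (J (indicat_real (A b))) < (1/2)^Suc k" for i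
      by (rule order_tendstoD[OF small]) simp
    then have "\<forall>\<^sub>F b in sequentially. \<forall>i\<in>{..a}. H i (J (indicat_real (A b))) < (1/2)^Suc k"
      by (intro eventually_ball_finite) auto
    then have "\<forall>\<^sub>F b in sequentially. a < b \<and> (\<forall>i\<in>{..a}. H i (J (indicat_real (A b))) < (1/2)^Suc k)"
      by (intro eventually_conj eventually_gt_at_top)
    then obtain b where "a < b" "\<forall>i\<in>{..a}. H i (J (indicat_real (A b))) < (1/2)^Suc k"
      by (auto dest: eventually_happens)
    then show "\<exists>b. True \<and> a < b \<and> (\<forall>i\<le>a. H i (J (indicat_real (A b))) \<le> (1/2)^Suc k)"
      by (intro exI[of _ b]) (auto intro: less_imp_le)
  qed auto
  then obtain t where t1: "\<And>k. t k < t (Suc k)"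
    and t2: "\<And>k i. i \<le> t k \<Longrightarrow> H i (J (indicat_real (A (t (Suc k))))) \<le> (1/2)^Suc k" by blast
  have t: "strict_mono t" using t1 by (simp add: strict_mono_Suc_iff)
  define F where "F k = f (s (t k))" for k
  define h where "h k = H (t k)" for k
  define I where "I k = A (t k)" for k
  define z where "z k n = \<phi> n (x (s (t k)))" for k n
  have st: "strict_mono (\<lambda>k. s (t k))" using strict_mono_o[OF s t] by (simp add: o_def)
  have F: "weakly_null F" unfolding F_def by (rule weakly_null_subseq[OF f st])
  have h: "posf (h k)" "\<bar>F k y\<bar> \<le> h k (labs y)" for k y using H by (auto simp: h_def F_def)
  have hI: "h k (J (indicat_real (I j))) \<le> (1/2)^j" if kj: "k < j" for k j
  proof -
    obtain j' where j: "j = Suc j'" using kj by (cases j) auto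
    have "t k \<le> t j'" using strict_mono_less_eq[OF t] kj j by simp
    then show ?thesis using t2 by (simp add: h_def I_def j)
  qed
  have zM: "\<bar>z k n\<bar> \<le> Mx" for k n
  proof -
    have "\<bar>z k n\<bar> \<le> norm (\<phi> n) * norm (x (s (t k)))" unfolding z_def using norm_blinfun[of "\<phi> n"] by simp
    also have "\<dots> \<le> 1 * Mx" by (intro mult_mono \<phi> Mx) auto
    finally show ?thesis by simp
  qed
  have zI: "n \<in> I k \<longleftrightarrow> \<epsilon> < \<bar>z k n\<bar>" for k n by (simp add: I_def A_def z_def)
  \<comment> \<open>\<open>w k\<close> keeps the large coefficients of \<open>z k\<close> only. The
    sets \<open>B k L\<close> below remove from \<open>I k\<close> the later level sets with index
    under \<open>L\<close>: they are disjoint for \<open>k < L\<close>, and for fixed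
    \<open>k\<close> they shrink as \<open>L\<close> grows.\<close>
  define w where "w k n = z k n * indicat_real (I k) n" for k n
  have w: "\<bar>w k n\<bar> \<le> Mx" for k n using zM[of k n] Mx0 by (simp add: w_def indicator_def)
  define B where "B k L = I k - (\<Union>j\<in>{k<..<L}. I j)" for k L :: nat
  define v where "v k L n = z k n * indicat_real (B k L) n" for k L n
  have v: "\<bar>v k L n\<bar> \<le> Mx" for k L n using zM[of k n] Mx0 by (simp add: v_def indicator_def)
  have bw: "bseq (w k)" for k by (rule bseqI[OF w])
  have bv: "bseq (v k L)" for k L by (rule bseqI[OF v])
  have Banti: "B k L' \<subseteq> B k L" if "L \<le> L'" for k L L' using that by (auto simp: B_def)
  have BI: "B k L \<subseteq> I k" for k L by (auto simp: B_def)
  \<comment> \<open>The elements \<open>J (v k L)\<close> need not converge in norm as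
    \<open>L\<close> grows, but under each functional they do; hence the passage to the
    bidual.\<close>
  define \<alpha> where "\<alpha> k L = eval_at (J (v k L))" for k L
  have \<alpha>: "\<alpha> k L g = blinfun_apply g (J (v k L))" for k L g by (simp add: \<alpha>_def)
  \<comment> \<open>At each \<open>n\<close> at most one of the disjoint sets \<open>B k L\<close>
    contributes, so signed sums of the coefficients are bounded by \<open>Mx\<close> independently
    of \<open>N\<close>.\<close>
  have sum_le: "(\<Sum>k<N. \<bar>\<alpha> k L g\<bar>) \<le> norm g * (Mx * norm u)" if NL: "N \<le> L" for N L g
    unfolding \<alpha>
  proof (rule sum_abs_le_of_signs)
    fix c :: "nat \<Rightarrow> real" assume c: "\<And>k. k \<in> {..<N} \<Longrightarrow> \<bar>c k\<bar> \<le> 1"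
    have "(\<Sum>k<N. c k *\<^sub>R J (v k L)) = J (\<lambda>n. \<Sum>k<N. c k * v k L n)"
      by (subst J_sum) (auto simp: J_scale bv bseq_scale)
    also have "norm \<dots> \<le> Mx * norm u"
    proof (rule norm_J_le)
      fix n
      show "\<bar>\<Sum>k<N. c k * v k L n\<bar> \<le> Mx"
      proof (cases "\<exists>k0<N. n \<in> B k0 L")
        case True
        then obtain k0 where k0: "k0 < N" "n \<in> B k0 L" by blast
        have "n \<notin> B k L" if "k \<noteq> k0" "k < N" for k
          using k0 that NL by (cases k k0 rule: linorder_cases) (auto simp: B_def)
        then have "(\<Sum>k<N. c k * v k L n) = (\<Sum>k\<in>{k0}. c k * v k L n)"
          using k0 by (intro sum.mono_neutral_right) (auto simp: v_def)
        also have "\<bar>\<dots>\<bar> = \<bar>c k0\<bar> * \<bar>v k0 L n\<bar>" by (simp add: abs_mult)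
        also have "\<dots> \<le> 1 * Mx" using c k0 v by (intro mult_mono) auto
        finally show ?thesis by simp
      next
        case False
        then have "(\<Sum>k<N. c k * v k L n) = 0" by (intro sum.neutral) (auto simp: v_def)
        then show ?thesis using Mx0 by simp
      qed
    qed
    finally show "norm (\<Sum>k<N. c k *\<^sub>R J (v k L)) \<le> Mx * norm u" .
  qed
  have conv: "convergent (\<lambda>L. \<alpha> k L g)" for k and g :: "'a \<Rightarrow>\<^sub>L real"
  proof -
    obtain q where q: "posf q" "\<And>y. \<bar>g y\<bar> \<le> q (labs y)" using modulus_functional[of g] by metis
    \<comment> \<open>\<open>a\<close> decreases and is nonnegative, hence converges, and its
      differences dominate those of \<open>\<alpha> k\<close>.\<close>
    define a where "a L = q (J (indicat_real (B k L)))" for L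
    have a0: "0 \<le> a L" for L
      unfolding a_def by (intro posfD[OF q(1)] J_nonneg bseq_indicator) auto
    have anti: "a L' \<le> a L" if "L \<le> L'" for L L'
      unfolding a_def using Banti[OF that, of k]
      by (intro posf_mono[OF q(1)] J_mono bseq_indicator) (auto simp: indicator_def)
    have diff: "\<bar>\<alpha> k L g - \<alpha> k L' g\<bar> \<le> Mx * (a L - a L')" if "L \<le> L'" for L L'
    proof -
      let ?d = "\<lambda>n. Mx * (indicat_real (B k L) n - indicat_real (B k L') n)"
      have bd: "bseq (\<lambda>n. indicat_real (B k L) n - indicat_real (B k L') n)"
        by (intro bseq_diff bseq_indicator)
      have "\<alpha> k L g - \<alpha> k L' g = g (J (\<lambda>n. v k L n - v k L' n))"
        by (simp add: \<alpha> J_diff bv blinfun.diff_right)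
      also have "\<bar>\<dots>\<bar> \<le> q (labs (J (\<lambda>n. v k L n - v k L' n)))" by (rule q)
      also have "\<dots> \<le> q (J ?d)"
      proof (intro posf_mono[OF q(1)] labs_J_le bseq_scale bd)
        fix n
        show "\<bar>v k L n - v k L' n\<bar> \<le> ?d n"
          using Banti[OF that, of k] zM[of k n] by (auto simp: v_def indicator_def)
      qed
      also have "\<dots> = Mx * (a L - a L')"
        by (simp add: J_scale[OF bd] J_diff bseq_indicator a_def blinfun.scaleR_right blinfun.diff_right)
      finally show ?thesis .
    qed
    have "decseq a" using anti by (simp add: decseq_def)
    then obtain l where "a \<longlonglongrightarrow> l" using decseq_convergent[of a 0] a0 by blast
    then have "convergent a" by (rule convergentI)
    then have ca: "Cauchy a" by (rule convergent_Cauchy)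
    have "Cauchy (\<lambda>L. \<alpha> k L g)"
    proof (rule CauchyI')
      fix e :: real assume e: "0 < e"
      then have "0 < e / (Mx + 1)" using Mx0 by simp
      then obtain M where M: "\<And>m n. m \<ge> M \<Longrightarrow> n \<ge> M \<Longrightarrow> norm (a m - a n) < e / (Mx + 1)"
        using CauchyD[OF ca] by blast
      show "\<exists>M. \<forall>m\<ge>M. \<forall>n>m. dist (\<alpha> k m g) (\<alpha> k n g) < e"
      proof (intro exI[of _ M] allI impI)
        fix m n assume mn: "M \<le> m" "m < n"
        have "\<bar>\<alpha> k m g - \<alpha> k n g\<bar> \<le> Mx * (a m - a n)" using diff[of m n] mn by simp
        also have "\<dots> \<le> (Mx + 1) * (a m - a n)" using anti[of m n] mn by (intro mult_right_mono) auto
        also have "\<dots> < (Mx + 1) * (e / (Mx + 1))"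
          using M[of m n] mn Mx0 by (intro mult_strict_left_mono) auto
        also have "\<dots> = e" using Mx0 by simp
        finally show "dist (\<alpha> k m g) (\<alpha> k n g) < e" by (simp add: dist_real_def)
      qed
    qed
    then show ?thesis by (rule Cauchy_convergent)
  qed
  have "\<exists>\<psi>. \<forall>g. (\<lambda>L. \<alpha> k L g) \<longlonglongrightarrow> blinfun_apply \<psi> g" for k
  proof (rule bounded_linear_real_limit[of "\<alpha> k" "Mx * norm u"])
    show "convergent (\<lambda>L. \<alpha> k L g)" for g by (rule conv)
    show "\<bar>\<alpha> k L g\<bar> \<le> Mx * norm u * norm g" for L g
    proof -
      have "\<bar>\<alpha> k L g\<bar> \<le> norm g * norm (J (v k L))" unfolding \<alpha> using norm_blinfun[of g] by simp
      also have "\<dots> \<le> norm g * (Mx * norm u)" by (intro mult_left_mono norm_J_le v) auto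
      finally show ?thesis by (simp add: mult_ac)
    qed
  qed blast
  then obtain \<psi> :: "nat \<Rightarrow> ('a \<Rightarrow>\<^sub>L real) \<Rightarrow>\<^sub>L real" where \<psi>: "\<And>k g. (\<lambda>L. \<alpha> k L g) \<longlonglongrightarrow> \<psi> k g" by metis
  have \<psi>_sum: "(\<Sum>k<N. \<bar>\<psi> k g\<bar>) \<le> Mx * norm u * norm g" for g N
  proof (rule LIMSEQ_le_const2)
    show "(\<lambda>L. \<Sum>k<N. \<bar>\<alpha> k L g\<bar>) \<longlonglongrightarrow> (\<Sum>k<N. \<bar>\<psi> k g\<bar>)" by (intro tendsto_intros \<psi>)
    show "\<exists>L0. \<forall>L\<ge>L0. (\<Sum>k<N. \<bar>\<alpha> k L g\<bar>) \<le> Mx * norm u * norm g"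
      using sum_le by (intro exI[of _ N]) (auto simp: mult_ac)
  qed
  have "(\<lambda>m. \<Sum>k. \<bar>\<psi> k (F m)\<bar>) \<longlonglongrightarrow> 0" by (rule schur(2)[OF F \<psi>_sum])
  then have "(\<lambda>m. \<psi> m (F m)) \<longlonglongrightarrow> 0"
  proof (rule Lim_null_comparison[rotated])
    have "\<bar>\<psi> m (F m)\<bar> \<le> (\<Sum>k. \<bar>\<psi> k (F m)\<bar>)" for m
      using sum_le_suminf[OF schur(1)[OF F \<psi>_sum], of "{m}" "F m"] by simp
    then show "\<forall>\<^sub>F m in sequentially. norm (\<psi> m (F m)) \<le> (\<Sum>k. \<bar>\<psi> k (F m)\<bar>)" by simp
  qed
  \<comment> \<open>Replacing \<open>I k\<close> by \<open>B k L\<close> costs at most the later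
    level sets, whose measures under \<open>h k\<close> sum to at most \<open>(1/2)^k\<close>
    whatever \<open>L\<close> is.\<close>
  moreover have near: "\<bar>F k (J (w k)) - \<psi> k (F k)\<bar> \<le> Mx * (1/2)^k" for k
  proof (rule LIMSEQ_le_const2)
    show "(\<lambda>L. \<bar>F k (J (w k)) - \<alpha> k L (F k)\<bar>) \<longlonglongrightarrow> \<bar>F k (J (w k)) - \<psi> k (F k)\<bar>"
      by (intro tendsto_intros \<psi>)
    have "\<bar>F k (J (w k)) - \<alpha> k L (F k)\<bar> \<le> Mx * (1/2)^k" for L
    proof -
      let ?D = "\<lambda>n. \<Sum>j\<in>{k<..<L}. indicat_real (I j) n"
      have bD: "bseq ?D" by (intro bseq_sum bseq_indicator) auto
      have "F k (J (w k)) - \<alpha> k L (F k) = F k (J (\<lambda>n. w k n - v k L n))"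
        by (simp add: \<alpha> J_diff bv bw blinfun.diff_right)
      also have "\<bar>\<dots>\<bar> \<le> h k (labs (J (\<lambda>n. w k n - v k L n)))" by (rule h)
      also have "\<dots> \<le> h k (J (\<lambda>n. Mx * ?D n))"
      proof (intro posf_mono[OF h(1)] labs_J_le bseq_scale bD)
        fix n
        have D0: "0 \<le> ?D n" by (intro sum_nonneg) auto
        show "\<bar>w k n - v k L n\<bar> \<le> Mx * ?D n"
        proof (cases "n \<in> I k \<and> n \<notin> B k L")
          case True
          then obtain j where j: "j \<in> {k<..<L}" "n \<in> I j" by (auto simp: B_def)
          have "(\<Sum>j\<in>{j}. indicat_real (I j) n) \<le> ?D n" using j by (intro sum_mono2) auto
          then have "1 \<le> ?D n" using j by simp
          then have "Mx * 1 \<le> Mx * ?D n" using Mx0 by (rule mult_left_mono)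
          moreover have "\<bar>w k n - v k L n\<bar> \<le> Mx" using True zM[of k n] by (simp add: w_def v_def)
          ultimately show ?thesis by simp
        next
          case False
          then have "w k n - v k L n = 0" using BI[of k L] by (auto simp: w_def v_def indicator_def)
          then show ?thesis using D0 Mx0 by simp
        qed
      qed
      also have "\<dots> = Mx * (\<Sum>j\<in>{k<..<L}. h k (J (indicat_real (I j))))"
        using J_scale[OF bD, of Mx] by (simp add: J_sum bseq_indicator blinfun.scaleR_right blinfun.sum_right)
      also have "\<dots> \<le> Mx * (\<Sum>j\<in>{k<..<L}. (1/2)^j)" using Mx0 hI by (intro mult_left_mono sum_mono) auto
      also have "(\<Sum>j\<in>{k<..<L}. (1/2::real)^j) \<le> (1/2)^k"
        by (rule half_power_tail_sum)
      finally show ?thesis using Mx0 by (simp add: mult_left_mono)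
    qed
    then show "\<exists>N. \<forall>L\<ge>N. \<bar>F k (J (w k)) - \<alpha> k L (F k)\<bar> \<le> Mx * (1/2)^k" by blast
  qed
  have "(\<lambda>k. F k (J (w k)) - \<psi> k (F k)) \<longlonglongrightarrow> 0"
  proof (rule Lim_null_comparison)
    show "\<forall>\<^sub>F k in sequentially. norm (F k (J (w k)) - \<psi> k (F k)) \<le> Mx * (1/2)^k" using near by simp
    show "(\<lambda>k. Mx * (1/2)^k) \<longlonglongrightarrow> 0" by (intro tendsto_mult_right_zero LIMSEQ_power_zero) simp
  qed
  ultimately have "(\<lambda>k. (F k (J (w k)) - \<psi> k (F k)) + \<psi> k (F k)) \<longlonglongrightarrow> 0 + 0" by (intro tendsto_add)
  then have lim: "(\<lambda>k. F k (J (w k))) \<longlonglongrightarrow> 0" by simp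
  have "\<delta> / 2 \<le> \<bar>F k (J (w k))\<bar>" for k
  proof -
    have bz: "bseq (z k)" by (rule bseqI[OF zM])
    have "norm (J (\<lambda>n. z k n - w k n)) \<le> \<epsilon> * norm u"
    proof (rule norm_J_le)
      show "\<bar>z k n - w k n\<bar> \<le> \<epsilon>" for n using zI[of n k] \<epsilon> by (cases "n \<in> I k") (auto simp: w_def)
    qed
    then have "\<bar>F k (J (\<lambda>n. z k n - w k n))\<bar> \<le> Mf * (\<epsilon> * norm u)"
      using norm_blinfun[of "F k" "J (\<lambda>n. z k n - w k n)"] Mf[of "s (t k)"] Mf0
      unfolding F_def real_norm_def by (meson mult_mono norm_ge_zero order_trans)
    then have "\<bar>F k (J (z k)) - F k (J (w k))\<bar> \<le> \<delta> / 2"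
      using \<epsilon>' by (simp add: J_diff bz bw blinfun.diff_right)
    moreover have "\<delta> \<le> \<bar>F k (J (z k))\<bar>" using big[of "t k"] by (simp add: F_def z_def[abs_def])
    ultimately show ?thesis by linarith
  qed
  moreover have "\<exists>k. \<bar>F k (J (w k))\<bar> < \<delta> / 2" using LIMSEQ_D[OF lim, of "\<delta> / 2"] \<delta> by fastforce
  ultimately show False by (meson not_le)
qed

text \<open>The lower bound by a single term is what later keeps \<open>T\<close> away from 0 on the
  \<open>d n\<close>.\<close>

lemma (in order_bounded_series) series_operator:
  fixes \<phi> :: "nat \<Rightarrow> 'a \<Rightarrow>\<^sub>L real"
  assumes pos: "\<And>n. posf (\<phi> n)" and \<phi>: "\<And>n. norm (\<phi> n) \<le> 1"
  obtains T :: "'a \<Rightarrow>\<^sub>L 'a" where "positive_op T" "weak_DP T" "\<And>x n. 0 \<le> x \<Longrightarrow> \<phi> n x *\<^sub>R d n \<le> T x"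
proof -
  have le: "\<bar>\<phi> n x\<bar> \<le> norm x" for n x
    using norm_blinfun[of "\<phi> n" x] mult_right_mono[OF \<phi>[of n] norm_ge_zero[of x]] by simp
  have b: "bseq (\<lambda>n. \<phi> n x)" for x by (rule bseqI[OF le])
  define T where "T x = J (\<lambda>n. \<phi> n x)" for x
  have "bounded_linear T"
  proof (rule bounded_linear_intro)
    show "T (x + y) = T x + T y" for x y by (simp add: T_def blinfun.add_right J_add b)
    show "T (r *\<^sub>R x) = r *\<^sub>R T x" for r x by (simp add: T_def blinfun.scaleR_right J_scale b)
    show "norm (T x) \<le> norm x * norm u" for x unfolding T_def by (rule norm_J_le[OF le])
  qed
  then have T: "blinfun_apply (Blinfun T) = T" by (rule bounded_linear_Blinfun_apply)
  show thesis
  proof (rule that[of "Blinfun T"])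
    show "positive_op (Blinfun T)"
      unfolding positive_op_def T T_def using posfD[OF pos] b by (auto intro: J_nonneg)
    show "weak_DP (Blinfun T)"
      unfolding weak_DP_def T T_def
      by (intro allI impI dunford_pettis \<phi>) simp_all
    show "\<phi> n x *\<^sub>R d n \<le> Blinfun T x" if "0 \<le> x" for x n
      unfolding T T_def by (rule J_ge) (use posfD[OF pos that] b in auto)
  qed
qed

section \<open>Order bounded increasing sequences\<close>

lemma uaw_DP_bounded_sums:
  fixes d :: "nat \<Rightarrow> 'a::banach_lattice" and T :: "'a \<Rightarrow>\<^sub>L 'b::real_normed_vector"
  assumes T: "uaw_DP T" and d: "\<And>n. 0 \<le> d n" "\<And>N. norm (\<Sum>n<N. d n) \<le> C"
  shows "(\<lambda>n. T (d n)) \<longlonglongrightarrow> 0"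
proof -
  have "norm (d n) \<le> C" for n
  proof -
    have "d n \<le> (\<Sum>n<Suc n. d n)" using sum_nonneg[of "{..<n}" d] d(1) by simp
    then have "norm (d n) \<le> norm (\<Sum>n<Suc n. d n)" by (rule norm_mono_nonneg[OF d(1)])
    with d(2) show ?thesis using order_trans by blast
  qed
  then have "bounded (range d)" by (auto simp: bounded_iff)
  moreover have "uaw_null d" by (rule bounded_sums_uaw_null[OF d])
  ultimately show ?thesis using T tendsto_norm_zero_iff unfolding uaw_DP_def by blast
qed

text \<open>For an increasing sequence a gap only grows when its lower end is moved back, so every
  index starts a gap of size \<open>\<delta>\<close>.\<close>

lemma incseq_not_Cauchy:
  fixes X :: "nat \<Rightarrow> 'a::banach_lattice"
  assumes inc: "incseq X" and nc: "\<not> Cauchy X"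
  obtains s :: "nat \<Rightarrow> nat" and \<delta> where "strict_mono s" "0 < \<delta>" "\<And>k. \<delta> \<le> norm (X (s (Suc k)) - X (s k))"
proof -
  obtain \<delta> where \<delta>: "0 < \<delta>" "\<And>M. \<exists>m\<ge>M. \<exists>n\<ge>M. \<delta> \<le> norm (X m - X n)"
    using nc by (auto simp: Cauchy_iff not_less)
  have step: "\<exists>m>N. \<delta> \<le> norm (X m - X N)" for N
  proof -
    obtain m n where mn: "N < m" "N < n" "\<delta> \<le> norm (X m - X n)" using \<delta>(2)[of "Suc N"] by (auto simp: Suc_le_eq)
    have *: "\<delta> \<le> norm (X j - X N)" if "N < i" "i \<le> j" "\<delta> \<le> norm (X j - X i)" for i j
    proof -
      have "norm (X j - X i) \<le> norm (X j - X N)"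
        using incseqD[OF inc, of i j] incseqD[OF inc, of N i] that
        by (intro norm_mono_nonneg) (auto intro: diff_left_mono)
      with that show ?thesis by simp
    qed
    show ?thesis
    proof (cases "n \<le> m")
      case True
      with *[of n m] mn show ?thesis by blast
    next
      case False
      with *[of m n] mn show ?thesis by (metis nat_le_linear norm_minus_commute)
    qed
  qed
  have "\<exists>s. \<forall>k. True \<and> s k < s (Suc k) \<and> \<delta> \<le> norm (X (s (Suc k)) - X (s k))"
    by (rule dependent_nat_choice) (use step in auto)
  then obtain s where "\<And>k. s k < s (Suc k)" "\<And>k. \<delta> \<le> norm (X (s (Suc k)) - X (s k))" by blast
  with \<delta>(1) that[of s \<delta>] show thesis by (simp add: strict_mono_Suc_iff)
qed

text \<open>Increments along a bad subsequence are positive with order bounded sums, hence uaw-null.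
  With \<open>\<phi> n\<close> norming \<open>d n\<close>, the operator satisfies
  \<open>norm (d n) *\<^sub>R d n \<le> T (d n)\<close>, so the images stay at norm
  \<open>\<delta> * \<delta>\<close> or more.\<close>

lemma order_bounded_incseq_Cauchy:
  fixes X :: "nat \<Rightarrow> 'a::banach_lattice"
  assumes sc: "dedekind_sigma_complete TYPE('a)"
    and H: "\<And>T :: 'a \<Rightarrow>\<^sub>L 'a. positive_op T \<Longrightarrow> weak_DP T \<Longrightarrow> uaw_DP T"
    and inc: "incseq X" and le: "\<And>n. X n \<le> u"
  shows "Cauchy X"
proof (rule ccontr)
  assume "\<not> Cauchy X"
  then obtain s \<delta> where s: "strict_mono (s :: nat \<Rightarrow> nat)" and \<delta>: "0 < \<delta>"
    and big: "\<And>k. \<delta> \<le> norm (X (s (Suc k)) - X (s k))"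
    using incseq_not_Cauchy[OF inc] by metis
  define d where "d k = X (s (Suc k)) - X (s k)" for k
  have sum: "(\<Sum>k<N. d k) = X (s N) - X (s 0)" for N
    unfolding d_def by (rule sum_lessThan_telescope)
  interpret order_bounded_series d "u - X (s 0)"
  proof
    show "dedekind_sigma_complete TYPE('a)" by (rule sc)
    show "0 \<le> d n" for n
      using incseqD[OF inc, of "s n" "s (Suc n)"] strict_mono_less_eq[OF s, of n "Suc n"] by (simp add: d_def)
    show "(\<Sum>n<N. d n) \<le> u - X (s 0)" for N using le by (simp add: sum)
  qed
  have "\<exists>f. posf f \<and> norm f \<le> 1 \<and> f (d n) = norm (d n)" for n
    using positive_norming_functional[OF d_nonneg] by metis
  then obtain \<phi> where \<phi>: "\<And>n. posf (\<phi> n)" "\<And>n. norm (\<phi> n) \<le> 1" "\<And>n. \<phi> n (d n) = norm (d n)" by metis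
  obtain T :: "'a \<Rightarrow>\<^sub>L 'a" where T: "positive_op T" "weak_DP T" "\<And>x n. 0 \<le> x \<Longrightarrow> \<phi> n x *\<^sub>R d n \<le> T x"
    using series_operator[of \<phi>, OF \<phi>(1,2)] by blast
  have "(\<lambda>n. T (d n)) \<longlonglongrightarrow> 0"
  proof (rule uaw_DP_bounded_sums[OF H[OF T(1,2)] d_nonneg])
    show "norm (\<Sum>n<N. d n) \<le> norm (u - X (s 0))" for N
      by (intro norm_mono_nonneg d_sum_le sum_nonneg d_nonneg)
  qed
  moreover have "\<delta> * \<delta> \<le> norm (T (d n))" for n
  proof -
    have "\<delta> * \<delta> \<le> norm (d n) * norm (d n)" using big[of n] \<delta> by (intro mult_mono) (auto simp: d_def)
    also have "\<dots> = norm (\<phi> n (d n) *\<^sub>R d n)" by (simp add: \<phi>)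
    also have "\<dots> \<le> norm (T (d n))"
      using T(3)[OF d_nonneg, of n n] d_nonneg[of n] posfD[OF \<phi>(1) d_nonneg, of n n]
      by (intro norm_mono_nonneg scaleR_nonneg_nonneg) auto
    finally show ?thesis .
  qed
  moreover have "0 < \<delta> * \<delta>" using \<delta> by simp
  ultimately show False
    using LIMSEQ_le_const[OF tendsto_norm, of "\<lambda>n. T (d n)" 0 "\<delta> * \<delta>"] by (simp add: not_le[symmetric])
qed

section \<open>Almost order boundedness and tail suprema\<close>

text \<open>For \<open>T x = f x *\<^sub>R e\<close> the pairing with \<open>g n\<close> is the
  product \<open>f (x n) * g n e\<close>, both factors of which tend to 0. Unless all
  \<open>v n\<close> vanish, one of them serves as \<open>e\<close>.\<close>

lemma disjoint_null_of_rank_one: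
  fixes v :: "nat \<Rightarrow> 'a::banach_lattice"
  assumes H: "\<And>T :: 'a \<Rightarrow>\<^sub>L 'a. positive_op T \<Longrightarrow> weak_DP T \<Longrightarrow> uaw_DP T"
    and f: "posf f" and v: "\<And>n. 0 \<le> v n" "\<And>n. norm (v n) \<le> C" "\<And>n m. n \<noteq> m \<Longrightarrow> inf (v n) (v m) = 0"
  shows "(\<lambda>n. blinfun_apply f (v n)) \<longlonglongrightarrow> 0"
proof (cases "\<forall>n. v n = 0")
  case True
  then show ?thesis by simp
next
  case False
  then obtain e where e: "0 \<le> e" "e \<noteq> (0::'a)" using v(1) by blast
  define T where "T = Blinfun (\<lambda>x. f x *\<^sub>R e)"
  have T: "T x = f x *\<^sub>R e" for x
    unfolding T_def by (subst bounded_linear_Blinfun_apply) (auto intro!: bounded_linear_intros)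
  have "positive_op T" unfolding positive_op_def T using e posfD[OF f] by (auto intro: scaleR_nonneg_nonneg)
  moreover have "weak_DP T"
    unfolding weak_DP_def
  proof (intro allI impI)
    fix x :: "nat \<Rightarrow> 'a" and g :: "nat \<Rightarrow> 'a \<Rightarrow>\<^sub>L real"
    assume *: "weakly_null x \<and> weakly_null g"
    have "(\<lambda>n. f (x n) * eval_at e (g n)) \<longlonglongrightarrow> 0 * 0"
      using * by (intro tendsto_mult weakly_nullD) auto
    then show "(\<lambda>n. g n (T (x n))) \<longlonglongrightarrow> 0" by (simp add: T blinfun.scaleR_right)
  qed
  ultimately have "uaw_DP T" by (rule H)
  moreover have "bounded (range v)" using v(2) by (auto simp: bounded_iff)
  moreover have "uaw_null v" by (rule disjoint_uaw_null[OF v(1,3)])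
  ultimately have "(\<lambda>n. norm (T (v n))) \<longlonglongrightarrow> 0" unfolding uaw_DP_def by blast
  then have "(\<lambda>n. norm (T (v n)) / norm e) \<longlonglongrightarrow> 0 / norm e" using e by (intro tendsto_divide) auto
  then have "(\<lambda>n. \<bar>f (v n)\<bar>) \<longlonglongrightarrow> 0" using e by (simp add: T)
  then show ?thesis by (simp add: tendsto_rabs_zero_iff)
qed

text \<open>Failure is exploited for \<open>u\<close> equal to \<open>4^n\<close> times the sum of
  the elements already chosen. The excesses over these \<open>u\<close> are what disjointification
  starts from, and it removes only a further \<open>(1/2)^n *\<^sub>R w\<close>, so \<open>f\<close>
  stays away from 0 on a bounded disjoint sequence.\<close>

lemma almost_order_bounded:
  fixes f :: "'a::banach_lattice \<Rightarrow>\<^sub>L real"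
  assumes f: "posf f"
    and disj: "\<And>v C. (\<And>n. 0 \<le> v n) \<Longrightarrow> (\<And>n. norm (v n) \<le> C) \<Longrightarrow>
      (\<And>n m. n \<noteq> m \<Longrightarrow> inf (v n) (v m) = 0) \<Longrightarrow> (\<lambda>n. f (v n)) \<longlonglongrightarrow> 0"
    and e: "0 < e"
  shows "\<exists>u\<ge>0. \<forall>x. norm x \<le> M \<longrightarrow> f (pprt (labs x - u)) \<le> e"
proof (rule ccontr)
  assume "\<not> ?thesis"
  then have "\<forall>u. \<exists>x. 0 \<le> u \<longrightarrow> norm x \<le> M \<and> e < f (pprt (labs x - u))" by (meson not_le)
  then obtain X where X: "\<And>u. 0 \<le> u \<Longrightarrow> norm (X u) \<le> M \<and> e < f (pprt (labs (X u) - u))" by metis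
  define \<sigma> where "\<sigma> = rec_nat 0 (\<lambda>n s. s + labs (X (4^n *\<^sub>R s)))"
  define x where "x n = labs (X (4^n *\<^sub>R \<sigma> n))" for n
  have \<sigma>: "\<sigma> n = (\<Sum>j<n. x j)" for n
    by (induction n) (simp_all add: \<sigma>_def x_def)
  have x0: "0 \<le> x n" for n by (simp add: x_def)
  have \<sigma>0: "0 \<le> 4^n *\<^sub>R \<sigma> n" for n
    unfolding \<sigma> by (intro scaleR_nonneg_nonneg sum_nonneg x0) simp
  have xM: "norm (x n) \<le> M" for n using X[OF \<sigma>0] by (simp add: x_def)
  have xe: "e < f (pprt (x n - 4^n *\<^sub>R (\<Sum>j<n. x j)))" for n
    using X[OF \<sigma>0, of n] by (simp add: x_def[of n] \<sigma>[symmetric])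
  define w where "w = (\<Sum>j. (1/2)^j *\<^sub>R x j)"
  define v where "v n = pprt (x n - (4^n) *\<^sub>R (\<Sum>j<n. x j) - (1/2)^n *\<^sub>R w)" for n
  note v = disjointification[of x M, OF x0 xM, folded w_def, folded v_def]
  have "norm (v n) \<le> M" for n using norm_mono_nonneg[OF v(2,3)] xM order_trans by blast
  then have "(\<lambda>n. f (v n)) \<longlonglongrightarrow> 0" using v by (intro disj)
  moreover have "(\<lambda>n. (1/2)^n * f w) \<longlonglongrightarrow> 0" by (intro tendsto_mult_left_zero LIMSEQ_power_zero) simp
  ultimately have "(\<lambda>n. f (v n) + (1/2)^n * f w) \<longlonglongrightarrow> 0 + 0" by (rule tendsto_add)
  moreover have "e \<le> f (v n) + (1/2)^n * f w" for n
  proof -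
    let ?y = "x n - 4^n *\<^sub>R (\<Sum>j<n. x j)"
    have "pprt ?y \<le> v n + (1/2)^n *\<^sub>R w"
      unfolding pprt_le_iff using le_pprt[of "?y - (1/2)^n *\<^sub>R w"] v(1) v(2)[of n]
      by (auto simp: v_def diff_le_eq intro!: add_nonneg_nonneg scaleR_nonneg_nonneg)
    then have "f (pprt ?y) \<le> f (v n + (1/2)^n *\<^sub>R w)" by (rule posf_mono[OF f])
    then show ?thesis using xe[of n] by (simp add: blinfun.add_right blinfun.scaleR_right)
  qed
  ultimately have "e \<le> 0 + 0" by (meson LIMSEQ_le_const)
  with e show False by simp
qed

text \<open>A Borel-Cantelli argument. The tail suprema \<open>t N\<close> are norm limits of finite
  suprema and decrease to an upper limit \<open>l\<close>; since \<open>F (t N)\<close> is at most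
  the tail sum of the \<open>F (y n)\<close>, summability forces \<open>F l = 0\<close>.\<close>

lemma tail_suprema:
  fixes y :: "nat \<Rightarrow> 'a::banach_lattice"
  assumes oc: "\<And>X (u::'a). incseq X \<Longrightarrow> (\<And>n. X n \<le> u) \<Longrightarrow> Cauchy X"
    and y: "\<And>n. 0 \<le> y n" "\<And>n. y n \<le> u"
  obtains t l where "\<And>N n. N \<le> n \<Longrightarrow> y n \<le> t N" "t \<longlonglongrightarrow> l" "0 \<le> l"
    "\<And>F. posf F \<Longrightarrow> summable (\<lambda>n. blinfun_apply F (y n)) \<Longrightarrow> F l = 0"
proof -
  define m where "m N = rec_nat (y N) (\<lambda>k s. sup s (y (N + Suc k)))" for N
  have m0: "m N 0 = y N" and mS: "m N (Suc k) = sup (m N k) (y (N + Suc k))" for N k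
    by (simp_all add: m_def)
  have inc: "incseq (m N)" for N by (rule incseq_SucI) (simp add: mS)
  have mu: "m N k \<le> u" for N k by (induction k) (auto simp: m0 mS y)
  have ym: "y (N + k) \<le> m N k" for N k by (cases k) (auto simp: m0 mS)
  have m_nonneg: "0 \<le> m N k" for N k using y(1) ym order_trans by blast
  have shift: "m (Suc N) k \<le> m N (Suc k)" for N k
    by (induction k) (auto simp: m0 mS intro: le_supI1 le_supI2)
  have "\<exists>t. m N \<longlonglongrightarrow> t" for N
    using oc[OF inc mu] Cauchy_convergent convergent_def by blast
  then obtain t where t: "\<And>N. m N \<longlonglongrightarrow> t N" by metis
  have mt: "m N k \<le> t N" for N k by (rule limit_ge_const[OF t, of k]) (rule incseqD[OF inc])
  have tu: "t N \<le> u" for N by (rule limit_le_const[OF t]) (rule mu)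
  have t0: "0 \<le> t N" for N using m_nonneg mt order_trans by blast
  have tS: "t (Suc N) \<le> t N" for N
    by (rule limit_le_const[OF t]) (use shift mt order_trans in blast)
  have dec: "t n \<le> t N" if "N \<le> n" for N n using that by (induction rule: dec_induct) (auto intro: order_trans tS)
  \<comment> \<open>A decreasing positive sequence converges because its complement in the bound
    \<open>u\<close> increases.\<close>
  have "Cauchy (\<lambda>N. u - t N)"
  proof (rule oc)
    show "incseq (\<lambda>N. u - t N)" by (rule incseq_SucI) (simp add: tS)
    show "u - t N \<le> u" for N using t0 by simp
  qed
  then obtain l' where "(\<lambda>N. u - t N) \<longlonglongrightarrow> l'" using Cauchy_convergent convergent_def by blast
  from tendsto_diff[OF tendsto_const[of u] this] have tl: "t \<longlonglongrightarrow> u - l'" by simp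
  define l where "l = u - l'"
  have tl: "t \<longlonglongrightarrow> l" using tl by (simp add: l_def)
  have l0: "0 \<le> l" by (rule limit_ge_const[OF tl]) (rule t0)
  have lt: "l \<le> t N" for N by (rule limit_le_const[OF tl, of N]) (rule dec)
  show thesis
  proof (rule that[OF _ tl l0])
    show "y n \<le> t N" if "N \<le> n" for N n using ym[of N "n - N"] mt[of N "n - N"] that by simp
    fix F assume F: "posf F" and sm: "summable (\<lambda>n. blinfun_apply F (y n))"
    have Fm: "F (m N k) \<le> (\<Sum>j<Suc k. F (y (j + N)))" for N k
    proof (induction k)
      case (Suc k)
      have "m N (Suc k) \<le> m N k + y (N + Suc k)"
        unfolding mS using m_nonneg y(1) by (auto intro: add_increasing add_increasing2)
      from posf_mono[OF F this] Suc show ?case by (simp add: blinfun.add_right add.commute)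
    qed (simp add: m0)
    have smN: "summable (\<lambda>j. F (y (j + N)))" for N using sm by (rule summable_ignore_initial_segment)
    have "F (t N) \<le> (\<Sum>j. F (y (j + N)))" for N
    proof (rule LIMSEQ_le_const2)
      show "(\<lambda>k. F (m N k)) \<longlonglongrightarrow> F (t N)" by (intro blinfun.tendsto tendsto_const t)
      have "(\<Sum>j<Suc k. F (y (j + N))) \<le> (\<Sum>j. F (y (j + N)))" for k
        by (rule sum_le_suminf[OF smN]) (auto intro: posfD[OF F] y)
      then show "\<exists>K. \<forall>k\<ge>K. F (m N k) \<le> (\<Sum>j. F (y (j + N)))" using Fm order_trans by blast
    qed
    then have "F l \<le> (\<Sum>j. F (y (j + N)))" for N using posf_mono[OF F lt] order_trans by blast
    moreover have "(\<lambda>N. \<Sum>j. F (y (j + N))) \<longlonglongrightarrow> 0" by (rule suminf_exist_split2[OF sm])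
    ultimately have "F l \<le> 0" by (meson LIMSEQ_le_const)
    with posfD[OF F l0] show "F l = 0" by simp
  qed
qed

text \<open>The upper limit is annihilated by all positive functionals, hence 0, so the tail suprema
  tend to 0 in norm and dominate \<open>y\<close>.\<close>

lemma norm_null_of_summable:
  fixes y :: "nat \<Rightarrow> 'a::banach_lattice"
  assumes oc: "\<And>X (u::'a). incseq X \<Longrightarrow> (\<And>n. X n \<le> u) \<Longrightarrow> Cauchy X"
    and y: "\<And>n. 0 \<le> y n" "\<And>n. y n \<le> u"
    and sm: "\<And>F. posf F \<Longrightarrow> summable (\<lambda>n. blinfun_apply F (y n))"
  shows "(\<lambda>n. norm (y n)) \<longlonglongrightarrow> 0"
proof -
  obtain t l where t: "\<And>N n. N \<le> n \<Longrightarrow> y n \<le> t N" "t \<longlonglongrightarrow> l" "0 \<le> l"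
    "\<And>F. posf F \<Longrightarrow> summable (\<lambda>n. blinfun_apply F (y n)) \<Longrightarrow> F l = 0"
    by (rule tail_suprema[of y u, OF oc y]) blast+
  have "l = 0" by (rule eq_zero_if_posf_zero[OF t(3)]) (use t(4) sm in blast)
  with t(2) have "(\<lambda>n. norm (t n)) \<longlonglongrightarrow> 0" by (simp add: tendsto_norm_zero)
  then show ?thesis
    by (rule Lim_null_comparison[rotated]) (use norm_mono_nonneg[OF y(1) t(1)] in simp)
qed

section \<open>Norm bounded increasing sequences\<close>

text \<open>The functional \<open>\<psi>\<close> cut down to the band generated by \<open>v\<close>.\<close>

lemma band_functional:
  fixes v :: "'a::banach_lattice"
  assumes \<psi>: "posf \<psi>" and v: "0 \<le> v"
  obtains \<phi> where "posf \<phi>" "norm \<phi> \<le> norm \<psi>" "blinfun_apply \<phi> v = \<psi> v"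
    "\<And>x e. 0 \<le> x \<Longrightarrow> 0 < e \<Longrightarrow> \<exists>j::nat. blinfun_apply \<phi> x \<le> \<psi> (inf x (real j *\<^sub>R v)) + e"
proof -
  \<comment> \<open>In effect \<open>\<psi>\<close> of the projection of \<open>x\<close> onto the
    band of \<open>v\<close>, expressed as a supremum of values so that no projection has to be
    formed.\<close>
  define \<theta> where "\<theta> x = (SUP j::nat. \<psi> (inf x (real j *\<^sub>R v)))" for x
  have le: "\<psi> (inf x (real j *\<^sub>R v)) \<le> \<psi> x" for x j by (rule posf_mono[OF \<psi>]) simp
  have bdd: "bdd_above (range (\<lambda>j::nat. \<psi> (inf x (real j *\<^sub>R v))))" for x using le by (intro bdd_aboveI2)
  have up: "\<psi> (inf x (real j *\<^sub>R v)) \<le> \<theta> x" for x j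
    unfolding \<theta>_def by (rule cSUP_upper[OF _ bdd]) simp
  have low: "\<theta> x \<le> B" if "\<And>j. \<psi> (inf x (real j *\<^sub>R v)) \<le> B" for x B
    unfolding \<theta>_def by (rule cSUP_least) (use that in auto)
  have mono: "\<psi> (inf x (real i *\<^sub>R v)) \<le> \<psi> (inf x (real j *\<^sub>R v))" if "i \<le> j" for x i j
    using that v by (intro posf_mono[OF \<psi>] inf_mono order_refl scaleR_right_mono) auto
  have jv: "0 \<le> real j *\<^sub>R v" for j using v by (intro scaleR_nonneg_nonneg) auto
  have add: "\<theta> (x + y) = \<theta> x + \<theta> y" if xy: "0 \<le> x" "0 \<le> y" for x y
  proof (rule antisym)
    show "\<theta> (x + y) \<le> \<theta> x + \<theta> y"
    proof (rule low)
      fix j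
      have "\<psi> (inf (x + y) (real j *\<^sub>R v)) \<le> \<psi> (inf x (real j *\<^sub>R v) + inf y (real j *\<^sub>R v))"
        by (intro posf_mono[OF \<psi>] inf_add_le xy jv)
      also have "\<dots> \<le> \<theta> x + \<theta> y" by (simp add: blinfun.add_right add_mono up)
      finally show "\<psi> (inf (x + y) (real j *\<^sub>R v)) \<le> \<theta> x + \<theta> y" .
    qed
    have *: "\<psi> (inf x (real i *\<^sub>R v)) + \<psi> (inf y (real j *\<^sub>R v)) \<le> \<theta> (x + y)" for i j
    proof -
      let ?m = "max i j"
      have "\<psi> (inf x (real i *\<^sub>R v)) + \<psi> (inf y (real j *\<^sub>R v))
          \<le> \<psi> (inf x (real ?m *\<^sub>R v)) + \<psi> (inf y (real ?m *\<^sub>R v))"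
        by (intro add_mono mono) auto
      also have "\<dots> = \<psi> (inf x (real ?m *\<^sub>R v) + inf y (real ?m *\<^sub>R v))" by (simp add: blinfun.add_right)
      \<comment> \<open>Two truncations at level \<open>?m\<close> may add up to
        \<open>2 * ?m\<close> copies of \<open>v\<close>; the supremum over all levels absorbs the
        factor.\<close>
      also have "\<dots> \<le> \<psi> (inf (x + y) (real (2 * ?m) *\<^sub>R v))"
      proof (rule posf_mono[OF \<psi>], rule inf_greatest)
        show "inf x (real ?m *\<^sub>R v) + inf y (real ?m *\<^sub>R v) \<le> x + y" by (intro add_mono) auto
        have "inf x (real ?m *\<^sub>R v) + inf y (real ?m *\<^sub>R v) \<le> real ?m *\<^sub>R v + real ?m *\<^sub>R v"
          by (intro add_mono) auto
        also have "\<dots> = real (2 * ?m) *\<^sub>R v" by (simp add: scaleR_add_left[symmetric])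
        finally show "inf x (real ?m *\<^sub>R v) + inf y (real ?m *\<^sub>R v) \<le> real (2 * ?m) *\<^sub>R v" .
      qed
      also have "\<dots> \<le> \<theta> (x + y)" by (rule up)
      finally show ?thesis .
    qed
    have "\<theta> x \<le> \<theta> (x + y) - \<theta> y"
    proof (rule low)
      fix i
      have "\<theta> y \<le> \<theta> (x + y) - \<psi> (inf x (real i *\<^sub>R v))" by (rule low) (use * in \<open>simp add: le_diff_eq add.commute\<close>)
      then show "\<psi> (inf x (real i *\<^sub>R v)) \<le> \<theta> (x + y) - \<theta> y" by simp
    qed
    then show "\<theta> x + \<theta> y \<le> \<theta> (x + y)" by simp
  qed
  have nonneg: "0 \<le> \<theta> x" if "0 \<le> x" for x
  proof -
    have "0 \<le> \<psi> (inf x (real 0 *\<^sub>R v))" using that by (intro posfD[OF \<psi>]) auto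
    then show ?thesis using up[of x 0] by simp
  qed
  have \<theta>\<psi>: "\<theta> x \<le> \<psi> x" for x by (rule low[OF le])
  have scale_le: "\<theta> (c *\<^sub>R x) \<le> c * \<theta> x" if c: "0 < c" and x: "0 \<le> x" for c x
  proof (rule low)
    fix j :: nat
    obtain i :: nat where i: "real j / c \<le> real i" using real_arch_simple by blast
    have "inf (c *\<^sub>R x) (real j *\<^sub>R v) = c *\<^sub>R inf x ((real j / c) *\<^sub>R v)" using c by (simp add: scaleR_inf)
    also have "\<psi> \<dots> \<le> c * \<psi> (inf x (real i *\<^sub>R v))"
      using c i v by (simp add: blinfun.scaleR_right)
        (intro mult_left_mono posf_mono[OF \<psi>] inf_mono order_refl scaleR_right_mono, auto)
    also have "\<dots> \<le> c * \<theta> x" using c up by (intro mult_left_mono) auto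
    finally show "\<psi> (inf (c *\<^sub>R x) (real j *\<^sub>R v)) \<le> c * \<theta> x" .
  qed
  have scale: "\<theta> (c *\<^sub>R x) = c * \<theta> x" if "0 \<le> c" "0 \<le> x" for c x
  proof (cases "c = 0")
    case True
    then show ?thesis using nonneg[of 0] \<theta>\<psi>[of 0] by simp
  next
    case False
    with that have c: "0 < c" by simp
    have "\<theta> x \<le> inverse c * \<theta> (c *\<^sub>R x)"
      using scale_le[of "inverse c" "c *\<^sub>R x"] c that by (simp add: scaleR_nonneg_nonneg)
    then show ?thesis using scale_le[OF c that(2)] c by (simp add: field_simps)
  qed
  have bound: "\<theta> x \<le> norm \<psi> * norm x" for x using \<theta>\<psi>[of x] apply_le_norm[of \<psi> x] by simp
  obtain \<phi> where \<phi>: "posf \<phi>" "\<And>x. 0 \<le> x \<Longrightarrow> blinfun_apply \<phi> x = \<theta> x"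
    by (rule extend_from_cone[of \<theta> "norm \<psi>", OF add scale nonneg bound]) blast+
  show thesis
  proof (rule that)
    show "posf \<phi>" by (rule \<phi>)
    show "norm \<phi> \<le> norm \<psi>"
    proof (rule norm_blinfun_le_of_le)
      fix x
      have "\<phi> x \<le> \<phi> (labs x)" by (rule posf_mono[OF \<phi>(1) le_labs])
      also have "\<dots> \<le> norm \<psi> * norm x" using bound[of "labs x"] by (simp add: \<phi>(2))
      finally show "\<phi> x \<le> norm \<psi> * norm x" .
    qed simp
    show "\<phi> v = \<psi> v" using up[of v 1] \<theta>\<psi>[of v] by (simp add: \<phi>(2) v)
    show "\<exists>j::nat. \<phi> x \<le> \<psi> (inf x (real j *\<^sub>R v)) + e" if x: "0 \<le> x" and e: "0 < e" for x e
    proof (rule ccontr)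
      assume "\<not> ?thesis"
      then have "\<psi> (inf x (real j *\<^sub>R v)) \<le> \<phi> x - e" for j :: nat by (auto simp: not_le less_diff_eq intro: less_imp_le)
      then have "\<theta> x \<le> \<phi> x - e" by (rule low)
      with e show False by (simp add: \<phi>(2) x)
    qed
  qed
qed

text \<open>The sums of \<open>v\<close> are bounded in norm only, so bounded coefficients need not
  give a convergent series, but coefficients tending to 0 do. On the dual side
  \<open>f \<mapsto> (\<lambda>n. f (v n))\<close> is bounded into \<open>\<ell>\<^sub>1\<close>, so
  the sum of the \<open>\<bar>f m (v n)\<bar>\<close> over \<open>n\<close> tends to 0 while the
  coefficients \<open>\<phi> n (x m)\<close> stay bounded.\<close>

lemma c0_series_operator:
  fixes v :: "nat \<Rightarrow> 'a::banach_lattice" and \<phi> :: "nat \<Rightarrow> 'a \<Rightarrow>\<^sub>L real"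
  assumes v: "\<And>n. 0 \<le> v n" "\<And>N. norm (\<Sum>n<N. v n) \<le> C"
    and pos: "\<And>n. posf (\<phi> n)" and \<phi>: "\<And>n. norm (\<phi> n) \<le> 1" and null: "\<And>x. (\<lambda>n. \<phi> n x) \<longlonglongrightarrow> 0"
  obtains T :: "'a \<Rightarrow>\<^sub>L 'a" where "positive_op T" "weak_DP T" "\<And>x n. 0 \<le> x \<Longrightarrow> \<phi> n x *\<^sub>R v n \<le> T x"
proof -
  have C0: "0 \<le> C" using v(2)[of 0] by simp
  have sumA: "norm (\<Sum>n\<in>A. v n) \<le> C" if fin: "finite A" for A
  proof -
    obtain N where "A \<subseteq> {..<N}" using finite_nat_bounded[OF fin] by blast
    then have "(\<Sum>n\<in>A. v n) \<le> (\<Sum>n<N. v n)" using v(1) by (intro sum_mono2) auto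
    then have "norm (\<Sum>n\<in>A. v n) \<le> norm (\<Sum>n<N. v n)" using v(1) by (intro norm_mono_nonneg sum_nonneg)
    with v(2) show ?thesis using order_trans by blast
  qed
  have sum_le: "norm (\<Sum>n\<in>A. a n *\<^sub>R v n) \<le> b * C" if "finite A" "\<And>n. n \<in> A \<Longrightarrow> \<bar>a n\<bar> \<le> b" "0 \<le> b" for A a b
  proof -
    have "labs (\<Sum>n\<in>A. a n *\<^sub>R v n) \<le> b *\<^sub>R (\<Sum>n\<in>A. v n)" using that v(1) by (intro labs_signed_sum_le)
    then have "norm (\<Sum>n\<in>A. a n *\<^sub>R v n) \<le> norm (b *\<^sub>R (\<Sum>n\<in>A. v n))" by (rule norm_le_of_labs_le)
    also have "\<dots> = b * norm (\<Sum>n\<in>A. v n)" using that by simp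
    also have "\<dots> \<le> b * C" using sumA that by (intro mult_left_mono) auto
    finally show ?thesis .
  qed
  have le: "\<bar>\<phi> n x\<bar> \<le> norm x" for n x
    using norm_blinfun[of "\<phi> n" x] mult_right_mono[OF \<phi>[of n] norm_ge_zero[of x]] by simp
  have sm: "summable (\<lambda>n. \<phi> n x *\<^sub>R v n)" for x
    unfolding summable_Cauchy
  proof (intro allI impI)
    fix e :: real assume e: "0 < e"
    define b where "b = e / (C + 1)"
    have b: "0 < b" using e C0 by (simp add: b_def)
    obtain N where N: "\<And>n. N \<le> n \<Longrightarrow> \<bar>\<phi> n x\<bar> < b" using LIMSEQ_D[OF null b, of x] by auto
    have "b * C < e" using e C0 by (simp add: b_def field_simps)
    moreover have "norm (\<Sum>n\<in>{m..<k}. \<phi> n x *\<^sub>R v n) \<le> b * C" if "N \<le> m" for m k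
      using N that b by (intro sum_le) (auto intro: less_imp_le)
    ultimately show "\<exists>N. \<forall>m\<ge>N. \<forall>k. norm (\<Sum>n\<in>{m..<k}. \<phi> n x *\<^sub>R v n) < e"
      using order_le_less_trans by blast
  qed
  define T where "T x = (\<Sum>n. \<phi> n x *\<^sub>R v n)" for x
  have lim: "(\<lambda>N. \<Sum>n<N. \<phi> n x *\<^sub>R v n) \<longlonglongrightarrow> T x" for x
    unfolding T_def using sm by (rule summable_LIMSEQ)
  have "bounded_linear T"
  proof (rule bounded_linear_intro)
    show "T (x + y) = T x + T y" for x y
      by (simp add: T_def blinfun.add_right scaleR_add_left suminf_add[OF sm sm])
    show "T (r *\<^sub>R x) = r *\<^sub>R T x" for r x
      using suminf_scaleR_right[OF sm, of r x] by (simp add: T_def blinfun.scaleR_right)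
    show "norm (T x) \<le> norm x * C" for x
    proof (rule LIMSEQ_le_const2[OF tendsto_norm[OF lim]])
      show "\<exists>N. \<forall>n\<ge>N. norm (\<Sum>n<n. \<phi> n x *\<^sub>R v n) \<le> norm x * C" using le by (auto intro!: sum_le)
    qed
  qed
  then have T: "blinfun_apply (Blinfun T) = T" by (rule bounded_linear_Blinfun_apply)
  have ge: "\<phi> n x *\<^sub>R v n \<le> T x" if "0 \<le> x" for x n
  proof (rule limit_ge_const[OF lim, of "Suc n"])
    fix N assume "Suc n \<le> N"
    then have "(\<Sum>k\<in>{n}. \<phi> k x *\<^sub>R v k) \<le> (\<Sum>k<N. \<phi> k x *\<^sub>R v k)"
      using posfD[OF pos that] v(1) by (intro sum_mono2) (auto intro: scaleR_nonneg_nonneg)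
    then show "\<phi> n x *\<^sub>R v n \<le> (\<Sum>k<N. \<phi> k x *\<^sub>R v k)" by simp
  qed
  show thesis
  proof (rule that[of "Blinfun T"])
    show "positive_op (Blinfun T)"
      unfolding positive_op_def T
    proof (intro allI impI)
      fix x :: 'a assume x: "0 \<le> x"
      have "0 \<le> \<phi> 0 x *\<^sub>R v 0" using posfD[OF pos x] v(1) by (intro scaleR_nonneg_nonneg)
      then show "0 \<le> T x" using ge[OF x, of 0] by (rule order_trans)
    qed
    show "weak_DP (Blinfun T)"
      unfolding weak_DP_def T
    proof (intro allI impI)
      fix x :: "nat \<Rightarrow> 'a" and f :: "nat \<Rightarrow> 'a \<Rightarrow>\<^sub>L real"
      assume *: "weakly_null x \<and> weakly_null f"
      obtain M where M: "\<And>m. norm (x m) \<le> M" using weakly_null_bounded * by blast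
      have M0: "0 \<le> M" using M[of 0] norm_ge_zero order_trans by blast
      have bd: "(\<Sum>n<N. \<bar>eval_at (v n) g\<bar>) \<le> C * norm g" for g :: "'a \<Rightarrow>\<^sub>L real" and N
        using sum_abs_functional_le[of "{..<N}" v C g] v by (simp add: mult.commute)
      have f: "weakly_null f" using * by simp
      note sf = schur[OF f bd]
      have "(\<lambda>m. M * (\<Sum>n. \<bar>eval_at (v n) (f m)\<bar>)) \<longlonglongrightarrow> M * 0" by (intro tendsto_mult tendsto_const sf)
      then have lim0: "(\<lambda>m. M * (\<Sum>n. \<bar>eval_at (v n) (f m)\<bar>)) \<longlonglongrightarrow> 0" by simp
      have "\<bar>f m (T (x m))\<bar> \<le> M * (\<Sum>n. \<bar>eval_at (v n) (f m)\<bar>)" for m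
      proof (rule LIMSEQ_le_const2)
        show "(\<lambda>N. \<bar>f m (\<Sum>n<N. \<phi> n (x m) *\<^sub>R v n)\<bar>) \<longlonglongrightarrow> \<bar>f m (T (x m))\<bar>"
          by (intro tendsto_rabs blinfun.tendsto tendsto_const lim)
        have "\<bar>f m (\<Sum>n<N. \<phi> n (x m) *\<^sub>R v n)\<bar> \<le> M * (\<Sum>n. \<bar>eval_at (v n) (f m)\<bar>)" for N
        proof -
          have "\<bar>f m (\<Sum>n<N. \<phi> n (x m) *\<^sub>R v n)\<bar> \<le> (\<Sum>n<N. \<bar>\<phi> n (x m) * f m (v n)\<bar>)"
            by (simp add: blinfun.sum_right blinfun.scaleR_right sum_abs)
          also have "\<dots> \<le> (\<Sum>n<N. M * \<bar>eval_at (v n) (f m)\<bar>)"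
            using order_trans[OF le M] by (intro sum_mono) (auto simp: abs_mult intro: mult_right_mono)
          also have "\<dots> = M * (\<Sum>n<N. \<bar>eval_at (v n) (f m)\<bar>)" by (simp add: sum_distrib_left)
          also have "\<dots> \<le> M * (\<Sum>n. \<bar>eval_at (v n) (f m)\<bar>)"
            by (intro mult_left_mono sum_le_suminf sf M0) auto
          finally show ?thesis .
        qed
        then show "\<exists>N. \<forall>n\<ge>N. \<bar>f m (\<Sum>n<n. \<phi> n (x m) *\<^sub>R v n)\<bar> \<le> M * (\<Sum>n. \<bar>eval_at (v n) (f m)\<bar>)"
          by blast
      qed
      then show "(\<lambda>m. f m (T (x m))) \<longlonglongrightarrow> 0"
        by (intro Lim_null_comparison[OF _ lim0]) simp
    qed
    show "\<phi> n x *\<^sub>R v n \<le> Blinfun T x" if "0 \<le> x" for x n unfolding T by (rule ge[OF that])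
  qed
qed

text \<open>Without an order bound, the functionals have to tend to 0 pointwise. The increments are
  thinned out until each is almost disjoint from large multiples of the earlier ones, then made
  disjoint. Norming functionals cut down to the bands of the resulting \<open>V k\<close> are null
  at every \<open>x\<close>, because the parts of \<open>x\<close> in disjoint bands form a
  convergent series.\<close>

lemma norm_bounded_incseq_Cauchy:
  fixes X :: "nat \<Rightarrow> 'a::banach_lattice"
  assumes oc: "\<And>X (u::'a). incseq X \<Longrightarrow> (\<And>n. X n \<le> u) \<Longrightarrow> Cauchy X"
    and H: "\<And>T :: 'a \<Rightarrow>\<^sub>L 'a. positive_op T \<Longrightarrow> weak_DP T \<Longrightarrow> uaw_DP T"
    and inc: "incseq X" and bd: "\<And>n. norm (X n) \<le> C"
  shows "Cauchy X"
proof (rule ccontr)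
  assume "\<not> Cauchy X"
  then obtain s \<delta> where s: "strict_mono (s :: nat \<Rightarrow> nat)" and \<delta>: "0 < \<delta>"
    and big: "\<And>k. \<delta> \<le> norm (X (s (Suc k)) - X (s k))"
    using incseq_not_Cauchy[OF inc] by metis
  define d where "d k = X (s (Suc k)) - X (s k)" for k
  have d0: "0 \<le> d n" for n
    using incseqD[OF inc, of "s n" "s (Suc n)"] strict_mono_less_eq[OF s, of n "Suc n"] by (simp add: d_def)
  have dsum: "norm (\<Sum>k<N. d k) \<le> C + C" for N
  proof -
    have "(\<Sum>k<N. d k) = X (s N) - X (s 0)" unfolding d_def by (rule sum_lessThan_telescope)
    then show ?thesis using norm_triangle_ineq4[of "X (s N)" "X (s 0)"] bd[of "s N"] bd[of "s 0"] by simp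
  qed
  have d\<delta>: "\<delta> \<le> norm (d k)" for k using big by (simp add: d_def)
  have dle: "norm (d n) \<le> C + C" for n
  proof -
    have "d n \<le> (\<Sum>n<Suc n. d n)" using sum_nonneg[of "{..<n}" d] d0 by simp
    then have "norm (d n) \<le> norm (\<Sum>n<Suc n. d n)" by (rule norm_mono_nonneg[OF d0])
    with dsum show ?thesis using order_trans by blast
  qed
  have dnull: "(\<lambda>n. norm (inf (d n) u)) \<longlonglongrightarrow> 0" if u: "0 \<le> u" for u
  proof (rule norm_null_of_summable[where u=u])
    show "Cauchy X" if "incseq X" "\<And>n. X n \<le> u" for X and u :: 'a using oc that .
    show nn: "0 \<le> inf (d n) u" for n using d0 u by simp
    show "inf (d n) u \<le> u" for n by simp
    fix F :: "'a \<Rightarrow>\<^sub>L real" assume F: "posf F"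
    have "norm (\<Sum>n<N. inf (d n) u) \<le> C + C" for N
      using norm_mono_nonneg[of "\<Sum>n<N. inf (d n) u" "\<Sum>n<N. d n"] dsum[of N] nn
      by (meson inf_le1 order_trans sum_mono sum_nonneg)
    then have "summable (\<lambda>n. \<bar>F (inf (d n) u)\<bar>)" by (rule bounded_sums_summable[OF nn])
    then show "summable (\<lambda>n. F (inf (d n) u))" by (rule summable_rabs_cancel)
  qed
  \<comment> \<open>State at stage \<open>k\<close>: the index \<open>n\<close> of the next
    increment and the sum \<open>\<sigma>\<close> of those chosen before. The multiple
    \<open>4^k\<close> is the one that disjointification will subtract.\<close>
  define P :: "nat \<Rightarrow> nat \<times> 'a \<Rightarrow> bool"
    where "P k = (\<lambda>(n, \<sigma>). 0 \<le> \<sigma> \<and> norm (inf (d n) (4^k *\<^sub>R \<sigma>)) \<le> \<delta> / 4)" for k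
  define Q :: "nat \<times> 'a \<Rightarrow> nat \<times> 'a \<Rightarrow> bool"
    where "Q = (\<lambda>(n, \<sigma>) (n', \<sigma>'). n < n' \<and> \<sigma>' = \<sigma> + d n)"
  have "\<exists>f. \<forall>k. P k (f k) \<and> Q (f k) (f (Suc k))"
  proof (rule dependent_nat_choice)
    have "P 0 (0, 0)" using \<delta> d0 by (simp add: P_def inf_absorb2)
    then show "\<exists>x. P 0 x" ..
  next
    fix x :: "nat \<times> 'a" and k assume "P k x"
    moreover obtain n \<sigma> where x: "x = (n, \<sigma>)" by (cases x) auto
    ultimately have \<sigma>: "0 \<le> \<sigma> + d n" using d0 by (simp add: P_def)
    then have "0 \<le> 4^Suc k *\<^sub>R (\<sigma> + d n)" by (intro scaleR_nonneg_nonneg) simp_all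
    from dnull[OF this] have "\<forall>\<^sub>F n' in sequentially. norm (inf (d n') (4^Suc k *\<^sub>R (\<sigma> + d n))) < \<delta> / 4"
      by (rule order_tendstoD) (use \<delta> in simp)
    then have "\<forall>\<^sub>F n' in sequentially. n < n' \<and> norm (inf (d n') (4^Suc k *\<^sub>R (\<sigma> + d n))) < \<delta> / 4"
      by (intro eventually_conj eventually_gt_at_top)
    then obtain n' where "n < n'" "norm (inf (d n') (4^Suc k *\<^sub>R (\<sigma> + d n))) < \<delta> / 4"
      by (auto dest: eventually_happens)
    then have "P (Suc k) (n', \<sigma> + d n)" "Q x (n', \<sigma> + d n)" using \<sigma> x by (simp_all add: P_def Q_def less_imp_le)
    then show "\<exists>y. P (Suc k) y \<and> Q x y" by blast
  qed
  then obtain f where P: "\<And>k. P k (f k)" and Q: "\<And>k. Q (f k) (f (Suc k))" by blast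
  define r where "r k = fst (f k)" for k
  have f: "f k = (r k, snd (f k))" for k by (simp add: r_def)
  have P': "0 \<le> snd (f k)" "norm (inf (d (r k)) (4^k *\<^sub>R snd (f k))) \<le> \<delta> / 4" for k
    using P[of k] f[of k] unfolding P_def by (metis (mono_tags, lifting) case_prod_conv)+
  have Q': "r k < r (Suc k)" "snd (f (Suc k)) = snd (f k) + d (r k)" for k
    using Q[of k] f[of k] f[of "Suc k"] unfolding Q_def by (metis (mono_tags, lifting) case_prod_conv)+
  have r: "strict_mono r" using Q'(1) by (simp add: strict_mono_Suc_iff)
  define x where "x k = d (r k)" for k
  have sx: "(\<Sum>j<k. x j) \<le> snd (f k)" for k
    by (induction k) (auto simp: P' Q' x_def intro: add_right_mono)
  have x0: "0 \<le> x k" and xC: "norm (x k) \<le> C + C" for k using d0 dle by (simp_all add: x_def)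
  have xsmall: "norm (inf (x k) (4^k *\<^sub>R (\<Sum>j<k. x j))) \<le> \<delta> / 4" for k
  proof -
    have "inf (x k) (4^k *\<^sub>R (\<Sum>j<k. x j)) \<le> inf (x k) (4^k *\<^sub>R snd (f k))"
      by (intro inf_mono order_refl scaleR_left_mono sx) simp
    then have "norm (inf (x k) (4^k *\<^sub>R (\<Sum>j<k. x j))) \<le> norm (inf (x k) (4^k *\<^sub>R snd (f k)))"
      by (intro norm_mono_nonneg inf_nonneg x0 scaleR_nonneg_nonneg sum_nonneg) simp_all
    with P'(2)[of k] show ?thesis by (simp add: x_def)
  qed
  define w where "w = (\<Sum>j. (1/2)^j *\<^sub>R x j)"
  define v where "v n = pprt (x n - (4^n) *\<^sub>R (\<Sum>j<n. x j) - (1/2)^n *\<^sub>R w)" for n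
  note v = disjointification[of x "C + C", OF x0 xC, folded w_def, folded v_def]
  have vbig: "\<delta> - \<delta> / 4 - (1/2)^k * norm w \<le> norm (v k)" for k
  proof -
    let ?a = "4^k *\<^sub>R (\<Sum>j<k. x j)" and ?b = "(1/2)^k *\<^sub>R w"
    have b0: "0 \<le> ?b" using v(1) by (intro scaleR_nonneg_nonneg) auto
    have a0: "0 \<le> ?a" using x0 by (intro scaleR_nonneg_nonneg sum_nonneg) auto
    \<comment> \<open>Disjointification removes from \<open>x k\<close> its meet with
      \<open>?a + ?b\<close>; the first summand contributes little by the thinning, the second by
      its factor \<open>(1/2)^k\<close>.\<close>
    have "x k - v k = inf (x k) (?a + ?b)"
      using diff_inf_eq_pprt[of "x k" "?a + ?b"] by (simp add: v_def diff_diff_add algebra_simps)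
    also have "\<dots> \<le> inf (x k) ?a + ?b"
    proof -
      have "inf (?a + ?b) (x k) \<le> inf ?a (x k) + inf ?b (x k)" by (rule inf_add_le[OF a0 b0 x0])
      also have "\<dots> \<le> inf ?a (x k) + ?b" by (intro add_left_mono) simp
      finally show ?thesis by (simp add: inf_commute)
    qed
    finally have "norm (x k - v k) \<le> norm (inf (x k) ?a + ?b)" using v(3)[of k] by (intro norm_mono_nonneg) auto
    also have "\<dots> \<le> norm (inf (x k) ?a) + norm ?b" by (rule norm_triangle_ineq)
    also have "\<dots> \<le> \<delta> / 4 + (1/2)^k * norm w" using xsmall[of k] by simp
    finally have "norm (x k) - norm (v k) \<le> \<delta> / 4 + (1/2)^k * norm w"
      using norm_triangle_ineq2[of "x k" "v k"] by simp
    with d\<delta>[of "r k"] show ?thesis by (simp add: x_def)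
  qed
  have "(\<lambda>k. (1/2)^k * norm w) \<longlonglongrightarrow> 0" by (intro tendsto_mult_left_zero LIMSEQ_power_zero) simp
  then have "\<forall>\<^sub>F k in sequentially. (1/2)^k * norm w < \<delta> / 4" by (rule order_tendstoD) (use \<delta> in simp)
  \<comment> \<open>From \<open>K\<close> on the two losses are at most \<open>\<delta> / 4\<close>
    each, so \<open>\<delta> / 2\<close> of the norm survives.\<close>
  then obtain K where K: "\<And>k. K \<le> k \<Longrightarrow> (1/2)^k * norm w < \<delta> / 4" by (auto simp: eventually_sequentially)
  define V where "V k = v (k + K)" for k
  have V0: "0 \<le> V k" for k using v(2) by (simp add: V_def)
  have V\<delta>: "\<delta> / 2 \<le> norm (V k)" for k using vbig[of "k + K"] K[of "k + K"] by (simp add: V_def)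
  have Vdisj: "inf (V n) (V m) = 0" if "n \<noteq> m" for n m using v(4)[of "n + K" "m + K"] that by (simp add: V_def)
  have Vsum: "norm (\<Sum>k<N. V k) \<le> C + C" for N
  proof -
    have inj: "inj_on (\<lambda>k. r (k + K)) {..<N}" using strict_mono_eq[OF r] by (auto simp: inj_on_def)
    have "(\<Sum>k<N. V k) \<le> (\<Sum>k<N. d (r (k + K)))" unfolding V_def using v(3) by (intro sum_mono) (simp add: x_def)
    also have "\<dots> = (\<Sum>n\<in>(\<lambda>k. r (k + K)) ` {..<N}. d n)" by (simp add: sum.reindex[OF inj])
    also have "\<dots> \<le> (\<Sum>n<r (N + K). d n)"
      using d0 strict_mono_less[OF r] by (intro sum_mono2) auto
    finally have "norm (\<Sum>k<N. V k) \<le> norm (\<Sum>n<r (N + K). d n)" using V0 by (intro norm_mono_nonneg sum_nonneg)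
    with dsum show ?thesis using order_trans by blast
  qed
  have "\<exists>\<psi>. posf \<psi> \<and> norm \<psi> \<le> 1 \<and> \<psi> (V k) = norm (V k)" for k
    using positive_norming_functional[OF V0] by metis
  then obtain \<psi> where \<psi>: "\<And>k. posf (\<psi> k)" "\<And>k. norm (\<psi> k) \<le> 1" "\<And>k. \<psi> k (V k) = norm (V k)" by metis
  have "\<exists>\<phi>. posf \<phi> \<and> norm \<phi> \<le> norm (\<psi> k) \<and> \<phi> (V k) = \<psi> k (V k)
      \<and> (\<forall>x e. 0 \<le> x \<longrightarrow> 0 < e \<longrightarrow> (\<exists>j::nat. \<phi> x \<le> \<psi> k (inf x (real j *\<^sub>R V k)) + e))" for k
    using band_functional[OF \<psi>(1) V0, of k k] by metis
  then obtain \<phi> where \<phi>: "\<And>k. posf (\<phi> k)" "\<And>k. norm (\<phi> k) \<le> norm (\<psi> k)" "\<And>k. \<phi> k (V k) = \<psi> k (V k)"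
      "\<And>k x e. 0 \<le> x \<Longrightarrow> 0 < e \<Longrightarrow> \<exists>j::nat. \<phi> k x \<le> \<psi> k (inf x (real j *\<^sub>R V k)) + e" by metis
  have \<phi>1: "norm (\<phi> k) \<le> 1" for k using \<phi>(2) \<psi>(2) order_trans by blast
  have null_pos: "(\<lambda>k. \<phi> k x) \<longlonglongrightarrow> 0" if x: "0 \<le> x" for x
  proof -
    \<comment> \<open>One truncation \<open>e k\<close> reaches the supremum behind
      \<open>\<phi> k x\<close> up to \<open>1 / real (Suc k)\<close>. These truncations are
      disjoint and below \<open>x\<close>, so their series converges and \<open>e k\<close> tends to
      0 in norm.\<close>
    have "\<exists>j::nat. \<phi> k x \<le> \<psi> k (inf x (real j *\<^sub>R V k)) + 1 / real (Suc k)" for k by (rule \<phi>(4)[OF x]) simp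
    then obtain j :: "nat \<Rightarrow> nat" where j: "\<And>k. \<phi> k x \<le> \<psi> k (inf x (real (j k) *\<^sub>R V k)) + 1 / real (Suc k)" by metis
    define e where "e k = inf x (real (j k) *\<^sub>R V k)" for k
    have jV: "0 \<le> real (j k) *\<^sub>R V k" for k using V0 by (intro scaleR_nonneg_nonneg) auto
    have e0: "0 \<le> e k" for k using x jV by (simp add: e_def)
    have ex: "e k \<le> x" for k by (simp add: e_def)
    have edisj: "inf (e n) (e m) = 0" if "n \<noteq> m" for n m
    proof (rule disjoint_mono[OF e0 _ e0 _ disjoint_scaleR[OF V0 V0 Vdisj[OF that]]])
      show "e n \<le> real (j n) *\<^sub>R V n" "e m \<le> real (j m) *\<^sub>R V m" by (simp_all add: e_def)
    qed simp_all
    have "Cauchy (\<lambda>N. \<Sum>k<N. e k)"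
    proof (rule oc)
      show "incseq (\<lambda>N. \<Sum>k<N. e k)" by (rule incseq_SucI) (simp add: e0)
      show "(\<Sum>k<N. e k) \<le> x" for N by (rule disjoint_sum_le[OF e0 ex edisj])
    qed
    then have "(\<lambda>k. e k) \<longlonglongrightarrow> 0"
      using Cauchy_convergent summable_iff_convergent summable_LIMSEQ_zero by blast
    then have "(\<lambda>k. norm (e k) + 1 / real (Suc k)) \<longlonglongrightarrow> 0 + 0"
      by (intro tendsto_add tendsto_norm_zero LIMSEQ_Suc[OF lim_1_over_n])
    moreover have "norm (\<phi> k x) \<le> norm (e k) + 1 / real (Suc k)" for k
    proof -
      have "\<psi> k (e k) \<le> norm (e k)"
        using apply_le_norm[of "\<psi> k" "e k"] mult_right_mono[OF \<psi>(2)[of k] norm_ge_zero[of "e k"]] by simp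
      then show ?thesis using j[of k] posfD[OF \<phi>(1) x, of k] by (simp add: e_def)
    qed
    ultimately show ?thesis by (intro Lim_null_comparison[of "\<lambda>k. \<phi> k x"]) auto
  qed
  have null: "(\<lambda>k. \<phi> k x) \<longlonglongrightarrow> 0" for x
  proof -
    have "(\<lambda>k. \<phi> k (pprt x) - \<phi> k (pprt (- x))) \<longlonglongrightarrow> 0 - 0" by (intro tendsto_diff null_pos) auto
    then show ?thesis by (simp add: blinfun.diff_right[symmetric] pprt_minus_pprt)
  qed
  obtain T :: "'a \<Rightarrow>\<^sub>L 'a" where T: "positive_op T" "weak_DP T" "\<And>x n. 0 \<le> x \<Longrightarrow> \<phi> n x *\<^sub>R V n \<le> T x"
    by (rule c0_series_operator[of V "C + C" \<phi>, OF V0 Vsum \<phi>(1) \<phi>1 null]) blast+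
  have "(\<lambda>n. T (V n)) \<longlonglongrightarrow> 0"
    by (rule uaw_DP_bounded_sums[OF H[OF T(1,2)] V0 Vsum])
  moreover have "(\<delta>/2) * (\<delta>/2) \<le> norm (T (V n))" for n
  proof -
    have "(\<delta>/2) * (\<delta>/2) \<le> norm (V n) * norm (V n)" using V\<delta>[of n] \<delta> by (intro mult_mono) auto
    also have "\<dots> = norm (\<phi> n (V n) *\<^sub>R V n)" by (simp add: \<phi> \<psi>)
    also have "\<dots> \<le> norm (T (V n))"
      using T(3)[OF V0, of n n] V0[of n] posfD[OF \<phi>(1) V0, of n n]
      by (intro norm_mono_nonneg scaleR_nonneg_nonneg) auto
    finally show ?thesis .
  qed
  moreover have "0 < (\<delta>/2) * (\<delta>/2)" using \<delta> by simp
  ultimately show False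
    using LIMSEQ_le_const[OF tendsto_norm, of "\<lambda>n. T (V n)" 0 "(\<delta>/2) * (\<delta>/2)"] by (simp add: not_le[symmetric])
qed

section \<open>Reflexive Banach lattices\<close>

text \<open>Hahn-Banach in place of weak* compactness: \<open>g x\<close> lies between the lower and
  the upper limit of \<open>f n x\<close>. Eventual lower bounds can be added and scaled, so they
  form an admissible set of constraints.\<close>

lemma cluster_functional:
  fixes f :: "nat \<Rightarrow> 'v::real_normed_vector \<Rightarrow>\<^sub>L real"
  assumes bd: "\<And>n. norm (f n) \<le> C"
  obtains g :: "'v \<Rightarrow>\<^sub>L real" where "\<And>x s. \<forall>\<^sub>F n in sequentially. s \<le> f n x \<Longrightarrow> s \<le> g x"
proof -
  define K where "K = {(x, s). \<forall>\<^sub>F n in sequentially. s \<le> f n x}"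
  have C0: "0 \<le> C" using bd norm_ge_zero order_trans by blast
  have rc: "real_cone K"
    unfolding real_cone_def
  proof (intro conjI allI impI)
    show "(0, 0) \<in> K" by (simp add: K_def)
    fix g s g' s' assume "(g, s) \<in> K" "(g', s') \<in> K"
    then have "\<forall>\<^sub>F n in sequentially. s \<le> f n g \<and> s' \<le> f n g'" by (simp add: K_def eventually_conj)
    then show "(g + g', s + s') \<in> K"
      by (auto simp: K_def blinfun.add_right elim!: eventually_mono)
  next
    fix c :: real and g s assume "0 < c" "(g, s) \<in> K"
    then show "(c *\<^sub>R g, c * s) \<in> K"
      by (auto simp: K_def blinfun.scaleR_right elim!: eventually_mono)
  qed
  have sub: "sublinear (\<lambda>x::'v. C * norm x)"
    unfolding sublinear_def using C0 norm_triangle_ineq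
    by (auto simp: distrib_left[symmetric] intro!: mult_left_mono)
  have le: "s \<le> C * norm x" if "(x, s) \<in> K" for x s
  proof -
    from that have "\<forall>\<^sub>F n in sequentially. s \<le> f n x" by (simp add: K_def)
    then obtain n where "s \<le> f n x" by (auto dest: eventually_happens)
    also have "\<dots> \<le> C * norm x"
      using apply_le_norm[of "f n" x] mult_right_mono[OF bd[of n] norm_ge_zero[of x]] by simp
    finally show ?thesis .
  qed
  obtain g :: "'v \<Rightarrow>\<^sub>L real" where "\<And>x. g x \<le> C * norm x" and g: "\<And>x s. (x, s) \<in> K \<Longrightarrow> s \<le> g x"
    by (rule hahn_banach_bounded[OF sub order_refl rc le]) blast+
  show thesis by (rule that[of g]) (use g in \<open>simp add: K_def\<close>)
qed

lemma cluster_limit: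
  fixes f :: "nat \<Rightarrow> 'v::real_normed_vector \<Rightarrow>\<^sub>L real"
  assumes g: "\<And>x s. \<forall>\<^sub>F n in sequentially. s \<le> f n x \<Longrightarrow> s \<le> blinfun_apply g x"
    and lim: "(\<lambda>n. f n x) \<longlonglongrightarrow> l"
  shows "g x = l"
proof -
  have *: "l - e \<le> g x" if "0 < e" and "(\<lambda>n. f n x) \<longlonglongrightarrow> l" for x l e
  proof (rule g)
    have "\<forall>\<^sub>F n in sequentially. l - e < f n x" by (rule order_tendstoD[OF that(2)]) (use that in simp)
    then show "\<forall>\<^sub>F n in sequentially. l - e \<le> f n x" by (auto elim: eventually_mono)
  qed
  have "(\<lambda>n. f n (- x)) \<longlonglongrightarrow> - l" using tendsto_minus[OF lim] by (simp add: blinfun.minus_right)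
  then have "- l - e \<le> g (- x)" if "0 < e" for e by (rule *[OF that])
  from this have 1: "g x \<le> l + e" if "0 < e" for e using that by (fastforce simp: blinfun.minus_right)
  have 2: "l \<le> g x + e" if "0 < e" for e using *[OF that lim] by simp
  show ?thesis using field_le_epsilon[OF 1] field_le_epsilon[OF 2] by simp
qed

text \<open>Otherwise Mazur separation gives an \<open>f\<close> that stays \<open>e\<close> below
  its value at \<open>w\<close> along the whole tail, which the property of \<open>w\<close>,
  applied to \<open>- f\<close>, excludes.\<close>

lemma cluster_near_hull:
  fixes x :: "nat \<Rightarrow> 'v::real_normed_vector"
  assumes w: "\<And>f s::real. \<forall>\<^sub>F n in sequentially. s \<le> blinfun_apply f (x n) \<Longrightarrow> s \<le> f w" and e: "0 < e"
  shows "\<exists>z\<in>convex hull (x ` {N..}). norm (w - z) < e"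
proof (rule ccontr)
  assume "\<not> ?thesis"
  then have "\<And>z. z \<in> convex hull (x ` {N..}) \<Longrightarrow> e \<le> norm (w - z)" by (auto simp: not_less)
  moreover have "convex hull (x ` {N..}) \<noteq> {}" by simp
  ultimately obtain f :: "'v \<Rightarrow>\<^sub>L real" where "norm f \<le> 1" and f: "\<And>z. z \<in> convex hull (x ` {N..}) \<Longrightarrow> f z \<le> f w - e"
    using mazur_separation[OF convex_convex_hull[of "x ` {N..}"], of e w] by metis
  have "e - f w \<le> (- f) w"
  proof (rule w)
    have "e - f w \<le> (- f) (x n)" if "N \<le> n" for n
      using f[of "x n"] that by (simp add: hull_inc blinfun.minus_left)
    then show "\<forall>\<^sub>F n in sequentially. e - f w \<le> (- f) (x n)" by (auto simp: eventually_sequentially)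
  qed
  with e show False by (simp add: blinfun.minus_left)
qed

text \<open>The cluster functional is formed on the dual, for the evaluations at \<open>x n\<close>;
  reflexivity represents it by a vector.\<close>

lemma reflexive_cluster:
  fixes x :: "nat \<Rightarrow> 'v::real_normed_vector"
  assumes r: "reflexive TYPE('v)" and bd: "\<And>n. norm (x n) \<le> C"
  obtains w where "\<And>f s::real. \<forall>\<^sub>F n in sequentially. s \<le> blinfun_apply f (x n) \<Longrightarrow> s \<le> f w"
proof -
  obtain \<Phi> :: "('v \<Rightarrow>\<^sub>L real) \<Rightarrow>\<^sub>L real"
    where \<Phi>: "\<And>f s. \<forall>\<^sub>F n in sequentially. s \<le> eval_at (x n) f \<Longrightarrow> s \<le> \<Phi> f"
    by (rule cluster_functional[of "\<lambda>n. eval_at (x n)" C]) (use bd in auto)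
  obtain w where w: "\<And>f. \<Phi> f = blinfun_apply f w" using r unfolding reflexive_def by blast
  show thesis by (rule that[of w]) (use \<Phi> w in simp)
qed

lemma convex_disjoint_cone:
  fixes v :: "'a::banach_lattice"
  assumes v: "0 \<le> v"
  shows "convex {z. 0 \<le> z \<and> inf z v = 0}"
proof (rule convexI)
  fix x y and a b :: real
  assume x: "x \<in> {z. 0 \<le> z \<and> inf z v = 0}" and y: "y \<in> {z. 0 \<le> z \<and> inf z v = 0}" and ab: "0 \<le> a" "0 \<le> b"
  have nn: "0 \<le> a *\<^sub>R x" "0 \<le> b *\<^sub>R y" using x y ab by (auto intro: scaleR_nonneg_nonneg)
  have "inf (a *\<^sub>R x) (1 *\<^sub>R v) = 0" "inf (b *\<^sub>R y) (1 *\<^sub>R v) = 0"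
    using x y ab v by (intro disjoint_scaleR; simp)+
  then have "inf (a *\<^sub>R x + b *\<^sub>R y) v \<le> 0" using inf_add_le[OF nn v] by simp
  moreover have "0 \<le> inf (a *\<^sub>R x + b *\<^sub>R y) v" using nn v by simp
  ultimately show "a *\<^sub>R x + b *\<^sub>R y \<in> {z. 0 \<le> z \<and> inf z v = 0}" using nn by (auto intro: antisym)
qed

lemma limit_in_disjoint_cone:
  fixes v :: "'a::banach_lattice"
  assumes near: "\<And>e. 0 < e \<Longrightarrow> \<exists>z\<in>Z. norm (w - z) < e" and Z: "Z \<subseteq> {z. 0 \<le> z \<and> inf z v = 0}"
  shows "0 \<le> w" "inf w v = 0"
proof -
  have "\<exists>z\<in>Z. norm (w - z) < 1 / real (Suc n)" for n by (rule near) simp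
  then obtain z where z: "\<And>n. z n \<in> Z" "\<And>n. norm (w - z n) < 1 / real (Suc n)" by metis
  have "(\<lambda>n. z n - w) \<longlonglongrightarrow> 0"
  proof (rule Lim_null_comparison)
    show "\<forall>\<^sub>F n in sequentially. norm (z n - w) \<le> 1 / real (Suc n)"
      using z(2) by (auto simp: norm_minus_commute intro!: always_eventually less_imp_le)
    show "(\<lambda>n. 1 / real (Suc n)) \<longlonglongrightarrow> 0" by (rule LIMSEQ_Suc[OF lim_1_over_n])
  qed
  then have lim: "z \<longlonglongrightarrow> w" by (rule LIM_zero_cancel)
  show "0 \<le> w" by (rule limit_ge_const[OF lim]) (use z Z in auto)
  have "(\<lambda>n. inf (z n) v) \<longlonglongrightarrow> inf w v" by (rule tendsto_inf_const[OF lim])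
  moreover have "inf (z n) v = 0" for n using z Z by auto
  ultimately show "inf w v = 0" by (simp add: LIMSEQ_const_iff)
qed

text \<open>A cluster point \<open>w\<close> lies in the closed convex hull of each tail, hence is
  disjoint from every \<open>y k\<close>. It also lies in the closed hull of all \<open>y k\<close>,
  hence is disjoint from itself.\<close>

lemma reflexive_disjoint_null:
  fixes v :: "nat \<Rightarrow> 'a::banach_lattice"
  assumes r: "reflexive TYPE('a)" and f: "posf f"
    and v: "\<And>n. 0 \<le> v n" "\<And>n. norm (v n) \<le> C" "\<And>n m. n \<noteq> m \<Longrightarrow> inf (v n) (v m) = 0"
  shows "(\<lambda>n. blinfun_apply f (v n)) \<longlonglongrightarrow> 0"
proof (rule tendsto_zero_subseqI)
  fix s :: "nat \<Rightarrow> nat" and e :: real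
  assume s: "strict_mono s" and e: "0 < e" and big: "\<And>k. e \<le> \<bar>f (v (s k))\<bar>"
  define y where "y k = v (s k)" for k
  have y: "0 \<le> y k" "norm (y k) \<le> C" for k using v by (auto simp: y_def)
  have ydisj: "inf (y n) (y m) = 0" if "n \<noteq> m" for n m
    unfolding y_def by (rule v(3)) (use that strict_mono_eq[OF s] in simp)
  obtain w where w: "\<And>f s::real. \<forall>\<^sub>F n in sequentially. s \<le> blinfun_apply f (y n) \<Longrightarrow> s \<le> f w"
    by (rule reflexive_cluster[of y C, OF r y(2)]) blast
  have near: "\<exists>z\<in>convex hull (y ` {N..}). norm (w - z) < \<eta>" if "0 < \<eta>" for \<eta> N
    by (rule cluster_near_hull[OF w that])
  have wy: "0 \<le> w \<and> inf w (y k) = 0" for k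
  proof -
    have "convex hull (y ` {Suc k..}) \<subseteq> {z. 0 \<le> z \<and> inf z (y k) = 0}"
      by (intro hull_minimal convex_disjoint_cone y) (use y ydisj in auto)
    from limit_in_disjoint_cone[OF near this] show ?thesis by simp
  qed
  then have w0: "0 \<le> w" by blast
  have "convex hull (y ` {0..}) \<subseteq> {z. 0 \<le> z \<and> inf z w = 0}"
    by (intro hull_minimal convex_disjoint_cone w0) (use y wy in \<open>auto simp: inf_commute\<close>)
  from limit_in_disjoint_cone(2)[OF near this] have "inf w w = 0" by simp
  then have "w = 0" by simp
  moreover have "e \<le> f w"
  proof (rule w)
    have "e \<le> f (y k)" for k using big[of k] posfD[OF f y(1), of k] by (simp add: y_def)
    then show "\<forall>\<^sub>F n in sequentially. e \<le> f (y n)" by simp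
  qed
  ultimately show False using e by simp
qed

text \<open>Split \<open>labs (x n)\<close> at \<open>u\<close>: the part below is weakly null by
  assumption, the part above is uniformly small under \<open>h\<close> by almost order
  boundedness.\<close>

lemma reflexive_uaw_null_weakly_null:
  fixes x :: "nat \<Rightarrow> 'a::banach_lattice"
  assumes r: "reflexive TYPE('a)" and x: "uaw_null x" and bd: "\<And>n. norm (x n) \<le> C"
  shows "weakly_null (\<lambda>n. labs (x n))"
  unfolding weakly_null_def
proof
  fix g :: "'a \<Rightarrow>\<^sub>L real"
  obtain h where h: "posf h" "\<And>x. \<bar>g x\<bar> \<le> h (labs x)" using modulus_functional[of g] by metis
  have h0: "0 \<le> h (labs (x n))" for n by (rule posfD[OF h(1)]) simp
  have "(\<lambda>n. h (labs (x n))) \<longlonglongrightarrow> 0"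
  proof (rule LIMSEQ_I)
    fix e :: real assume e: "0 < e"
    have "\<exists>u\<ge>0. \<forall>x. norm x \<le> C \<longrightarrow> h (pprt (labs x - u)) \<le> e / 2"
    proof (rule almost_order_bounded[OF h(1)])
      show "(\<lambda>n. h (v n)) \<longlonglongrightarrow> 0" if "\<And>n. 0 \<le> v n" "\<And>n. norm (v n) \<le> C"
        "\<And>n m. n \<noteq> m \<Longrightarrow> inf (v n) (v m) = 0" for v C
        by (rule reflexive_disjoint_null[OF r h(1) that])
    qed (use e in simp)
    then obtain u where u: "0 \<le> u" "\<And>x. norm x \<le> C \<Longrightarrow> h (pprt (labs x - u)) \<le> e / 2" by blast
    have "(\<lambda>n. h (inf (labs (x n)) u)) \<longlonglongrightarrow> 0" using x u(1) unfolding uaw_null_def by (auto intro: weakly_nullD)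
    then obtain N where N: "\<And>n. N \<le> n \<Longrightarrow> \<bar>h (inf (labs (x n)) u)\<bar> < e / 2"
      using LIMSEQ_D[of _ 0 "e / 2"] e by fastforce
    have "h (labs (x n)) < e" if "N \<le> n" for n
    proof -
      have "labs (x n) = inf (labs (x n)) u + pprt (labs (x n) - u)"
        using diff_inf_eq_pprt[of "labs (x n)" u] by (metis add.commute diff_add_cancel)
      then have "h (labs (x n)) = h (inf (labs (x n)) u) + h (pprt (labs (x n) - u))"
        by (metis blinfun.add_right)
      then show ?thesis using N[OF that] u(2)[OF bd[of n]] by linarith
    qed
    then show "\<exists>N. \<forall>n\<ge>N. norm (h (labs (x n)) - 0) < e" using h0 by auto
  qed
  moreover have "\<bar>g (labs (x n))\<bar> \<le> h (labs (x n))" for n using h(2)[of "labs (x n)"] by simp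
  then have "\<forall>\<^sub>F n in sequentially. norm (g (labs (x n))) \<le> h (labs (x n))" by simp
  ultimately show "(\<lambda>n. g (labs (x n))) \<longlonglongrightarrow> 0" by (rule Lim_null_comparison[rotated])
qed

lemma diagonal_convergence:
  fixes a :: "nat \<Rightarrow> nat \<Rightarrow> real"
  assumes bd: "\<And>i. bounded (range (a i))"
  obtains s :: "nat \<Rightarrow> nat" where "strict_mono s" "\<And>i. convergent (\<lambda>k. a i (s k))"
proof -
  interpret subseqs "\<lambda>i s. convergent (\<lambda>k. a i (s k))"
  proof
    fix n and s :: "nat \<Rightarrow> nat" assume "strict_mono s"
    have "bounded (range (\<lambda>k. a n (s k)))" using bd[of n] by (rule bounded_subset) auto
    then obtain l r where "strict_mono r" "((\<lambda>k. a n (s k)) \<circ> r) \<longlonglongrightarrow> l"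
      using bounded_imp_convergent_subsequence by blast
    then show "\<exists>r. strict_mono r \<and> convergent (\<lambda>k. a n ((s \<circ> r) k))" by (auto simp: convergent_def o_def)
  qed
  have "convergent (\<lambda>k. a i ((diagseq \<circ> (+) (Suc i)) k))" for i
  proof (rule diagseq_holds)
    fix n and s r :: "nat \<Rightarrow> nat" assume "convergent (\<lambda>k. a n (s k))" "strict_mono r"
    then show "convergent (\<lambda>k. a n ((s \<circ> r) k))"
      using LIMSEQ_subseq_LIMSEQ by (fastforce simp: convergent_def o_def)
  qed
  then have "convergent (\<lambda>k. a i (diagseq (k + Suc i)))" for i
    by (simp only: o_apply add.commute[of _ "Suc i"])
  then have "convergent (\<lambda>k. a i (diagseq k))" for i
    using convergent_ignore_initial_segment[of "\<lambda>k. a i (diagseq k)" "Suc i"] by blast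
  with subseq_diagseq that show thesis by blast
qed

text \<open>Stage \<open>n\<close> of the recursion holds the rational combinations with
  \<open>n\<close> terms.\<close>

lemma countable_dense_in_span:
  fixes f :: "nat \<Rightarrow> 'v::real_normed_vector"
  obtains Q where "countable Q" "Q \<noteq> {}" "\<And>g e. g \<in> span (range f) \<Longrightarrow> 0 < e \<Longrightarrow> \<exists>h\<in>Q. norm (g - h) < e"
proof -
  define Q where "Q = rec_nat {0} (\<lambda>_ S. (\<lambda>(h, q, i). h + of_rat q *\<^sub>R f i) ` (S \<times> UNIV \<times> UNIV))"
  have Q0: "Q 0 = {0}" and QS: "Q (Suc n) = (\<lambda>(h, q, i). h + of_rat q *\<^sub>R f i) ` (Q n \<times> UNIV \<times> UNIV)" for n
    by (simp_all add: Q_def)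
  have c: "countable (Q n)" for n by (induction n) (simp_all add: Q0 QS)
  have dense: "\<forall>e>0. \<exists>n. \<exists>h\<in>Q n. norm (g - h) < e" if "g \<in> span (range f)" for g
    using that
  proof (induction rule: span_induct_alt)
    case base
    show ?case by (intro allI impI exI[of _ 0]) (simp add: Q0)
  next
    case (step c x y)
    show ?case
    proof (intro allI impI)
      fix e :: real assume e: "0 < e"
      obtain i where i: "x = f i" using step by blast
      obtain n h where h: "h \<in> Q n" "norm (y - h) < e / 2" using step(2) e by (meson half_gt_zero)
      define \<eta> where "\<eta> = e / (2 * (norm x + 1))"
      have nx: "0 < norm x + 1" using norm_ge_zero[of x] by linarith
      have \<eta>: "0 < \<eta>" using e nx by (simp add: \<eta>_def)
      obtain q where q: "c < of_rat q" "of_rat q < c + \<eta>" using of_rat_dense[of c "c + \<eta>"] \<eta> by auto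
      have "\<bar>c - of_rat q\<bar> * norm x \<le> \<eta> * (norm x + 1)" using q by (intro mult_mono) auto
      also have "\<dots> = e / 2" using nx by (simp add: \<eta>_def field_simps)
      finally have "norm ((c - of_rat q) *\<^sub>R x) \<le> e / 2" by simp
      have "c *\<^sub>R x + y - (h + of_rat q *\<^sub>R x) = (c - of_rat q) *\<^sub>R x + (y - h)" by (simp add: scaleR_diff_left)
      then have "norm (c *\<^sub>R x + y - (h + of_rat q *\<^sub>R x)) \<le> norm ((c - of_rat q) *\<^sub>R x) + norm (y - h)"
        by (metis norm_triangle_ineq)
      also have "\<dots> < e" using h(2) \<open>norm ((c - of_rat q) *\<^sub>R x) \<le> e / 2\<close> by linarith
      finally have "norm (c *\<^sub>R x + y - (h + of_rat q *\<^sub>R x)) < e" .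
      moreover have "h + of_rat q *\<^sub>R x \<in> Q (Suc n)" unfolding QS i using h(1) by (intro image_eqI[of _ _ "(h, q, i)"]) auto
      ultimately show "\<exists>n. \<exists>h\<in>Q n. norm (c *\<^sub>R x + y - h) < e" by blast
    qed
  qed
  show thesis
  proof (rule that[of "\<Union>n. Q n"])
    show "countable (\<Union>n. Q n)" using c by simp
    show "(\<Union>n. Q n) \<noteq> {}" using Q0 by blast
    show "\<exists>h\<in>\<Union>n. Q n. norm (g - h) < e" if "g \<in> span (range f)" "0 < e" for g e using dense that by blast
  qed
qed

text \<open>The span of the \<open>f n\<close> has a countable dense set \<open>Q\<close>, and the
  points \<open>d i\<close> norm the elements of \<open>Q\<close> up to a factor 2. After a diagonal
  choice any two cluster functionals of subsequences agree at all \<open>d i\<close>. By reflexivity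
  they lie in the closed span, so they coincide, and uniqueness of the cluster functional gives
  convergence.\<close>

lemma reflexive_dual_subseq:
  fixes f :: "nat \<Rightarrow> 'v::real_normed_vector \<Rightarrow>\<^sub>L real"
  assumes r: "reflexive TYPE('v)" and bd: "\<And>n. norm (f n) \<le> C"
  obtains s g where "strict_mono (s :: nat \<Rightarrow> nat)" "weakly_null (\<lambda>k. f (s k) - g)"
proof -
  have refl: "\<exists>x. \<forall>f. \<Phi> f = blinfun_apply f x" for \<Phi> :: "('v \<Rightarrow>\<^sub>L real) \<Rightarrow>\<^sub>L real"
    using r unfolding reflexive_def by blast
  obtain Q where Q: "countable Q" "Q \<noteq> {}"
    and Qd: "\<And>g e. g \<in> span (range f) \<Longrightarrow> 0 < e \<Longrightarrow> \<exists>h\<in>Q. norm (g - h) < e"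
    by (rule countable_dense_in_span[of f]) blast
  have "\<exists>y. norm y \<le> 1 \<and> norm h \<le> 2 * \<bar>blinfun_apply h y\<bar>" for h :: "'v \<Rightarrow>\<^sub>L real"
  proof (cases "h = 0")
    case False
    then have n: "0 < norm h" by simp
    have "\<exists>x. norm h / 2 * norm x < \<bar>h x\<bar>"
    proof (rule ccontr)
      assume "\<not> ?thesis"
      then have "norm (h x) \<le> norm h / 2 * norm x" for x by (simp add: not_less)
      then have "norm h \<le> norm h / 2" by (intro norm_blinfun_bound) auto
      with n show False by simp
    qed
    then obtain x where x: "norm h / 2 * norm x < \<bar>h x\<bar>" by blast
    then have x0: "0 < norm x" by auto
    have "norm h \<le> 2 * \<bar>h ((1 / norm x) *\<^sub>R x)\<bar>" using x x0 by (simp add: blinfun.scaleR_right field_simps)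
    then show ?thesis using x0 by (intro exI[of _ "(1 / norm x) *\<^sub>R x"]) simp
  qed (auto intro: exI[of _ 0])
  then have "\<forall>h::'v \<Rightarrow>\<^sub>L real. \<exists>y. norm y \<le> 1 \<and> norm h \<le> 2 * \<bar>blinfun_apply h y\<bar>" by blast
  from choice[OF this] obtain Y :: "('v \<Rightarrow>\<^sub>L real) \<Rightarrow> 'v"
    where Y: "\<And>h. norm (Y h) \<le> 1" "\<And>h. norm h \<le> 2 * \<bar>blinfun_apply h (Y h)\<bar>" by blast
  define d where "d i = Y (from_nat_into Q i)" for i
  obtain s where s: "strict_mono s" and conv: "\<And>i. convergent (\<lambda>k. f (s k) (d i))"
  proof (rule diagonal_convergence[of "\<lambda>i k. f k (d i)"])
    have "\<bar>f k (d i)\<bar> \<le> C * norm (d i)" for k i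
      using norm_blinfun[of "f k" "d i"] mult_right_mono[OF bd[of k] norm_ge_zero[of "d i"]] by simp
    then show "bounded (range (\<lambda>k. f k (d i)))" for i by (auto simp: bounded_iff)
  qed blast
  obtain g where g: "\<And>x t. \<forall>\<^sub>F n in sequentially. t \<le> f (s n) x \<Longrightarrow> t \<le> blinfun_apply g x"
    by (rule cluster_functional[of "\<lambda>n. f (s n)" C, OF bd]) blast
  \<comment> \<open>Functionals on the dual are evaluations, so \<open>g'\<close> satisfies the
    cluster condition against all of them and lies in the norm closure of the convex hull.\<close>
  have span_near: "\<exists>z\<in>span (range f). norm (g' - z) < e"
    if g': "\<And>x t. \<forall>\<^sub>F n in sequentially. t \<le> f (q n) x \<Longrightarrow> t \<le> blinfun_apply g' x" and e: "0 < e" for q g' e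
  proof -
    have "\<exists>z\<in>convex hull ((\<lambda>n. f (q n)) ` {0..}). norm (g' - z) < e"
    proof (rule cluster_near_hull[OF _ e])
      fix \<Phi> :: "('v \<Rightarrow>\<^sub>L real) \<Rightarrow>\<^sub>L real" and t
      assume *: "\<forall>\<^sub>F n in sequentially. t \<le> \<Phi> (f (q n))"
      obtain x where x: "\<And>f. \<Phi> f = blinfun_apply f x" using refl by blast
      show "t \<le> \<Phi> g'" using g'[of t x] * by (simp add: x)
    qed
    moreover have "convex hull ((\<lambda>n. f (q n)) ` {0..}) \<subseteq> span (range f)"
      by (intro hull_minimal subspace_imp_convex subspace_span) (auto intro: span_base)
    ultimately show ?thesis by blast
  qed
  have no: False if q: "strict_mono (q :: nat \<Rightarrow> nat)" and e: "0 < e" and big: "\<And>k. g x + e \<le> f (s (q k)) x" for q x e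
  proof -
    obtain g' where g': "\<And>x t. \<forall>\<^sub>F n in sequentially. t \<le> f (s (q n)) x \<Longrightarrow> t \<le> blinfun_apply g' x"
      by (rule cluster_functional[of "\<lambda>n. f (s (q n))" C, OF bd]) blast
    have eqd: "g' (d i) = g (d i)" for i
    proof -
      obtain l where l: "(\<lambda>k. f (s k) (d i)) \<longlonglongrightarrow> l" using conv convergent_def by blast
      have "g (d i) = l" by (rule cluster_limit[OF g l])
      have lq: "(\<lambda>k. f (s (q k)) (d i)) \<longlonglongrightarrow> l"
        using LIMSEQ_subseq_LIMSEQ[OF l q] by (simp add: o_def)
      have "g' (d i) = l" by (rule cluster_limit[OF g' lq])
      with \<open>g (d i) = l\<close> show ?thesis by simp
    qed
    have "norm (g' - g) \<le> \<eta>" if \<eta>: "0 < \<eta>" for \<eta>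
    proof -
      \<comment> \<open>Three errors \<open>\<eta> / 9\<close> bring \<open>h\<close> within
        \<open>\<eta> / 3\<close> of \<open>g' - g\<close>. As the latter vanishes at
        \<open>Y h\<close>, this bounds \<open>norm h\<close> by \<open>2 * (\<eta> / 3)\<close>,
        and both estimates add up to \<open>\<eta>\<close>.\<close>
      have \<eta>9: "0 < \<eta> / 9" using \<eta> by simp
      obtain z1 where z1: "z1 \<in> span (range f)" "norm (g - z1) < \<eta> / 9" using span_near[of s g, OF g \<eta>9] by blast
      obtain z2 where z2: "z2 \<in> span (range f)" "norm (g' - z2) < \<eta> / 9"
        using span_near[of "\<lambda>n. s (q n)" g', OF g' \<eta>9] by blast
      obtain h where h: "h \<in> Q" "norm (z2 - z1 - h) < \<eta> / 9" using Qd[OF span_diff[OF z2(1) z1(1)] \<eta>9] by blast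
      have "g' - g - h = (g' - z2) - (g - z1) + (z2 - z1 - h)" by simp
      also have "norm \<dots> \<le> norm (g' - z2) + norm (g - z1) + norm (z2 - z1 - h)"
        by (intro norm_triangle_le add_right_mono norm_triangle_ineq4)
      finally have near: "norm (g' - g - h) \<le> \<eta> / 3" using z1 z2 h by simp
      obtain i where i: "h = from_nat_into Q i" using from_nat_into_surj[OF Q(1) h(1)] by metis
      have "\<bar>h (Y h)\<bar> = \<bar>(g' - g - h) (Y h)\<bar>" using eqd[of i] by (simp add: i d_def blinfun.diff_left)
      also have "\<dots> \<le> norm (g' - g - h) * norm (Y h)" using norm_blinfun[of "g' - g - h"] by simp
      also have "\<dots> \<le> norm (g' - g - h)" using Y(1)[of h] by (simp add: mult_left_le)
      finally have "norm h \<le> 2 * (\<eta> / 3)" using Y(2)[of h] near by linarith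
      moreover have "norm (g' - g) \<le> norm (g' - g - h) + norm h" using norm_triangle_ineq[of "g' - g - h" h] by simp
      ultimately show ?thesis using near by simp
    qed
    then have "norm (g' - g) \<le> 0" using field_le_epsilon[of "norm (g' - g)" 0] by simp
    then have "g' = g" by simp
    moreover have "g x + e \<le> g' x" by (rule g') (use big in simp)
    ultimately show False using e by simp
  qed
  have lim: "(\<lambda>k. f (s k) x - g x) \<longlonglongrightarrow> 0" for x
  proof (rule tendsto_zero_subseqI)
    fix q :: "nat \<Rightarrow> nat" and e :: real
    assume q: "strict_mono q" and e: "0 < e" and big: "\<And>k. e \<le> \<bar>f (s (q k)) x - g x\<bar>"
    define A where "A = {k. g x + e \<le> f (s (q k)) x}"
    define B where "B = {k. g (- x) + e \<le> f (s (q k)) (- x)}"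
    have "k \<in> A \<union> B" for k using big[of k] by (auto simp: A_def B_def blinfun.minus_right abs_if split: if_splits)
    then have "A \<union> B = UNIV" by blast
    then have "infinite A \<or> infinite B" by (metis finite_Un infinite_UNIV_nat)
    then show False
    proof
      assume "infinite A"
      then obtain t :: "nat \<Rightarrow> nat" where t: "strict_mono t" "\<And>n. t n \<in> A" using infinite_enumerate by metis
      show False using no[of "\<lambda>n. q (t n)" e x] strict_mono_o[OF q t(1)] t(2) e by (simp add: o_def A_def)
    next
      assume "infinite B"
      then obtain t :: "nat \<Rightarrow> nat" where t: "strict_mono t" "\<And>n. t n \<in> B" using infinite_enumerate by metis
      show False using no[of "\<lambda>n. q (t n)" e "- x"] strict_mono_o[OF q t(1)] t(2) e by (simp add: o_def B_def)
    qed
  qed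
  have "weakly_null (\<lambda>k. f (s k) - g)"
    unfolding weakly_null_def
  proof
    fix \<Phi> :: "('v \<Rightarrow>\<^sub>L real) \<Rightarrow>\<^sub>L real"
    obtain x where x: "\<And>f. \<Phi> f = blinfun_apply f x" using refl by blast
    show "(\<lambda>k. \<Phi> (f (s k) - g)) \<longlonglongrightarrow> 0" using lim[of x] by (simp add: x blinfun.diff_left)
  qed
  with s show thesis by (rule that)
qed

text \<open>Positivity allows \<open>x n\<close> to be replaced by its modulus. The norming
  functionals of the images need not tend weakly to 0, so the weak limit \<open>g\<close> of a
  subsequence is subtracted: the weak Dunford-Pettis property handles the difference, weak nullity
  of the moduli the remaining term \<open>g o\<^sub>L T\<close>.\<close>

theorem reflexive_imp_uaw_DP:
  fixes T :: "'a::banach_lattice \<Rightarrow>\<^sub>L 'a"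
  assumes r: "reflexive TYPE('a)" and pos: "positive_op T" and dp: "weak_DP T"
  shows "uaw_DP T"
  unfolding uaw_DP_def
proof (intro allI impI)
  fix x :: "nat \<Rightarrow> 'a" assume x: "bounded (range x) \<and> uaw_null x"
  then obtain C where C: "\<And>n. norm (x n) \<le> C" by (auto simp: bounded_iff)
  have wk: "weakly_null (\<lambda>n. labs (x n))" by (rule reflexive_uaw_null_weakly_null[OF r _ C]) (use x in simp)
  have mono: "T a \<le> T b" if "a \<le> b" for a b
    using pos that unfolding positive_op_def by (metis blinfun.diff_right diff_ge_0_iff_ge)
  have dom: "norm (T (x n)) \<le> norm (T (labs (x n)))" for n
  proof (rule norm_le_of_labs_le, rule labs_leI)
    show "T (x n) \<le> T (labs (x n))" by (rule mono[OF le_labs])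
    show "- T (x n) \<le> T (labs (x n))" using mono[OF neg_le_labs, of "x n"] by (simp add: blinfun.minus_right)
  qed
  show "(\<lambda>n. norm (T (x n))) \<longlonglongrightarrow> 0"
  proof (rule tendsto_zero_subseqI)
    fix s :: "nat \<Rightarrow> nat" and e :: real
    assume s: "strict_mono s" and e: "0 < e" and big: "\<And>k. e \<le> \<bar>norm (T (x (s k)))\<bar>"
    define y where "y k = labs (x (s k))" for k
    have y: "weakly_null y" unfolding y_def by (rule weakly_null_subseq[OF wk s])
    have "\<exists>f. norm f \<le> 1 \<and> blinfun_apply f (T (y k)) = norm (T (y k))" for k using norming_functional by metis
    then obtain f :: "nat \<Rightarrow> 'a \<Rightarrow>\<^sub>L real" where f: "\<And>k. norm (f k) \<le> 1" "\<And>k. blinfun_apply (f k) (T (y k)) = norm (T (y k))" by metis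
    obtain q g where q: "strict_mono (q :: nat \<Rightarrow> nat)" and g: "weakly_null (\<lambda>k. f (q k) - g)"
      by (rule reflexive_dual_subseq[OF r f(1)])
    have yq: "weakly_null (\<lambda>k. y (q k))" by (rule weakly_null_subseq[OF y q])
    have "(\<lambda>k. (f (q k) - g) (T (y (q k)))) \<longlonglongrightarrow> 0" using dp yq g unfolding weak_DP_def by blast
    moreover have "(\<lambda>k. (g o\<^sub>L T) (y (q k))) \<longlonglongrightarrow> 0" by (rule weakly_nullD[OF yq])
    ultimately have "(\<lambda>k. (f (q k) - g) (T (y (q k))) + (g o\<^sub>L T) (y (q k))) \<longlonglongrightarrow> 0 + 0" by (rule tendsto_add)
    then have lim: "(\<lambda>k. norm (T (y (q k)))) \<longlonglongrightarrow> 0" by (simp add: blinfun.diff_left f(2))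
    have "e \<le> norm (T (y k))" for k using big[of k] dom[of "s k"] by (simp add: y_def)
    then have "e \<le> 0" by (intro LIMSEQ_le_const[OF lim]) blast
    with e show False by simp
  qed
qed

section \<open>Sequences in nonreflexive spaces\<close>

text \<open>Induction on \<open>A\<close>. If some \<open>g0\<close> is annihilated by
  \<open>A\<close> but not by \<open>\<Lambda> y\<close>, a multiple of \<open>\<Lambda> y\<close>
  is subtracted from \<open>l\<close> so as to vanish at \<open>g0\<close>; if there is none,
  vanishing on \<open>A\<close> already implies vanishing of \<open>\<Lambda> y\<close>.\<close>

lemma functional_in_span:
  fixes l :: "'w::real_normed_vector \<Rightarrow>\<^sub>L real" and \<Lambda> :: "'b \<Rightarrow> 'w \<Rightarrow>\<^sub>L real"
  assumes "finite A" "\<And>g. (\<And>x. x \<in> A \<Longrightarrow> \<Lambda> x g = 0) \<Longrightarrow> l g = 0"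
  shows "\<exists>a. l = (\<Sum>x\<in>A. a x *\<^sub>R \<Lambda> x)"
  using assms
proof (induction A arbitrary: l rule: finite_induct)
  case empty
  then have "l = 0" by (intro blinfun_eqI) simp
  then show ?case by simp
next
  case (insert y A)
  have "\<exists>c a. l - c *\<^sub>R \<Lambda> y = (\<Sum>x\<in>A. a x *\<^sub>R \<Lambda> x)"
  proof (cases "\<exists>g0. (\<forall>x\<in>A. \<Lambda> x g0 = 0) \<and> \<Lambda> y g0 \<noteq> 0")
    case True
    then obtain g0 where g0: "\<And>x. x \<in> A \<Longrightarrow> \<Lambda> x g0 = 0" "\<Lambda> y g0 \<noteq> 0" by blast
    define c where "c = l g0 / \<Lambda> y g0"
    have "\<exists>a. l - c *\<^sub>R \<Lambda> y = (\<Sum>x\<in>A. a x *\<^sub>R \<Lambda> x)"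
    proof (rule insert.IH)
      fix g assume g: "\<And>x. x \<in> A \<Longrightarrow> \<Lambda> x g = 0"
      define t where "t = \<Lambda> y g / \<Lambda> y g0"
      have "l (g - t *\<^sub>R g0) = 0"
      proof (rule insert.prems)
        fix x assume "x \<in> insert y A"
        then show "\<Lambda> x (g - t *\<^sub>R g0) = 0" using g g0
          by (auto simp: blinfun.diff_right blinfun.scaleR_right t_def)
      qed
      then show "(l - c *\<^sub>R \<Lambda> y) g = 0"
        using g0(2) by (simp add: blinfun.diff_right blinfun.scaleR_right blinfun.diff_left blinfun.scaleR_left c_def t_def field_simps)
    qed
    then show ?thesis by blast
  next
    case False
    have "\<exists>a. l = (\<Sum>x\<in>A. a x *\<^sub>R \<Lambda> x)"
    proof (rule insert.IH)
      fix g assume g: "\<And>x. x \<in> A \<Longrightarrow> \<Lambda> x g = 0"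
      then have "\<Lambda> y g = 0" using False by blast
      with g show "l g = 0" by (intro insert.prems) auto
    qed
    then show ?thesis by (intro exI[of _ 0]) simp
  qed
  then obtain c a where ca: "l - c *\<^sub>R \<Lambda> y = (\<Sum>x\<in>A. a x *\<^sub>R \<Lambda> x)" by blast
  have "(\<Sum>x\<in>insert y A. (a(y := c)) x *\<^sub>R \<Lambda> x) = c *\<^sub>R \<Lambda> y + (\<Sum>x\<in>A. a x *\<^sub>R \<Lambda> x)"
    using insert.hyps by (simp add: sum.insert) (intro sum.cong, auto)
  also have "\<dots> = l" by (simp add: ca[symmetric])
  finally show ?case by (metis (no_types))
qed

section \<open>A minimax theorem and Helly's theorem\<close>

text \<open>The pairs \<open>(g x - \<theta>, h x - \<theta>)\<close> form a convex set in the
  plane. If it missed the open quadrant, a separating line would have nonnegative coefficients, and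
  their normalisation would contradict \<open>comb\<close>.\<close>

lemma two_functional_minimax:
  fixes g h :: "'v::real_normed_vector \<Rightarrow>\<^sub>L real"
  assumes B: "convex B" and comb: "\<And>a b. 0 \<le> a \<Longrightarrow> 0 \<le> b \<Longrightarrow> a + b = 1 \<Longrightarrow> \<exists>x\<in>B. \<theta> < a * g x + b * h x"
  shows "\<exists>x\<in>B. \<theta> < g x \<and> \<theta> < h x"
proof (rule ccontr)
  assume no: "\<not> ?thesis"
  define S where "S = (\<lambda>x. (g x - \<theta>, h x - \<theta>)) ` B"
  define Q :: "(real \<times> real) set" where "Q = {0<..} \<times> {0<..}"
  have "convex S"
  proof (rule convexI)
    fix p q :: "real \<times> real" and u v :: real
    assume "p \<in> S" "q \<in> S" and uv: "0 \<le> u" "0 \<le> v" "u + v = 1"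
    then obtain x y where xy: "x \<in> B" "y \<in> B" "p = (g x - \<theta>, h x - \<theta>)" "q = (g y - \<theta>, h y - \<theta>)"
      by (auto simp: S_def)
    have v: "v = 1 - u" using uv by simp
    have "u *\<^sub>R p + v *\<^sub>R q = (g (u *\<^sub>R x + v *\<^sub>R y) - \<theta>, h (u *\<^sub>R x + v *\<^sub>R y) - \<theta>)"
      unfolding v using xy by (simp add: blinfun.add_right blinfun.diff_right blinfun.scaleR_right algebra_simps)
    moreover have "u *\<^sub>R x + v *\<^sub>R y \<in> B" using convexD[OF B] xy uv by blast
    ultimately show "u *\<^sub>R p + v *\<^sub>R q \<in> S" by (auto simp: S_def)
  qed
  moreover have "convex Q" unfolding Q_def by (intro convex_Times convex_real_interval)
  moreover have "S \<noteq> {}" using comb[of 1 0] by (auto simp: S_def)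
  moreover have "Q \<noteq> {}" by (auto simp: Q_def)
  moreover have "S \<inter> Q = {}" using no by (auto simp: S_def Q_def)
  ultimately obtain a b where ab: "a \<noteq> 0" "\<And>p. p \<in> S \<Longrightarrow> a \<bullet> p \<le> b" "\<And>p. p \<in> Q \<Longrightarrow> b \<le> a \<bullet> p"
    using separating_hyperplane_sets[of S Q] by blast
  obtain a1 a2 where a: "a = (a1, a2)" by (cases a) auto
  have Qle: "b \<le> a1 * s + a2 * t" if "0 < s" "0 < t" for s t using ab(3)[of "(s, t)"] that by (simp add: Q_def a)
  have lim: "b \<le> a1 * s + a2 * t" if st: "0 \<le> s" "0 \<le> t" for s t
  proof (rule LIMSEQ_le_const)
    have "(\<lambda>n. a1 * (s + 1 / real (Suc n)) + a2 * (t + 1 / real (Suc n))) \<longlonglongrightarrow> a1 * (s + 0) + a2 * (t + 0)"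
      by (intro tendsto_intros LIMSEQ_Suc[OF lim_1_over_n])
    then show "(\<lambda>n. a1 * (s + 1 / real (Suc n)) + a2 * (t + 1 / real (Suc n))) \<longlonglongrightarrow> a1 * s + a2 * t" by simp
    show "\<exists>N. \<forall>n\<ge>N. b \<le> a1 * (s + 1 / real (Suc n)) + a2 * (t + 1 / real (Suc n))"
      using st by (intro exI[of _ 0] allI impI Qle add_nonneg_pos) auto
  qed
  have b0: "b \<le> 0" using lim[of 0 0] by simp
  have nonneg: "0 \<le> c" if c: "\<And>s. 0 \<le> s \<Longrightarrow> b \<le> c * s" for c
  proof (rule ccontr)
    assume "\<not> 0 \<le> c"
    \<comment> \<open>At this argument the product is \<open>b - 1\<close>.\<close>
    then have "b \<le> c * ((1 - b) / (- c))" using b0 by (intro c divide_nonneg_nonneg) auto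
    with \<open>\<not> 0 \<le> c\<close> show False by simp
  qed
  have a1: "0 \<le> a1" by (rule nonneg) (use lim[of _ 0] in simp)
  have a2: "0 \<le> a2" by (rule nonneg) (use lim[of 0] in simp)
  have pos: "0 < a1 + a2" using a1 a2 ab(1) a by (auto simp: zero_prod_def add_nonneg_eq_0_iff less_le)
  obtain x where x: "x \<in> B" "\<theta> < a1 / (a1 + a2) * g x + a2 / (a1 + a2) * h x"
    using comb[of "a1 / (a1 + a2)" "a2 / (a1 + a2)"] a1 a2 pos by (auto simp: add_divide_distrib[symmetric])
  have "a1 / (a1 + a2) * g x + a2 / (a1 + a2) * h x = (a1 * g x + a2 * h x) / (a1 + a2)"
    by (simp add: add_divide_distrib)
  with x(2) pos have "\<theta> * (a1 + a2) < a1 * g x + a2 * h x" by (simp add: pos_less_divide_eq)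
  moreover have "a1 * (g x - \<theta>) + a2 * (h x - \<theta>) \<le> b" using ab(2)[of "(g x - \<theta>, h x - \<theta>)"] x(1) by (auto simp: S_def a)
  ultimately show False using b0 by (simp add: algebra_simps)
qed

lemma convex_superlevel:
  fixes f :: "'v::real_normed_vector \<Rightarrow>\<^sub>L real"
  shows "convex {x. \<theta> < f x}"
proof (rule convexI)
  fix x y and u v :: real
  assume "x \<in> {x. \<theta> < f x}" "y \<in> {x. \<theta> < f x}" "0 \<le> u" "0 \<le> v" "u + v = 1"
  then have "u * - f x + v * - f y < - \<theta>" by (intro convex_bound_lt) auto
  then show "u *\<^sub>R x + v *\<^sub>R y \<in> {x. \<theta> < f x}" by (simp add: blinfun.add_right blinfun.scaleR_right)
qed

text \<open>Induction with a shrinking \<open>B\<close>: it is cut down to the superlevel set of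
  \<open>h\<close>, and the case of two functionals shows that the hypothesis on the hull of
  \<open>A\<close> survives the cut.\<close>

lemma finite_minimax:
  fixes A :: "('v::real_normed_vector \<Rightarrow>\<^sub>L real) set"
  assumes "finite A" "convex B" "B \<noteq> {}" "\<And>g. g \<in> convex hull A \<Longrightarrow> \<exists>x\<in>B. \<theta> < g x"
  shows "\<exists>x\<in>B. \<forall>g\<in>A. \<theta> < blinfun_apply g x"
  using assms
proof (induction A arbitrary: B rule: finite_induct)
  case (insert h A)
  define B' where "B' = {x \<in> B. \<theta> < blinfun_apply h x}"
  have "\<exists>x\<in>B'. \<forall>g\<in>A. \<theta> < blinfun_apply g x"
  proof (rule insert.IH)
    have "convex {x. \<theta> < blinfun_apply h x}"
      by (rule convex_superlevel)
    then have "convex (B \<inter> {x. \<theta> < blinfun_apply h x})" using insert.prems by (intro convex_Int)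
    moreover have "B' = B \<inter> {x. \<theta> < blinfun_apply h x}" by (auto simp: B'_def)
    ultimately show "convex B'" by simp
    show "B' \<noteq> {}" using insert.prems(3)[of h] by (auto simp: B'_def hull_inc)
    fix g assume g: "g \<in> convex hull A"
    have gA: "g \<in> convex hull (insert h A)" using g hull_mono[of A "insert h A" convex] by blast
    have "\<exists>x\<in>B. \<theta> < g x \<and> \<theta> < h x"
    proof (rule two_functional_minimax)
      show "convex B" by (rule insert.prems)
      fix a b :: real assume ab: "0 \<le> a" "0 \<le> b" "a + b = 1"
      have "a *\<^sub>R g + b *\<^sub>R h \<in> convex hull (insert h A)"
        by (rule convexD[OF convex_convex_hull gA _ ab]) (simp add: hull_inc)
      from insert.prems(3)[OF this] show "\<exists>x\<in>B. \<theta> < a * g x + b * h x"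
        by (simp add: blinfun.add_left blinfun.scaleR_left)
    qed
    then show "\<exists>x\<in>B'. \<theta> < g x" by (auto simp: B'_def)
  qed
  then show ?case by (auto simp: B'_def)
qed auto

text \<open>By the minimax theorem only a single \<open>g\<close> of the hull has to be considered.
  If \<open>g \<le> \<theta>\<close> on the ball, then
  \<open>norm g * (norm \<Phi> + 1) \<le> \<theta>\<close>, against
  \<open>\<theta> < \<Phi> g\<close>; the summand 1 keeps the radius positive.\<close>

lemma helly:
  fixes \<Phi> :: "('v::real_normed_vector \<Rightarrow>\<^sub>L real) \<Rightarrow>\<^sub>L real"
  assumes A: "finite A" "\<And>g. g \<in> A \<Longrightarrow> \<theta> < \<Phi> g" and \<theta>: "0 < \<theta>"
  shows "\<exists>x. norm x \<le> norm \<Phi> + 1 \<and> (\<forall>g\<in>A. \<theta> < blinfun_apply g x)"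
proof -
  have "\<exists>x\<in>cball 0 (norm \<Phi> + 1). \<forall>g\<in>A. \<theta> < blinfun_apply g x"
  proof (rule finite_minimax[OF A(1)])
    show "convex (cball (0::'v) (norm \<Phi> + 1))" by (rule convex_cball)
    show "cball (0::'v) (norm \<Phi> + 1) \<noteq> {}" using norm_ge_zero[of \<Phi>] by (simp add: not_less add_nonneg_nonneg)
    fix g assume g: "g \<in> convex hull A"
    have "convex {g. \<theta> < blinfun_apply \<Phi> g}"
      by (rule convex_superlevel)
    then have "convex hull A \<subseteq> {g. \<theta> < blinfun_apply \<Phi> g}" using A by (intro hull_minimal) auto
    then have \<Phi>g: "\<theta> < \<Phi> g" using g by blast
    show "\<exists>x\<in>cball 0 (norm \<Phi> + 1). \<theta> < g x"
    proof (rule ccontr)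
      assume "\<not> ?thesis"
      then have *: "g x \<le> \<theta>" if "norm x \<le> norm \<Phi> + 1" for x using that by (auto simp: not_less)
      have p: "0 < norm \<Phi> + 1" using norm_ge_zero[of \<Phi>] by linarith
      have "norm g \<le> \<theta> / (norm \<Phi> + 1)"
      proof (rule norm_blinfun_le_of_le)
        show "0 \<le> \<theta> / (norm \<Phi> + 1)" using \<theta> p by simp
        fix x :: 'v
        show "g x \<le> \<theta> / (norm \<Phi> + 1) * norm x"
        proof (cases "x = 0")
          case False
          have "g (((norm \<Phi> + 1) / norm x) *\<^sub>R x) \<le> \<theta>" using False p by (intro *) simp
          then have "(norm \<Phi> + 1) * g x \<le> \<theta> * norm x" using False by (simp add: blinfun.scaleR_right field_simps)
          then show ?thesis using p by (simp add: field_simps)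
        qed simp
      qed
      then have "norm g * (norm \<Phi> + 1) \<le> \<theta>" using p by (simp add: pos_le_divide_eq)
      moreover have "\<Phi> g \<le> norm \<Phi> * norm g" by (rule apply_le_norm)
      moreover have "norm g * (norm \<Phi> + 1) = norm \<Phi> * norm g + norm g" by (simp add: algebra_simps)
      ultimately show False using \<Phi>g norm_ge_zero[of g] by linarith
    qed
  qed
  then show ?thesis by auto
qed

text \<open>A penalty argument. If \<open>\<Phi> f\<close> never exceeded
  \<open>\<theta> * norm f\<close> plus a penalty for the values on \<open>B\<close>, Hahn-Banach
  would give \<open>L\<close> of norm at most \<open>\<theta>\<close> such that
  \<open>\<Phi> - L\<close> vanishes wherever all points of \<open>B\<close> do. Then
  \<open>\<Phi> - L\<close> is the evaluation at a combination of \<open>B\<close>, which is too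
  close to \<open>\<Phi>\<close>.\<close>

lemma functional_almost_annihilating:
  fixes \<Phi> :: "('v::real_normed_vector \<Rightarrow>\<^sub>L real) \<Rightarrow>\<^sub>L real"
  assumes B: "finite B" and far: "\<And>x. \<theta> < norm (\<Phi> - eval_at x)" and \<theta>: "0 < \<theta>"
  shows "\<exists>f. norm f \<le> 1 \<and> \<theta> < \<Phi> f \<and> (\<forall>x\<in>B. blinfun_apply f x \<le> \<theta> / 4)"
proof -
  \<comment> \<open>Large enough for \<open>c * \<bar>f x\<bar> \<le> \<Phi> f\<close> to force
    \<open>\<bar>f x\<bar> \<le> norm f * (\<theta> / 4)\<close>.\<close>
  define c where "c = 4 * (norm \<Phi> + 1) / \<theta>"
  have c: "0 < c" using \<theta> norm_ge_zero[of \<Phi>] unfolding c_def by (intro divide_pos_pos mult_pos_pos) linarith+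
  have "\<exists>f. \<theta> * norm f + c * (\<Sum>x\<in>B. \<bar>blinfun_apply f x\<bar>) < \<Phi> f"
  proof (rule ccontr)
    assume "\<not> ?thesis"
    then have le: "\<Phi> f - c * (\<Sum>x\<in>B. \<bar>blinfun_apply f x\<bar>) \<le> \<theta> * norm f" for f
      by (simp add: not_less diff_le_eq)
    define K where "K = {(f, s). s \<le> \<Phi> f - c * (\<Sum>x\<in>B. \<bar>blinfun_apply f x\<bar>)}"
    have rc: "real_cone K"
      unfolding real_cone_def
    proof (intro conjI allI impI)
      show "(0, 0) \<in> K" by (simp add: K_def)
      fix f s f' s' assume fs: "(f, s) \<in> K" "(f', s') \<in> K"
      have "(\<Sum>x\<in>B. \<bar>(f + f') x\<bar>) \<le> (\<Sum>x\<in>B. \<bar>f x\<bar>) + (\<Sum>x\<in>B. \<bar>f' x\<bar>)"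
        unfolding sum.distrib[symmetric] by (intro sum_mono) (simp add: blinfun.add_left abs_triangle_ineq)
      then have "c * (\<Sum>x\<in>B. \<bar>(f + f') x\<bar>) \<le> c * ((\<Sum>x\<in>B. \<bar>f x\<bar>) + (\<Sum>x\<in>B. \<bar>f' x\<bar>))"
        using c by (intro mult_left_mono) auto
      with fs show "(f + f', s + s') \<in> K" by (simp add: K_def blinfun.add_right distrib_left)
    next
      fix t :: real and f s assume t: "0 < t" and fs: "(f, s) \<in> K"
      have "(\<Sum>x\<in>B. \<bar>(t *\<^sub>R f) x\<bar>) = t * (\<Sum>x\<in>B. \<bar>f x\<bar>)"
        using t by (simp add: blinfun.scaleR_left abs_mult sum_distrib_left)
      moreover have "t * s \<le> t * (\<Phi> f - c * (\<Sum>x\<in>B. \<bar>f x\<bar>))" using fs t by (simp add: K_def)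
      ultimately show "(t *\<^sub>R f, t * s) \<in> K" by (simp add: K_def blinfun.scaleR_right algebra_simps)
    qed
    have sub: "sublinear (\<lambda>f::'v \<Rightarrow>\<^sub>L real. \<theta> * norm f)"
      unfolding sublinear_def using \<theta> norm_triangle_ineq
      by (auto simp: distrib_left[symmetric] intro!: mult_left_mono)
    have leK: "s \<le> \<theta> * norm f" if "(f, s) \<in> K" for f s using that le[of f] by (simp add: K_def)
    obtain L :: "('v \<Rightarrow>\<^sub>L real) \<Rightarrow>\<^sub>L real" where L: "\<And>f. L f \<le> \<theta> * norm f" "\<And>f s. (f, s) \<in> K \<Longrightarrow> s \<le> L f"
      by (rule hahn_banach_bounded[OF sub order_refl rc leK]) blast+
    have diff: "(\<Phi> - L) f \<le> c * (\<Sum>x\<in>B. \<bar>f x\<bar>)" for f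
      using L(2)[of f "\<Phi> f - c * (\<Sum>x\<in>B. \<bar>f x\<bar>)"] by (simp add: K_def blinfun.diff_left)
    have "\<exists>a. \<Phi> - L = (\<Sum>x\<in>B. a x *\<^sub>R eval_at x)"
    proof (rule functional_in_span[OF B])
      fix f :: "'v \<Rightarrow>\<^sub>L real" assume "\<And>x. x \<in> B \<Longrightarrow> eval_at x f = 0"
      then have z: "(\<Sum>x\<in>B. \<bar>f x\<bar>) = 0" "(\<Sum>x\<in>B. \<bar>(- f) x\<bar>) = 0" by (simp_all add: blinfun.minus_left)
      show "(\<Phi> - L) f = 0" using diff[of f] diff[of "- f"] z by (simp add: blinfun.minus_right)
    qed
    then obtain a where a: "\<Phi> - L = (\<Sum>x\<in>B. a x *\<^sub>R eval_at x)" by blast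
    have "eval_at (\<Sum>x\<in>B. a x *\<^sub>R x) = (\<Sum>x\<in>B. a x *\<^sub>R eval_at x)"
      by (rule blinfun_eqI) (simp add: blinfun.sum_right blinfun.scaleR_right blinfun.sum_left blinfun.scaleR_left)
    with a have "\<Phi> - eval_at (\<Sum>x\<in>B. a x *\<^sub>R x) = L" by (simp add: algebra_simps)
    moreover have "norm L \<le> \<theta>" by (rule norm_blinfun_le_of_le) (use \<theta> L(1) in auto)
    ultimately show False using far[of "\<Sum>x\<in>B. a x *\<^sub>R x"] by simp
  qed
  then obtain f where f: "\<theta> * norm f + c * (\<Sum>x\<in>B. \<bar>blinfun_apply f x\<bar>) < \<Phi> f" by blast
  have s0: "0 \<le> c * (\<Sum>x\<in>B. \<bar>f x\<bar>)" using c by (intro mult_nonneg_nonneg sum_nonneg) auto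
  have "f \<noteq> 0" using f by auto
  then have nf: "0 < norm f" by simp
  define g where "g = (1 / norm f) *\<^sub>R f"
  have ng: "norm g \<le> 1" using nf by (simp add: g_def)
  have \<Phi>g: "\<theta> < \<Phi> g"
  proof -
    have "\<theta> * norm f < \<Phi> f" using f s0 by linarith
    then show ?thesis using nf by (simp add: g_def blinfun.scaleR_right pos_less_divide_eq)
  qed
  have "g x \<le> \<theta> / 4" if x: "x \<in> B" for x
  proof -
    have "c * \<bar>f x\<bar> \<le> c * (\<Sum>x\<in>B. \<bar>f x\<bar>)"
      using sum_mono2[OF B, of "{x}" "\<lambda>x. \<bar>f x\<bar>"] x c by (intro mult_left_mono) auto
    moreover have "0 \<le> \<theta> * norm f" using \<theta> by simp
    ultimately have "c * \<bar>f x\<bar> \<le> \<Phi> f" using f by linarith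
    also have "\<dots> \<le> norm \<Phi> * norm f" by (rule apply_le_norm)
    also have "\<dots> \<le> (norm \<Phi> + 1) * norm f" by (intro mult_right_mono) auto
    finally have "\<bar>f x\<bar> \<le> (norm \<Phi> + 1) * norm f / c" using c by (simp add: pos_le_divide_eq mult.commute)
    also have "\<dots> = norm f * (\<theta> / 4)"
    proof -
      have "norm \<Phi> + 1 \<noteq> 0" using norm_ge_zero[of \<Phi>] by linarith
      then show ?thesis using \<theta> by (simp add: c_def field_simps)
    qed
    finally have "f x \<le> norm f * (\<theta> / 4)" by linarith
    then show ?thesis using nf by (simp add: g_def blinfun.scaleR_left field_simps)
  qed
  with ng \<Phi>g show ?thesis by blast
qed

text \<open>James's alternating construction: \<open>f n\<close> is small at the points already
  chosen although \<open>\<Phi>\<close> is large at it, and \<open>x n\<close> then imitates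
  \<open>\<Phi>\<close> on all functionals chosen so far.\<close>

theorem nonreflexive_sequences:
  assumes nr: "\<not> reflexive TYPE('v::banach)"
  obtains \<theta> M :: real and x :: "nat \<Rightarrow> 'v::banach" and f :: "nat \<Rightarrow> 'v \<Rightarrow>\<^sub>L real"
  where "0 < \<theta>" "\<And>k. norm (x k) \<le> M" "\<And>n. norm (f n) \<le> 1"
    "\<And>k n. k < n \<Longrightarrow> f n (x k) \<le> \<theta> / 4" "\<And>k n. n \<le> k \<Longrightarrow> \<theta> \<le> f n (x k)"
proof -
  obtain \<Phi> :: "('v \<Rightarrow>\<^sub>L real) \<Rightarrow>\<^sub>L real" where \<Phi>: "\<And>x. \<exists>f. \<Phi> f \<noteq> blinfun_apply f x"
    using nr unfolding reflexive_def by blast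
  \<comment> \<open>Completeness makes the image of the space closed in the bidual, so
    \<open>\<Phi>\<close> has positive distance from it.\<close>
  have "\<exists>\<theta>>0. \<forall>x. \<theta> < norm (\<Phi> - eval_at x)"
  proof (rule ccontr)
    assume "\<not> ?thesis"
    then have "\<exists>x. norm (\<Phi> - eval_at x) \<le> 1 / real (Suc n)" for n by (force simp: not_less)
    then obtain y where y: "\<And>n. norm (\<Phi> - eval_at (y n)) \<le> 1 / real (Suc n)" by metis
    have lim0: "(\<lambda>n. 1 / real (Suc n)) \<longlonglongrightarrow> 0" by (rule LIMSEQ_Suc[OF lim_1_over_n])
    have "(\<lambda>n. eval_at (y n) - \<Phi>) \<longlonglongrightarrow> 0"
      by (rule Lim_null_comparison[OF _ lim0]) (use y in \<open>simp add: norm_minus_commute\<close>)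
    then have ly: "(\<lambda>n. eval_at (y n)) \<longlonglongrightarrow> \<Phi>" by (rule LIM_zero_cancel)
    then have "Cauchy (\<lambda>n. eval_at (y n))" by (rule LIMSEQ_imp_Cauchy)
    then have "Cauchy y" by (simp add: Cauchy_iff eval_at_diff[symmetric])
    then obtain l where l: "y \<longlonglongrightarrow> l" using Cauchy_convergent convergent_def by blast
    have "\<Phi> f = f l" for f
    proof (rule LIMSEQ_unique)
      show "(\<lambda>n. eval_at (y n) f) \<longlonglongrightarrow> \<Phi> f" by (intro blinfun.tendsto ly tendsto_const)
      show "(\<lambda>n. eval_at (y n) f) \<longlonglongrightarrow> f l" by (simp, intro blinfun.tendsto l tendsto_const)
    qed
    with \<Phi>[of l] show False by simp
  qed
  then obtain \<theta> where \<theta>: "0 < \<theta>" "\<And>x. \<theta> < norm (\<Phi> - eval_at x)" by blast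
  \<comment> \<open>\<open>A\<close> and \<open>B\<close> hold the functionals and points of the
    earlier stages; the current \<open>f\<close> and \<open>x\<close> join them at the next
    stage.\<close>
  define P :: "('v \<Rightarrow>\<^sub>L real) \<times> 'v \<times> ('v \<Rightarrow>\<^sub>L real) set \<times> 'v set \<Rightarrow> bool"
    where "P = (\<lambda>(f, x, A, B). finite A \<and> finite B \<and> (\<forall>g\<in>insert f A. norm g \<le> 1 \<and> \<theta> < \<Phi> g)
      \<and> (\<forall>z\<in>B. f z \<le> \<theta> / 4) \<and> norm x \<le> norm \<Phi> + 1 \<and> (\<forall>g\<in>insert f A. \<theta> < g x))"
  define Q :: "('v \<Rightarrow>\<^sub>L real) \<times> 'v \<times> ('v \<Rightarrow>\<^sub>L real) set \<times> 'v set \<Rightarrow> ('v \<Rightarrow>\<^sub>L real) \<times> 'v \<times> ('v \<Rightarrow>\<^sub>L real) set \<times> 'v set \<Rightarrow> bool"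
    where "Q = (\<lambda>(f, x, A, B) (f', x', A', B'). A' = insert f A \<and> B' = insert x B)"
  have step: "\<exists>f x. P (f, x, A, B)" if AB: "finite A" "finite B" "\<forall>g\<in>A. norm g \<le> 1 \<and> \<theta> < \<Phi> g" for A B
  proof -
    obtain f where f: "norm f \<le> 1" "\<theta> < \<Phi> f" "\<And>z. z \<in> B \<Longrightarrow> f z \<le> \<theta> / 4"
      using functional_almost_annihilating[OF AB(2) \<theta>(2,1)] by blast
    have "finite (insert f A)" "\<And>g. g \<in> insert f A \<Longrightarrow> \<theta> < \<Phi> g" using AB f by auto
    from helly[OF this \<theta>(1)] obtain x where x: "norm x \<le> norm \<Phi> + 1" "\<forall>g\<in>insert f A. \<theta> < blinfun_apply g x" by blast
    have "P (f, x, A, B)" unfolding P_def using AB f x by auto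
    then show ?thesis by blast
  qed
  have "\<exists>S. \<forall>k. P (S k) \<and> Q (S k) (S (Suc k))"
  proof (rule dependent_nat_choice)
    show "\<exists>S. P S" using step[of "{}" "{}"] by auto
  next
    fix S :: "('v \<Rightarrow>\<^sub>L real) \<times> 'v \<times> ('v \<Rightarrow>\<^sub>L real) set \<times> 'v set" and n :: nat assume PS: "P S"
    obtain f x A B where S: "S = (f, x, A, B)" by (cases S) auto
    have "finite (insert f A)" "finite (insert x B)" "\<forall>g\<in>insert f A. norm g \<le> 1 \<and> \<theta> < \<Phi> g"
      using PS by (auto simp: S P_def)
    from step[OF this] obtain f' x' where "P (f', x', insert f A, insert x B)" by blast
    moreover have "Q S (f', x', insert f A, insert x B)" by (simp add: Q_def S)
    ultimately show "\<exists>S'. P S' \<and> Q S S'" by blast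
  qed
  then obtain S where P: "\<And>k. P (S k)" and Q: "\<And>k. Q (S k) (S (Suc k))" by blast
  define f where "f k = fst (S k)" for k
  define x where "x k = fst (snd (S k))" for k
  define A where "A k = fst (snd (snd (S k)))" for k
  define B where "B k = snd (snd (snd (S k)))" for k
  have S: "S k = (f k, x k, A k, B k)" for k by (simp add: f_def x_def A_def B_def)
  have AS: "A (Suc k) = insert (f k) (A k)" and BS: "B (Suc k) = insert (x k) (B k)" for k
    using Q[of k] by (simp_all add: S Q_def)
  have fA: "f n \<in> A k" if "n < k" for n k using that by (induction k) (auto simp: AS less_Suc_eq)
  have xB: "x n \<in> B k" if "n < k" for n k using that by (induction k) (auto simp: BS less_Suc_eq)
  have Pk: "norm (f k) \<le> 1" "\<And>z. z \<in> B k \<Longrightarrow> f k z \<le> \<theta> / 4" "norm (x k) \<le> norm \<Phi> + 1"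
    "\<And>g. g \<in> insert (f k) (A k) \<Longrightarrow> \<theta> < g (x k)" for k
    using P[of k] by (auto simp: S P_def)
  show thesis
  proof (rule that[OF \<theta>(1)])
    show "norm (x k) \<le> norm \<Phi> + 1" for k by (rule Pk)
    show "norm (f n) \<le> 1" for n by (rule Pk)
    show "f n (x k) \<le> \<theta> / 4" if "k < n" for k n using Pk(2)[OF xB[OF that]] .
    show "\<theta> \<le> f n (x k)" if "n \<le> k" for k n
      using Pk(4)[of "f n" k] fA[of n k] that by (cases "n = k") auto
  qed
qed

section \<open>Convex combinations that are Cauchy for a functional\<close>

text \<open>The square \<open>a\<^sup>2 / u\<close> of an element of the order interval \<open>[-u, u]\<close>, as the supremum of its rational
  tangents; this needs no multiplication, and the parallelogram law holds because the substitution
  \<open>(q, r) \<mapsto> ((q + r) / 2, (q - r) / 2)\<close> is a bijection of pairs of rationals.\<close>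

locale order_unit_square =
  fixes u :: "'a::banach_lattice"
  assumes complete: "dedekind_sigma_complete TYPE('a)" and u_nonneg: "0 \<le> u"
begin

definition tangent :: "real \<Rightarrow> 'a \<Rightarrow> 'a" where
  "tangent q a = (2 * q) *\<^sub>R a - (q * q) *\<^sub>R u"

definition sq :: "'a \<Rightarrow> 'a" where
  "sq a = (SOME s. (\<forall>q\<in>\<rat>. tangent q a \<le> s) \<and> (\<forall>b. (\<forall>q\<in>\<rat>. tangent q a \<le> b) \<longrightarrow> s \<le> b))"

lemma tangent_le:
  assumes "labs a \<le> u"
  shows "tangent q a \<le> u"
proof -
  have "(2 * q) *\<^sub>R a \<le> labs ((2 * q) *\<^sub>R a)" by (rule le_labs)
  also have "\<dots> \<le> (2 * \<bar>q\<bar>) *\<^sub>R u" using assms by (simp add: labs_scaleR abs_mult scaleR_left_mono)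
  also have "\<dots> \<le> (1 + q * q) *\<^sub>R u"
  proof (rule scaleR_right_mono)
    have "0 \<le> (1 - \<bar>q\<bar>)^2" by simp
    then show "2 * \<bar>q\<bar> \<le> 1 + q * q" by (simp add: power2_eq_square algebra_simps)
  qed (rule u_nonneg)
  finally show ?thesis by (simp add: tangent_def diff_le_eq scaleR_add_left)
qed

lemma sq_lub:
  assumes "labs a \<le> u"
  shows "q \<in> \<rat> \<Longrightarrow> tangent q a \<le> sq a" "(\<And>q. q \<in> \<rat> \<Longrightarrow> tangent q a \<le> b) \<Longrightarrow> sq a \<le> b"
proof -
  let ?A = "(\<lambda>q. tangent q a) ` \<rat>"
  have "countable ?A \<and> ?A \<noteq> {} \<and> bdd_above ?A"
    using tangent_le[OF assms] countable_rat Rats_0 by (auto intro!: bdd_aboveI2)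
  then obtain s where "\<forall>x\<in>?A. x \<le> s" "\<forall>b. (\<forall>x\<in>?A. x \<le> b) \<longrightarrow> s \<le> b"
    using complete unfolding dedekind_sigma_complete_def by meson
  then have "\<exists>s. (\<forall>q\<in>\<rat>. tangent q a \<le> s) \<and> (\<forall>b. (\<forall>q\<in>\<rat>. tangent q a \<le> b) \<longrightarrow> s \<le> b)" by auto
  from someI_ex[OF this]
  have *: "(\<forall>q\<in>\<rat>. tangent q a \<le> sq a) \<and> (\<forall>b. (\<forall>q\<in>\<rat>. tangent q a \<le> b) \<longrightarrow> sq a \<le> b)"
    unfolding sq_def .
  then show "q \<in> \<rat> \<Longrightarrow> tangent q a \<le> sq a" by blast
  from * show "(\<And>q. q \<in> \<rat> \<Longrightarrow> tangent q a \<le> b) \<Longrightarrow> sq a \<le> b" by blast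
qed

lemma sq_nonneg: "labs a \<le> u \<Longrightarrow> 0 \<le> sq a"
  using sq_lub(1)[of a 0] by (simp add: tangent_def)

lemma sq_le: "labs a \<le> u \<Longrightarrow> sq a \<le> u"
  by (rule sq_lub(2)) (auto intro: tangent_le)

text \<open>A supremum over pairs \<open>(q, r)\<close>, taken as two successive suprema. The factor
  \<open>c\<close> is 1 for one half of the parallelogram law and 2 for the other.\<close>

lemma sq_add_lub:
  assumes a: "labs a \<le> u" and b: "labs b \<le> u" and c: "0 < c"
    and le: "\<And>q r. q \<in> \<rat> \<Longrightarrow> r \<in> \<rat> \<Longrightarrow> c *\<^sub>R (tangent q a + tangent r b) \<le> z"
  shows "c *\<^sub>R (sq a + sq b) \<le> z"
proof -
  have *: "x \<le> inverse c *\<^sub>R z" if "c *\<^sub>R x \<le> z" for x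
    using scaleR_left_mono[OF that, of "inverse c"] c by simp
  have "sq a \<le> inverse c *\<^sub>R z - sq b"
  proof (rule sq_lub(2)[OF a])
    fix q :: real assume q: "q \<in> \<rat>"
    have "sq b \<le> inverse c *\<^sub>R z - tangent q a"
    proof (rule sq_lub(2)[OF b])
      fix r :: real assume "r \<in> \<rat>"
      from *[OF le[OF q this]] show "tangent r b \<le> inverse c *\<^sub>R z - tangent q a"
        by (simp add: le_diff_eq add.commute)
    qed
    then show "tangent q a \<le> inverse c *\<^sub>R z - sq b" by (simp add: le_diff_eq add.commute)
  qed
  then have "sq a + sq b \<le> inverse c *\<^sub>R z" by (simp add: le_diff_eq)
  from scaleR_left_mono[OF this, of c] c show ?thesis by simp
qed

lemma half_mem:
  assumes "labs a \<le> u" "labs b \<le> u"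
  shows "labs ((1/2) *\<^sub>R (a + b)) \<le> u" "labs ((1/2) *\<^sub>R (a - b)) \<le> u"
proof -
  have "labs a + labs b \<le> u + u" by (intro add_mono assms)
  then have *: "(1/2) *\<^sub>R (labs a + labs b) \<le> (1/2) *\<^sub>R (u + u)" by (intro scaleR_left_mono) auto
  have uu: "(1/2) *\<^sub>R (u + u) = u" using scaleR_half_double[of u] by simp
  have "(1/2) *\<^sub>R labs (a + b) \<le> (1/2) *\<^sub>R (labs a + labs b)" by (intro scaleR_left_mono labs_triangle) auto
  also note * also note uu
  finally show "labs ((1/2) *\<^sub>R (a + b)) \<le> u" by (simp add: labs_scaleR)
  have "(1/2) *\<^sub>R labs (a - b) \<le> (1/2) *\<^sub>R (labs a + labs b)" by (intro scaleR_left_mono labs_triangle_diff) auto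
  also note * also note uu
  finally show "labs ((1/2) *\<^sub>R (a - b)) \<le> u" by (simp add: labs_scaleR)
qed

lemma tangent_parallelogram:
  "tangent (s + t) a + tangent (s - t) b
    = 2 *\<^sub>R (tangent s ((1/2) *\<^sub>R (a + b)) + tangent t ((1/2) *\<^sub>R (a - b)))"
proof -
  have "2 *\<^sub>R (tangent s ((1/2) *\<^sub>R (a + b)) + tangent t ((1/2) *\<^sub>R (a - b)))
      = (2 * s) *\<^sub>R (a + b) + (2 * t) *\<^sub>R (a - b) - (2 * (s * s) + 2 * (t * t)) *\<^sub>R u"
    by (simp add: tangent_def scaleR_add_right scaleR_diff_right scaleR_add_left)
  also have "\<dots> = (2 * (s + t)) *\<^sub>R a + (2 * (s - t)) *\<^sub>R b - (2 * (s * s) + 2 * (t * t)) *\<^sub>R u"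
    by (simp add: algebra_simps)
  also have "2 * (s * s) + 2 * (t * t) = (s + t) * (s + t) + (s - t) * (s - t)" by (simp add: algebra_simps)
  finally show ?thesis by (simp add: tangent_def scaleR_add_left)
qed

lemma sq_parallelogram:
  assumes a: "labs a \<le> u" and b: "labs b \<le> u"
  shows "sq a + sq b = 2 *\<^sub>R (sq ((1/2) *\<^sub>R (a + b)) + sq ((1/2) *\<^sub>R (a - b)))"
proof (rule antisym)
  note h = half_mem[OF a b]
  have "1 *\<^sub>R (sq a + sq b) \<le> 2 *\<^sub>R (sq ((1/2) *\<^sub>R (a + b)) + sq ((1/2) *\<^sub>R (a - b)))"
  proof (rule sq_add_lub[OF a b])
    fix q r :: real assume qr: "q \<in> \<rat>" "r \<in> \<rat>"
    have "(q + r) / 2 \<in> \<rat>" "(q - r) / 2 \<in> \<rat>" using qr by (auto intro!: Rats_divide Rats_add Rats_diff)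
    then have "2 *\<^sub>R (tangent ((q + r) / 2) ((1/2) *\<^sub>R (a + b)) + tangent ((q - r) / 2) ((1/2) *\<^sub>R (a - b)))
        \<le> 2 *\<^sub>R (sq ((1/2) *\<^sub>R (a + b)) + sq ((1/2) *\<^sub>R (a - b)))"
      by (intro scaleR_left_mono add_mono sq_lub(1) h) auto
    moreover have "(q + r) / 2 + (q - r) / 2 = q" "(q + r) / 2 - (q - r) / 2 = r" by (simp_all add: field_simps)
    ultimately show "1 *\<^sub>R (tangent q a + tangent r b) \<le> 2 *\<^sub>R (sq ((1/2) *\<^sub>R (a + b)) + sq ((1/2) *\<^sub>R (a - b)))"
      using tangent_parallelogram[of "(q + r) / 2" "(q - r) / 2" a b] by simp
  qed simp
  then show "sq a + sq b \<le> 2 *\<^sub>R (sq ((1/2) *\<^sub>R (a + b)) + sq ((1/2) *\<^sub>R (a - b)))" by simp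
  show "2 *\<^sub>R (sq ((1/2) *\<^sub>R (a + b)) + sq ((1/2) *\<^sub>R (a - b))) \<le> sq a + sq b"
  proof (rule sq_add_lub[OF h])
    fix s t :: real assume "s \<in> \<rat>" "t \<in> \<rat>"
    then show "2 *\<^sub>R (tangent s ((1/2) *\<^sub>R (a + b)) + tangent t ((1/2) *\<^sub>R (a - b))) \<le> sq a + sq b"
      unfolding tangent_parallelogram[symmetric] by (intro add_mono sq_lub(1) a b Rats_add Rats_diff)
  qed simp
qed

lemma labs_le_sq:
  assumes a: "labs a \<le> u" and q: "q \<in> \<rat>" "0 < q"
  shows "(2 * q) *\<^sub>R labs a \<le> sq a + (q * q) *\<^sub>R u"
proof -
  have "(2 * q) *\<^sub>R a \<le> sq a + (q * q) *\<^sub>R u"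
    using sq_lub(1)[OF a q(1)] by (simp add: tangent_def diff_le_eq)
  moreover have "- ((2 * q) *\<^sub>R a) \<le> sq a + (q * q) *\<^sub>R u"
    using sq_lub(1)[OF a, of "- q"] q by (simp add: tangent_def diff_le_eq)
  ultimately have "labs ((2 * q) *\<^sub>R a) \<le> sq a + (q * q) *\<^sub>R u" by (rule labs_leI)
  then show ?thesis using q by (simp add: labs_scaleR)
qed

text \<open>Replaces the Cauchy-Schwarz inequality: the tangents at \<open>1 / n\<close> and
  \<open>- 1 / n\<close> bound \<open>2 / n\<close> times the modulus by \<open>sq a\<close> plus
  \<open>1 / n^2\<close> times \<open>u\<close>, and \<open>n\<close> is free to balance the two
  terms.\<close>

lemma functional_labs_le:
  assumes F: "posf F" and a: "labs a \<le> u" and n: "0 < (n::nat)"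
  shows "F (labs a) \<le> real n * F (sq a) + F u / real n"
proof -
  have "F ((2 * (1 / real n)) *\<^sub>R labs a) \<le> F (sq a + (1 / real n * (1 / real n)) *\<^sub>R u)"
    by (rule posf_mono[OF F labs_le_sq[OF a]]) (use n in auto)
  then have "2 * F (labs a) / real n \<le> F (sq a) + F u / (real n * real n)"
    by (simp add: blinfun.add_right blinfun.scaleR_right)
  then have "real n * (2 * F (labs a) / real n) \<le> real n * (F (sq a) + F u / (real n * real n))"
    by (intro mult_left_mono) auto
  moreover have "real n * (2 * F (labs a) / real n) = 2 * F (labs a)"
    "real n * (F (sq a) + F u / (real n * real n)) = real n * F (sq a) + F u / real n"
    using n by (simp_all add: distrib_left)
  ultimately have "2 * F (labs a) \<le> real n * F (sq a) + F u / real n" by simp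
  moreover have "0 \<le> F (labs a)" by (rule posfD[OF F]) simp
  ultimately show ?thesis by simp
qed

end

text \<open>When \<open>N\<close> is the square of a Hilbert space seminorm, the quantity below is \<open>N ((y m - y k) / 2)\<close>.\<close>

lemma almost_minimizers:
  fixes C :: "nat \<Rightarrow> 'v::real_vector set" and N :: "'v \<Rightarrow> real"
  assumes dec: "\<And>m n. m \<le> n \<Longrightarrow> C n \<subseteq> C m" and cv: "\<And>m. convex (C m)" and ne: "\<And>m. C m \<noteq> {}"
    and N: "\<And>x. x \<in> C 0 \<Longrightarrow> 0 \<le> N x" "\<And>x. x \<in> C 0 \<Longrightarrow> N x \<le> b"
  obtains y where "\<And>m. y m \<in> C m"
    "\<And>e. 0 < e \<Longrightarrow> \<exists>K. \<forall>m\<ge>K. \<forall>k\<ge>K. (N (y m) + N (y k)) / 2 - N ((1/2) *\<^sub>R (y m + y k)) < e"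
proof -
  define i where "i m = Inf (N ` C m)" for m
  have C0: "x \<in> C 0" if "x \<in> C m" for x m using dec[of 0 m] that by auto
  have bdd: "bdd_below (N ` C m)" for m using N(1) C0 by (intro bdd_belowI2[of _ 0]) auto
  have i_le: "i m \<le> N x" if "x \<in> C m" for m x unfolding i_def by (rule cINF_lower[OF bdd that])
  have inc: "incseq i"
    unfolding incseq_def i_def using dec ne bdd by (auto intro!: cInf_superset_mono)
  have ib: "i m \<le> b" for m using ne[of m] i_le N(2) C0 by (meson ex_in_conv order_trans)
  obtain I where I: "i \<longlonglongrightarrow> I" "\<And>m. i m \<le> I" using incseq_convergent[OF inc, of b] ib by blast
  have "\<exists>x\<in>C m. N x < i m + 1 / real (Suc m)" for m
    using cInf_lessD[of "N ` C m" "i m + 1 / real (Suc m)"] ne[of m] by (auto simp: i_def)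
  then obtain y where y: "\<And>m. y m \<in> C m" "\<And>m. N (y m) < i m + 1 / real (Suc m)" by metis
  show thesis
  proof (rule that[of y])
    show "y m \<in> C m" for m by (rule y)
    fix e :: real assume e: "0 < e"
    have "(\<lambda>m. (I - i m) + 1 / real (Suc m)) \<longlonglongrightarrow> (I - I) + 0"
      by (intro tendsto_intros I LIMSEQ_Suc[OF lim_1_over_n])
    then have "\<forall>\<^sub>F m in sequentially. (I - i m) + 1 / real (Suc m) < e"
      by (rule order_tendstoD) (use e in simp)
    then obtain K where K: "\<And>m. K \<le> m \<Longrightarrow> (I - i m) + 1 / real (Suc m) < e" by (auto simp: eventually_sequentially)
    have *: "(N (y m) + N (y k)) / 2 - N ((1/2) *\<^sub>R (y m + y k)) < e" if "K \<le> m" "m \<le> k" for m k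
    proof -
      \<comment> \<open>For \<open>m \<le> k\<close> the midpoint lies in \<open>C m\<close>, so its
        value is at least \<open>i m\<close>, while \<open>N (y m)\<close> and
        \<open>N (y k)\<close> exceed \<open>i m\<close> and \<open>I\<close> by little.\<close>
      have "y k \<in> C m" using dec[OF that(2)] y(1) by blast
      then have "(1/2) *\<^sub>R y m + (1/2) *\<^sub>R y k \<in> C m" by (intro convexD[OF cv] y) auto
      then have "i m \<le> N ((1/2) *\<^sub>R (y m + y k))" by (simp add: i_le scaleR_add_right)
      moreover have "1 / real (Suc k) \<le> 1 / real (Suc m)" using that by (simp add: frac_le)
      moreover define \<rho> where "\<rho> j = 1 / real (Suc j)" for j
      ultimately have "i m \<le> N ((1/2) *\<^sub>R (y m + y k))" "\<rho> k \<le> \<rho> m" "N (y m) < i m + \<rho> m"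
        "N (y k) < i k + \<rho> k" "I - i m + \<rho> m < e"
        using y(2)[of m] y(2)[of k] K[OF that(1)] by auto
      then show ?thesis using I(2)[of k] I(2)[of m] by argo
    qed
    show "\<exists>K. \<forall>m\<ge>K. \<forall>k\<ge>K. (N (y m) + N (y k)) / 2 - N ((1/2) *\<^sub>R (y m + y k)) < e"
    proof (intro exI[of _ K] allI impI)
      fix m k assume "K \<le> m" "K \<le> k"
      then show "(N (y m) + N (y k)) / 2 - N ((1/2) *\<^sub>R (y m + y k)) < e"
        using *[of m k] *[of k m] by (cases "m \<le> k") (simp_all add: add.commute)
    qed
  qed
qed

definition clip :: "'a::banach_lattice \<Rightarrow> 'a \<Rightarrow> 'a" where
  "clip u x = inf (sup x (- u)) u"

lemma labs_clip_le:
  assumes "0 \<le> u"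
  shows "labs (clip u x) \<le> u"
proof (rule labs_leI)
  show "clip u x \<le> u" by (simp add: clip_def)
  have "- u \<le> u" using assms by (metis neg_le_0_iff_le order_trans)
  then have "- u \<le> clip u x" by (simp add: clip_def)
  then show "- clip u x \<le> u" by (simp add: minus_le_iff)
qed

lemma labs_diff_clip_le: "labs (x - clip u x) \<le> pprt (labs x - u)"
proof (rule labs_leI)
  let ?p = "pprt (labs x - u)"
  have p: "x - u \<le> ?p" "- x - u \<le> ?p" "0 \<le> ?p"
    using order_trans[OF diff_right_mono[OF le_labs[of x], of u] le_pprt]
      order_trans[OF diff_right_mono[OF neg_le_labs[of x], of u] le_pprt] by auto
  have "x - ?p \<le> sup x (- u)" using p(3) by (intro le_supI1) (simp add: diff_le_eq)
  moreover have "x - ?p \<le> u" using p(1) by (simp add: diff_le_eq add.commute)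
  ultimately show "x - clip u x \<le> ?p" by (simp add: clip_def diff_le_eq) (metis add.commute diff_le_eq inf_greatest)
  have "sup x (- u) \<le> x + ?p"
  proof (rule sup_least)
    show "x \<le> x + ?p" using p(3) by simp
    have "- u = x + (- x - u)" by simp
    also have "\<dots> \<le> x + ?p" using p(2) by (rule add_left_mono)
    finally show "- u \<le> x + ?p" .
  qed
  then have "clip u x \<le> x + ?p" by (simp add: clip_def le_infI1)
  then show "- (x - clip u x) \<le> ?p" by (simp add: diff_le_eq add.commute)
qed

lemma (in order_unit_square) functional_sq_parallelogram:
  fixes F :: "'a \<Rightarrow>\<^sub>L real"
  assumes "labs a \<le> u" "labs b \<le> u"
  shows "(F (sq a) + F (sq b)) / 2 - F (sq ((1/2) *\<^sub>R (a + b))) = blinfun_apply F (sq ((1/2) *\<^sub>R (a - b)))"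
proof -
  have "F (sq a + sq b) = 2 * (F (sq ((1/2) *\<^sub>R (a + b))) + F (sq ((1/2) *\<^sub>R (a - b))))"
    by (simp only: sq_parallelogram[OF assms] blinfun.scaleR_right blinfun.add_right real_scaleR_def)
  moreover have "s / 2 - p = q" if "s = 2 * (p + q)" for s p q :: real using that by argo
  ultimately show ?thesis unfolding blinfun.add_right by blast
qed

text \<open>The naturals are discrete, so bounded continuous functions on them are just the bounded
  sequences; the type supplies their vector space structure.\<close>

lemma Bcontfun_nat_apply:
  fixes f :: "nat \<Rightarrow> 'a::real_normed_vector"
  assumes "\<And>n. norm (f n) \<le> b"
  shows "apply_bcontfun (Bcontfun f) = f"
  by (rule Bcontfun_inverse, rule bcontfun_normI[OF _ assms]) simp

text \<open>Component 0 of \<open>X i\<close> is \<open>x i\<close>, component \<open>Suc c\<close>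
  its clipping at \<open>u c\<close>. One weighted sum \<open>N\<close> of the quadratic seminorms
  of all clipped components is almost minimised, so a single sequence of combinations serves every
  level.\<close>

lemma functional_clip_Cauchy_blocks:
  fixes x :: "nat \<Rightarrow> 'a::banach_lattice" and F :: "'a \<Rightarrow>\<^sub>L real"
  assumes sc: "dedekind_sigma_complete TYPE('a)" and F: "posf F" and M: "\<And>n. norm (x n) \<le> M"
    and u: "\<And>c::nat. 0 \<le> u c" "\<And>c y. norm y \<le> M \<Longrightarrow> F (pprt (labs y - u c)) \<le> 1 / real (Suc c)"
  obtains Y :: "nat \<Rightarrow> nat \<Rightarrow>\<^sub>C 'a" where "\<And>m. apply_bcontfun (Y m) 0 \<in> convex hull (x ` {m..})"
    "\<And>m c. F (labs (apply_bcontfun (Y m) 0 - apply_bcontfun (Y m) (Suc c))) \<le> 1 / real (Suc c)"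
    "\<And>c e. 0 < e \<Longrightarrow> \<exists>K. \<forall>m\<ge>K. \<forall>k\<ge>K. F (labs (apply_bcontfun (Y m) (Suc c) - apply_bcontfun (Y k) (Suc c))) < e"
proof -
  note bc = plus_bcontfun.rep_eq scaleR_bcontfun.rep_eq minus_bcontfun.rep_eq
  interpret U: order_unit_square "u c" for c by standard (rule sc, rule u)
  define X where "X i = Bcontfun (\<lambda>c. case c of 0 \<Rightarrow> x i | Suc c \<Rightarrow> clip (u c) (x i))" for i
  have bound: "norm (case c of 0 \<Rightarrow> x i | Suc c \<Rightarrow> clip (u c) (x i)) \<le> M + M" for c i
  proof -
    have M0: "0 \<le> M" using M[of 0] norm_ge_zero order_trans by blast
    have "norm (clip v (x i)) \<le> M + M" if v: "0 \<le> v" for v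
    proof -
      have "pprt (labs (x i) - v) \<le> labs (x i)" using v by (simp add: pprt_le_iff diff_le_eq)
      then have "labs (x i - clip v (x i)) \<le> labs (x i)" using labs_diff_clip_le order_trans by blast
      then have "norm (x i - clip v (x i)) \<le> norm (x i)" by (rule norm_mono_labs)
      moreover have "norm (clip v (x i)) \<le> norm (x i) + norm (x i - clip v (x i))"
        using norm_triangle_ineq4[of "x i" "x i - clip v (x i)"] by simp
      ultimately show ?thesis using M[of i] by linarith
    qed
    then show ?thesis using M[of i] M0 u(1) by (cases c) auto
  qed
  have X0: "apply_bcontfun (X i) 0 = x i" and XS: "apply_bcontfun (X i) (Suc c) = clip (u c) (x i)" for i c
    unfolding X_def by (simp_all add: Bcontfun_nat_apply[OF bound])
  define C where "C m = convex hull (X ` {m..})" for m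
  \<comment> \<open>Both conditions are convex and so pass from the \<open>X i\<close> to their
    combinations: component \<open>Suc c\<close> stays in its order interval and close to component
    0, although it is no longer a clipping of it.\<close>
  define D where "D = {Y. \<forall>c. labs (apply_bcontfun Y (Suc c)) \<le> u c
      \<and> F (labs (apply_bcontfun Y 0 - apply_bcontfun Y (Suc c))) \<le> 1 / real (Suc c)}"
  have "convex D"
  proof (rule convexI)
    fix Y Z :: "nat \<Rightarrow>\<^sub>C 'a" and a b :: real assume YZ: "Y \<in> D" "Z \<in> D" and ab: "0 \<le> a" "0 \<le> b" "a + b = 1"
    have tri: "labs (a *\<^sub>R v + b *\<^sub>R w) \<le> a *\<^sub>R labs v + b *\<^sub>R labs w" for v w :: 'a
      using labs_triangle[of "a *\<^sub>R v" "b *\<^sub>R w"] ab by (simp add: labs_scaleR)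
    show "a *\<^sub>R Y + b *\<^sub>R Z \<in> D"
      unfolding D_def
    proof (intro CollectI allI conjI)
      fix c
      have "labs (a *\<^sub>R apply_bcontfun Y (Suc c) + b *\<^sub>R apply_bcontfun Z (Suc c)) \<le> a *\<^sub>R u c + b *\<^sub>R u c"
        using YZ ab by (intro order_trans[OF tri] add_mono scaleR_left_mono) (auto simp: D_def)
      also have "\<dots> = u c" using ab by (simp add: scaleR_add_left[symmetric])
      finally show "labs (apply_bcontfun (a *\<^sub>R Y + b *\<^sub>R Z) (Suc c)) \<le> u c" by (simp add: bc)
      let ?v = "apply_bcontfun Y 0 - apply_bcontfun Y (Suc c)" and ?w = "apply_bcontfun Z 0 - apply_bcontfun Z (Suc c)"
      have "F (labs (a *\<^sub>R ?v + b *\<^sub>R ?w)) \<le> F (a *\<^sub>R labs ?v + b *\<^sub>R labs ?w)" by (rule posf_mono[OF F tri])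
      also have "\<dots> = a * F (labs ?v) + b * F (labs ?w)" by (simp add: blinfun.add_right blinfun.scaleR_right)
      also have "\<dots> \<le> a * (1 / real (Suc c)) + b * (1 / real (Suc c))"
        using YZ ab by (intro add_mono mult_left_mono) (auto simp: D_def)
      also have "\<dots> = 1 / real (Suc c)" using ab by (simp only: distrib_right[symmetric])
      also have "a *\<^sub>R ?v + b *\<^sub>R ?w = apply_bcontfun (a *\<^sub>R Y + b *\<^sub>R Z) 0 - apply_bcontfun (a *\<^sub>R Y + b *\<^sub>R Z) (Suc c)"
        by (simp add: bc algebra_simps)
      finally show "F (labs (apply_bcontfun (a *\<^sub>R Y + b *\<^sub>R Z) 0 - apply_bcontfun (a *\<^sub>R Y + b *\<^sub>R Z) (Suc c))) \<le> 1 / real (Suc c)" .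
    qed
  qed
  moreover have "X i \<in> D" for i
    unfolding D_def using labs_clip_le u posf_mono[OF F labs_diff_clip_le, of "x i"] M[of i] order_trans
    by (simp add: X0 XS) blast
  ultimately have CD: "C m \<subseteq> D" for m unfolding C_def by (intro hull_minimal) auto
  \<comment> \<open>Scaled to values between 0 and 1, so that the weights \<open>(1/2)^c\<close>
    give a sum of at most 2 whatever the size of the \<open>u c\<close>.\<close>
  define nn where "nn c Y = F (U.sq c (apply_bcontfun Y (Suc c))) / (F (u c) + 1)" for c Y
  have den: "0 < F (u c) + 1" for c using posfD[OF F u(1), of c] by simp
  have nn: "0 \<le> nn c Y" "nn c Y \<le> 1" if "labs (apply_bcontfun Y (Suc c)) \<le> u c" for c Y
  proof -
    show "0 \<le> nn c Y" unfolding nn_def using posfD[OF F U.sq_nonneg[OF that]] den[of c] by simp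
    have "F (U.sq c (apply_bcontfun Y (Suc c))) \<le> F (u c) + 1" using posf_mono[OF F U.sq_le[OF that]] by simp
    then show "nn c Y \<le> 1" unfolding nn_def using den[of c] by simp
  qed
  define D' where "D' = {Y. \<forall>c. labs (apply_bcontfun Y (Suc c)) \<le> u c}"
  have DD': "D \<subseteq> D'" by (auto simp: D_def D'_def)
  have geo: "summable (\<lambda>c. (1/2::real)^c)" by (simp add: summable_geometric)
  have sm: "summable (\<lambda>c. (1/2)^c * nn c Y)" if "Y \<in> D'" for Y
  proof (rule summable_comparison_test'[OF geo])
    fix c
    have "0 \<le> nn c Y" "nn c Y \<le> 1" using nn[where c=c and Y=Y] that by (auto simp: D'_def)
    then show "norm ((1/2)^c * nn c Y) \<le> (1/2)^c" by (simp add: abs_mult mult_left_le)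
  qed
  define N where "N Y = (\<Sum>c. (1/2)^c * nn c Y)" for Y
  have N0: "0 \<le> N Y" if "Y \<in> D'" for Y
    unfolding N_def using that by (intro suminf_nonneg[OF sm[OF that]] mult_nonneg_nonneg nn) (auto simp: D'_def)
  have N2: "N Y \<le> 2" if "Y \<in> D'" for Y
  proof -
    have "N Y \<le> (\<Sum>c. (1/2::real)^c)"
      unfolding N_def by (rule suminf_le[OF _ sm[OF that] geo]) (use nn that in \<open>auto simp: D'_def intro!: mult_left_le\<close>)
    also have "\<dots> = 2" using suminf_geometric[of "1/2::real"] by simp
    finally show ?thesis .
  qed
  obtain Y where Y: "\<And>m. Y m \<in> C m"
    and Ydef: "\<And>e. 0 < e \<Longrightarrow> \<exists>K. \<forall>m\<ge>K. \<forall>k\<ge>K. (N (Y m) + N (Y k)) / 2 - N ((1/2) *\<^sub>R (Y m + Y k)) < e"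
  proof (rule almost_minimizers[of C N 2])
    show "C n \<subseteq> C m" if "m \<le> n" for m n unfolding C_def using that by (intro hull_mono image_mono) auto
    show "convex (C m)" for m unfolding C_def by (rule convex_convex_hull)
    show "C m \<noteq> {}" for m unfolding C_def by simp
    show "0 \<le> N Z" "N Z \<le> 2" if "Z \<in> C 0" for Z using that CD DD' N0 N2 by blast+
  qed blast
  have YD: "Y m \<in> D" for m using Y CD by blast
  \<comment> \<open>By the parallelogram law the defect of the midpoint is a sum of nonnegative
    terms, and so bounds each of them.\<close>
  have diff: "(1/2)^c * nn c ((1/2) *\<^sub>R (Y1 - Y2)) \<le> (N Y1 + N Y2) / 2 - N ((1/2) *\<^sub>R (Y1 + Y2))"
    if D: "Y1 \<in> D'" "Y2 \<in> D'" for c Y1 Y2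
  proof -
    have half: "(1/2) *\<^sub>R (Y1 + Y2) \<in> D'" "(1/2) *\<^sub>R (Y1 - Y2) \<in> D'"
      using D U.half_mem by (auto simp: D'_def bc)
    have eq: "((1/2)^j * nn j Y1 + (1/2)^j * nn j Y2) / 2 - (1/2)^j * nn j ((1/2) *\<^sub>R (Y1 + Y2))
        = (1/2)^j * nn j ((1/2) *\<^sub>R (Y1 - Y2))" for j
    proof -
      have "(F (U.sq j (apply_bcontfun Y1 (Suc j))) + F (U.sq j (apply_bcontfun Y2 (Suc j)))) / 2
          - F (U.sq j (apply_bcontfun ((1/2) *\<^sub>R (Y1 + Y2)) (Suc j))) = F (U.sq j (apply_bcontfun ((1/2) *\<^sub>R (Y1 - Y2)) (Suc j)))"
        using U.functional_sq_parallelogram D by (simp add: bc D'_def)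
      moreover have "(p / d + q / d) / 2 - s / d = t / d" if "(p + q) / 2 - s = t" for p q s t d :: real
        unfolding that[symmetric] by (simp add: add_divide_distrib diff_divide_distrib)
      ultimately have "(nn j Y1 + nn j Y2) / 2 - nn j ((1/2) *\<^sub>R (Y1 + Y2)) = nn j ((1/2) *\<^sub>R (Y1 - Y2))"
        unfolding nn_def by blast
      then show ?thesis by (simp only: distrib_left[symmetric] times_divide_eq_right[symmetric] right_diff_distrib[symmetric])
    qed
    have s12: "summable (\<lambda>j. (1/2)^j * nn j Y1 + (1/2)^j * nn j Y2)" by (intro summable_add sm D)
    have "(N Y1 + N Y2) / 2 - N ((1/2) *\<^sub>R (Y1 + Y2)) = (\<Sum>j. (1/2)^j * nn j ((1/2) *\<^sub>R (Y1 - Y2)))"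
      unfolding N_def eq[symmetric] suminf_add[OF sm[OF D(1)] sm[OF D(2)]] suminf_divide[OF s12, symmetric]
      by (rule suminf_diff[OF summable_divide[OF s12] sm[OF half(1)]])
    moreover have "(\<Sum>j\<in>{c}. (1/2)^j * nn j ((1/2) *\<^sub>R (Y1 - Y2))) \<le> (\<Sum>j. (1/2)^j * nn j ((1/2) *\<^sub>R (Y1 - Y2)))"
      using half(2) by (intro sum_le_suminf sm mult_nonneg_nonneg nn) (auto simp: D'_def)
    ultimately show ?thesis by simp
  qed
  show thesis
  proof (rule that[of Y])
    show "apply_bcontfun (Y m) 0 \<in> convex hull (x ` {m..})" for m
    proof -
      have "convex {Y::nat \<Rightarrow>\<^sub>C 'a. apply_bcontfun Y 0 \<in> convex hull (x ` {m..})}"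
        by (rule convexI) (simp add: bc convexD[OF convex_convex_hull])
      then have "C m \<subseteq> {Y. apply_bcontfun Y 0 \<in> convex hull (x ` {m..})}"
        unfolding C_def by (intro hull_minimal) (auto simp: X0 hull_inc)
      with Y show ?thesis by blast
    qed
    show "F (labs (apply_bcontfun (Y m) 0 - apply_bcontfun (Y m) (Suc c))) \<le> 1 / real (Suc c)" for m c
      using YD[of m] unfolding D_def by blast
    fix c and e :: real assume e: "0 < e"
    define b where "b = F (u c) + 1"
    have b: "0 < b" using den by (simp add: b_def)
    \<comment> \<open>First \<open>n\<close> makes \<open>F (u c) / real n\<close> small, then
      \<open>\<eta>\<close> makes \<open>real n * F (U.sq c ?h)\<close> small. Both are below
      \<open>e / 4\<close>, and \<open>?h\<close> is half of the difference to be estimated.\<close>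
    obtain n :: nat where n: "4 * b / e < real n" using reals_Archimedean2 by blast
    have n0: "0 < n"
    proof -
      have "0 < 4 * b / e" using b e by simp
      with n have "0 < real n" by linarith
      then show ?thesis by simp
    qed
    define \<eta> where "\<eta> = (1/2)^c * (e / (4 * real n) / b)"
    have \<eta>: "0 < \<eta>" using e n0 b by (simp add: \<eta>_def)
    obtain K where K: "\<And>m k. K \<le> m \<Longrightarrow> K \<le> k \<Longrightarrow> (N (Y m) + N (Y k)) / 2 - N ((1/2) *\<^sub>R (Y m + Y k)) < \<eta>"
      using Ydef[OF \<eta>] by blast
    have "F (labs (apply_bcontfun (Y m) (Suc c) - apply_bcontfun (Y k) (Suc c))) < e" if mk: "K \<le> m" "K \<le> k" for m k
    proof -
      let ?h = "(1/2) *\<^sub>R (apply_bcontfun (Y m) (Suc c) - apply_bcontfun (Y k) (Suc c))"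
      have h: "labs ?h \<le> u c" using U.half_mem YD by (simp add: D_def)
      have "(1/2)^c * nn c ((1/2) *\<^sub>R (Y m - Y k)) < (1/2)^c * (e / (4 * real n) / b)"
        using diff[of "Y m" "Y k" c] K[OF mk] YD DD' unfolding \<eta>_def by fastforce
      then have "nn c ((1/2) *\<^sub>R (Y m - Y k)) < e / (4 * real n) / b"
        by (subst (asm) mult_less_cancel_left_pos) simp_all
      then have "F (U.sq c ?h) / b < e / (4 * real n) / b" unfolding nn_def b_def[symmetric] by (simp add: bc)
      moreover have "real n * t < e / 4" if "t / b < e / (4 * real n) / b" for t
      proof -
        have "t < s" if "t / b < s / b" for t s using that b by (simp add: divide_less_cancel)
        from this[OF that] show ?thesis using n0 by (simp add: field_simps)
      qed
      ultimately have "real n * F (U.sq c ?h) < e / 4" by blast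
      moreover have "F (u c) / real n < e / 4"
      proof -
        have "F (u c) < b" by (simp add: b_def)
        also have "b < real n * (e / 4)" using n e by (simp add: field_simps)
        finally show ?thesis using n0 by (simp add: field_simps)
      qed
      ultimately have "F (labs ?h) < e / 2" using U.functional_labs_le[OF F h n0] by linarith
      then show ?thesis by (simp add: labs_scaleR blinfun.scaleR_right)
    qed
    then show "\<exists>K. \<forall>m\<ge>K. \<forall>k\<ge>K. F (labs (apply_bcontfun (Y m) (Suc c) - apply_bcontfun (Y k) (Suc c))) < e" by blast
  qed
qed

text \<open>A three-term estimate through component \<open>Suc c\<close>: the level is chosen so
  that component 0 is within \<open>e / 3\<close> of it in every block, and at that fixed level the
  blocks are Cauchy.\<close>

lemma functional_Cauchy_blocks:
  fixes x :: "nat \<Rightarrow> 'a::banach_lattice" and F :: "'a \<Rightarrow>\<^sub>L real"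
  assumes sc: "dedekind_sigma_complete TYPE('a)" and F: "posf F" and M: "\<And>n. norm (x n) \<le> M"
    and ao: "\<And>e. 0 < e \<Longrightarrow> \<exists>u\<ge>0. \<forall>y. norm y \<le> M \<longrightarrow> F (pprt (labs y - u)) \<le> e"
  obtains y where "\<And>m. y m \<in> convex hull (x ` {m..})"
    "\<And>e. 0 < e \<Longrightarrow> \<exists>K. \<forall>m\<ge>K. \<forall>k\<ge>K. F (labs (y m - y k)) < e"
proof -
  have "\<exists>u\<ge>0. \<forall>y. norm y \<le> M \<longrightarrow> F (pprt (labs y - u)) \<le> 1 / real (Suc c)" for c by (rule ao) simp
  then obtain u where u: "\<And>c::nat. 0 \<le> u c" "\<And>c y. norm y \<le> M \<Longrightarrow> F (pprt (labs y - u c)) \<le> 1 / real (Suc c)" by metis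
  obtain Y :: "nat \<Rightarrow> nat \<Rightarrow>\<^sub>C 'a" where Y: "\<And>m. apply_bcontfun (Y m) 0 \<in> convex hull (x ` {m..})"
    "\<And>m c. F (labs (apply_bcontfun (Y m) 0 - apply_bcontfun (Y m) (Suc c))) \<le> 1 / real (Suc c)"
    "\<And>c e. 0 < e \<Longrightarrow> \<exists>K. \<forall>m\<ge>K. \<forall>k\<ge>K. F (labs (apply_bcontfun (Y m) (Suc c) - apply_bcontfun (Y k) (Suc c))) < e"
    by (rule functional_clip_Cauchy_blocks[of F x M u, OF sc F M u]) blast+
  show thesis
  proof (rule that[of "\<lambda>m. apply_bcontfun (Y m) 0"])
    show "apply_bcontfun (Y m) 0 \<in> convex hull (x ` {m..})" for m by (rule Y)
    fix e :: real assume e: "0 < e"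
    obtain c :: nat where c: "1 / real (Suc c) < e / 3" using nat_approx_posE[of "e / 3"] e by auto
    obtain K where K: "\<And>m k. K \<le> m \<Longrightarrow> K \<le> k \<Longrightarrow> F (labs (apply_bcontfun (Y m) (Suc c) - apply_bcontfun (Y k) (Suc c))) < e / 3"
      using Y(3)[of "e / 3" c] e by auto
    have "F (labs (apply_bcontfun (Y m) 0 - apply_bcontfun (Y k) 0)) < e" if mk: "K \<le> m" "K \<le> k" for m k
    proof -
      let ?a = "apply_bcontfun (Y m) 0 - apply_bcontfun (Y m) (Suc c)"
      let ?b = "apply_bcontfun (Y m) (Suc c) - apply_bcontfun (Y k) (Suc c)"
      let ?d = "apply_bcontfun (Y k) 0 - apply_bcontfun (Y k) (Suc c)"
      have "labs (?a + ?b - ?d) \<le> labs ?a + labs ?b + labs ?d"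
        using labs_triangle_diff[of "?a + ?b" ?d] labs_triangle[of ?a ?b] by (meson add_right_mono order_trans)
      moreover have "?a + ?b - ?d = apply_bcontfun (Y m) 0 - apply_bcontfun (Y k) 0" by simp
      ultimately have "labs (apply_bcontfun (Y m) 0 - apply_bcontfun (Y k) 0) \<le> labs ?a + labs ?b + labs ?d" by simp
      from posf_mono[OF F this] have "F (labs (apply_bcontfun (Y m) 0 - apply_bcontfun (Y k) 0))
          \<le> F (labs ?a) + F (labs ?b) + F (labs ?d)"
        by (simp add: blinfun.add_right)
      then show ?thesis using Y(2)[of m c] Y(2)[of k c] K[OF mk] c by linarith
    qed
    then show "\<exists>K. \<forall>m\<ge>K. \<forall>k\<ge>K. F (labs (apply_bcontfun (Y m) 0 - apply_bcontfun (Y k) 0)) < e" by blast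
  qed
qed

section \<open>Limits and the main theorem\<close>

text \<open>Absolute continuity with respect to \<open>F\<close>, in the form that transfers
  convergence: a null set condition together with almost order boundedness on the ball of radius
  \<open>M\<close>, without any inequality between \<open>G\<close> and \<open>F\<close>.\<close>

definition subordinate :: "('a::banach_lattice \<Rightarrow>\<^sub>L real) \<Rightarrow> real \<Rightarrow> ('a \<Rightarrow>\<^sub>L real) \<Rightarrow> bool" where
  "subordinate F M G \<longleftrightarrow> posf G \<and> (\<forall>x. 0 \<le> x \<longrightarrow> F x = 0 \<longrightarrow> G x = 0)
     \<and> (\<forall>e>0. \<exists>u\<ge>0. \<forall>x. norm x \<le> M \<longrightarrow> G (pprt (labs x - u)) \<le> e)"

text \<open>\<open>Z\<close> is the lower limit of the \<open>z n\<close>. The tail infima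
  \<open>\<zeta> N\<close> exist by \<open>oc\<close>; they increase with bounded norm, so
  \<open>kb\<close> gives their limit. Closeness makes the \<open>F (z N - \<zeta> N)\<close>
  summable, and the Borel-Cantelli argument carries this from \<open>F\<close> to every subordinate
  \<open>G\<close>.\<close>

lemma functional_limit_of_positive:
  fixes z :: "nat \<Rightarrow> 'a::banach_lattice" and F :: "'a \<Rightarrow>\<^sub>L real"
  assumes oc: "\<And>X (u::'a). incseq X \<Longrightarrow> (\<And>n. X n \<le> u) \<Longrightarrow> Cauchy X"
    and kb: "\<And>(X :: nat \<Rightarrow> 'a) C. incseq X \<Longrightarrow> (\<And>n. norm (X n) \<le> C) \<Longrightarrow> Cauchy X"
    and F: "posf F" and z: "\<And>n. 0 \<le> z n" "\<And>n. norm (z n) \<le> M"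
    and close: "\<And>n. F (labs (z (Suc n) - z n)) \<le> (1/2)^n"
  obtains Z where "\<And>G. subordinate F M G \<Longrightarrow> (\<lambda>n. blinfun_apply G (labs (z n - Z))) \<longlonglongrightarrow> 0"
proof -
  define m where "m N = rec_nat (z N) (\<lambda>k s. inf s (z (N + Suc k)))" for N
  have m0: "m N 0 = z N" and mS: "m N (Suc k) = inf (m N k) (z (N + Suc k))" for N k
    by (simp_all add: m_def)
  have mpos: "0 \<le> m N k" for N k by (induction k) (auto simp: m0 mS z)
  have dec: "m N (Suc k) \<le> m N k" for N k by (simp add: mS)
  have "Cauchy (\<lambda>k. z N - m N k)" for N
  proof (rule oc)
    show "incseq (\<lambda>k. z N - m N k)" by (rule incseq_SucI) (simp add: dec)
    show "z N - m N k \<le> z N" for k using mpos by simp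
  qed
  then have "\<exists>l. (\<lambda>k. z N - m N k) \<longlonglongrightarrow> l" for N using Cauchy_convergent convergent_def by blast
  then obtain l where l: "\<And>N. (\<lambda>k. z N - m N k) \<longlonglongrightarrow> l N" by metis
  define \<zeta> where "\<zeta> N = z N - l N" for N
  have lim: "m N \<longlonglongrightarrow> \<zeta> N" for N
    using tendsto_diff[OF tendsto_const[of "z N"] l[of N]] by (simp add: \<zeta>_def)
  have \<zeta>0: "0 \<le> \<zeta> N" for N by (rule limit_ge_const[OF lim]) (rule mpos)
  have mz: "m N k \<le> z N" for N k by (induction k) (auto simp: m0 mS intro: le_infI1)
  have \<zeta>z: "\<zeta> N \<le> z N" for N by (rule limit_le_const[OF lim]) (rule mz)
  have shift: "m N (Suc k) \<le> m (Suc N) k" for N k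
    by (induction k) (auto simp: m0 mS intro: le_infI1 le_infI2)
  have "\<zeta> N \<le> \<zeta> (Suc N)" for N
    using LIMSEQ_Suc[OF lim[of N]] by (rule limit_mono[OF _ lim]) (rule shift)
  then have inc: "incseq \<zeta>" by (rule incseq_SucI)
  have "norm (\<zeta> N) \<le> M" for N using norm_mono_nonneg[OF \<zeta>0 \<zeta>z] z(2) order_trans by blast
  then have "Cauchy \<zeta>" by (rule kb[OF inc])
  then obtain Z where Z: "\<zeta> \<longlonglongrightarrow> Z" using Cauchy_convergent convergent_def by blast
  have \<zeta>Z: "\<zeta> N \<le> Z" for N by (rule limit_ge_const[OF Z, of N]) (rule incseqD[OF inc])
  define b where "b N = z N - \<zeta> N" for N
  have b0: "0 \<le> b N" for N using \<zeta>z by (simp add: b_def)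
  have bM: "norm (b N) \<le> M" for N
  proof -
    have "norm (b N) \<le> norm (z N)" using \<zeta>0 by (intro norm_mono_nonneg b0) (simp add: b_def)
    with z(2) show ?thesis using order_trans by blast
  qed
  have step: "z N - z (N + k) \<le> (\<Sum>j<k. labs (z (Suc (N + j)) - z (N + j)))" for N k
  proof (induction k)
    case (Suc k)
    have "z N - z (N + Suc k) = (z N - z (N + k)) + (z (N + k) - z (Suc (N + k)))" by simp
    also have "\<dots> \<le> (\<Sum>j<k. labs (z (Suc (N + j)) - z (N + j))) + labs (z (Suc (N + k)) - z (N + k))"
      using le_labs[of "z (N + k) - z (Suc (N + k))"] Suc by (intro add_mono) (simp_all add: labs_commute)
    finally show ?case by simp
  qed simp
  \<comment> \<open>A tail infimum falls below \<open>z N\<close> by at most the total variation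
    along the tail.\<close>
  have zm: "z N - m N k \<le> (\<Sum>j<k. labs (z (Suc (N + j)) - z (N + j)))" for N k
  proof (induction k)
    case (Suc k)
    have "z N - m N (Suc k) = sup (z N - m N k) (z N - z (N + Suc k))"
      by (simp add: mS diff_inf_eq_sup add_sup_distrib_left)
    also have "\<dots> \<le> (\<Sum>j<Suc k. labs (z (Suc (N + j)) - z (N + j)))"
    proof (rule sup_least)
      show "z N - m N k \<le> (\<Sum>j<Suc k. labs (z (Suc (N + j)) - z (N + j)))"
        using Suc by (simp add: add_increasing2)
      show "z N - z (N + Suc k) \<le> (\<Sum>j<Suc k. labs (z (Suc (N + j)) - z (N + j)))" by (rule step)
    qed
    finally show ?case .
  qed (simp add: m0)
  have Fb: "F (b N) \<le> 2 * (1/2)^N" for N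
  proof (rule LIMSEQ_le_const2)
    show "(\<lambda>k. F (z N - m N k)) \<longlonglongrightarrow> F (b N)"
      unfolding b_def by (intro blinfun.tendsto tendsto_diff tendsto_const lim)
    have "F (z N - m N k) \<le> 2 * (1/2)^N" for k
    proof -
      have "F (z N - m N k) \<le> F (\<Sum>j<k. labs (z (Suc (N + j)) - z (N + j)))" by (rule posf_mono[OF F zm])
      also have "\<dots> \<le> (\<Sum>j<k. (1/2)^(N + j))" unfolding blinfun.sum_right by (intro sum_mono close)
      also have "\<dots> = (1/2)^N * (\<Sum>j<k. (1/2)^j)" by (simp add: power_add sum_distrib_left)
      also have "\<dots> \<le> (1/2)^N * (\<Sum>j. (1/2)^j)"
        by (intro mult_left_mono sum_le_suminf summable_geometric) auto
      also have "\<dots> = 2 * (1/2)^N" using suminf_geometric[of "1/2::real"] by simp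
      finally show ?thesis .
    qed
    then show "\<exists>K. \<forall>k\<ge>K. F (z N - m N k) \<le> 2 * (1/2)^N" by blast
  qed
  show thesis
  proof (rule that[of Z])
    fix G :: "'a \<Rightarrow>\<^sub>L real"
    assume "subordinate F M G"
    then have G: "posf G" and abs: "\<And>x. 0 \<le> x \<Longrightarrow> F x = 0 \<Longrightarrow> G x = 0"
      and ao: "\<And>e. 0 < e \<Longrightarrow> \<exists>u\<ge>0. \<forall>x. norm x \<le> M \<longrightarrow> G (pprt (labs x - u)) \<le> e"
      unfolding subordinate_def by blast+
    have "(\<lambda>N. G (b N)) \<longlonglongrightarrow> 0"
    proof (rule LIMSEQ_I)
      fix e :: real assume e: "0 < e"
      \<comment> \<open>Above \<open>u\<close> the functional \<open>G\<close> is uniformly small;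
        below it, the upper limit \<open>q\<close> of the truncations has \<open>F q = 0\<close> and
        therefore \<open>G q = 0\<close>.\<close>
      obtain u where u: "0 \<le> u" "\<And>x. norm x \<le> M \<Longrightarrow> G (pprt (labs x - u)) \<le> e / 2" using ao[of "e / 2"] e by auto
      define y where "y N = inf (b N) u" for N
      have y: "0 \<le> y N" "y N \<le> u" for N using b0 u(1) by (simp_all add: y_def)
      obtain t q where t: "\<And>N n. N \<le> n \<Longrightarrow> y n \<le> t N" "t \<longlonglongrightarrow> q" "0 \<le> q"
        "\<And>F. posf F \<Longrightarrow> summable (\<lambda>n. blinfun_apply F (y n)) \<Longrightarrow> F q = 0"
        by (rule tail_suprema[of y u, OF oc y]) blast+
      have "summable (\<lambda>n. F (y n))"
      proof (rule summable_comparison_test')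
        show "summable (\<lambda>n. 2 * (1/2::real)^n)" by (intro summable_mult summable_geometric) simp
        have "F (y n) \<le> F (b n)" for n by (rule posf_mono[OF F]) (simp add: y_def)
        then show "norm (F (y n)) \<le> 2 * (1/2)^n" for n
          using Fb[of n] posfD[OF F y(1), of n] order_trans by fastforce
      qed
      then have "F q = 0" by (rule t(4)[OF F])
      then have "G q = 0" by (rule abs[OF t(3)])
      moreover have "(\<lambda>N. G (t N)) \<longlonglongrightarrow> G q" by (intro blinfun.tendsto tendsto_const t)
      ultimately have "\<forall>\<^sub>F N in sequentially. G (t N) < e / 2" using e by (intro order_tendstoD) auto
      then obtain K where K: "\<And>N. K \<le> N \<Longrightarrow> G (t N) < e / 2" by (auto simp: eventually_sequentially)
      have "norm (G (b N) - 0) < e" if "K \<le> N" for N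
      proof -
        have "b N = y N + pprt (labs (b N) - u)"
          using diff_inf_eq_pprt[of "b N" u] b0[of N] by (simp add: y_def algebra_simps)
        then have "G (b N) = G (y N) + G (pprt (labs (b N) - u))" by (metis blinfun.add_right)
        also have "\<dots> < e" using posf_mono[OF G t(1)[OF order_refl], of N] K[OF that] u(2)[OF bM[of N]] by linarith
        finally show ?thesis using posfD[OF G b0, of N] by simp
      qed
      then show "\<exists>K. \<forall>N\<ge>K. norm (G (b N) - 0) < e" by blast
    qed
    moreover have "(\<lambda>N. G (Z - \<zeta> N)) \<longlonglongrightarrow> G (Z - Z)" by (intro blinfun.tendsto tendsto_const tendsto_diff Z)
    ultimately have "(\<lambda>N. G (b N) + G (Z - \<zeta> N)) \<longlonglongrightarrow> 0 + G (Z - Z)" by (rule tendsto_add)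
    then have lim0: "(\<lambda>N. G (b N) + G (Z - \<zeta> N)) \<longlonglongrightarrow> 0" by simp
    have "G (labs (z n - Z)) \<le> G (b n) + G (Z - \<zeta> n)" for n
    proof -
      have "labs (z n - Z) \<le> labs (b n) + labs (Z - \<zeta> n)" using labs_triangle_diff[of "b n" "Z - \<zeta> n"] by (simp add: b_def)
      then have "labs (z n - Z) \<le> b n + (Z - \<zeta> n)" using b0[of n] \<zeta>Z[of n] by simp
      from posf_mono[OF G this] show ?thesis by (simp add: blinfun.add_right)
    qed
    then have "norm (G (labs (z n - Z))) \<le> G (b n) + G (Z - \<zeta> n)" for n
      using posfD[OF G labs_nonneg[of "z n - Z"]] by simp
    then show "(\<lambda>n. G (labs (z n - Z))) \<longlonglongrightarrow> 0" by (intro Lim_null_comparison[OF always_eventually lim0]) blast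
  qed
qed

text \<open>A subsequence with \<open>F\<close>-gaps below \<open>(1/2)^n\<close> is split into
  positive and negative parts, which inherit the gaps; \<open>\<sigma>\<close> is the sign that
  selects the part.\<close>

lemma functional_limit:
  fixes y :: "nat \<Rightarrow> 'a::banach_lattice" and F :: "'a \<Rightarrow>\<^sub>L real"
  assumes oc: "\<And>X (u::'a). incseq X \<Longrightarrow> (\<And>n. X n \<le> u) \<Longrightarrow> Cauchy X"
    and kb: "\<And>(X :: nat \<Rightarrow> 'a) C. incseq X \<Longrightarrow> (\<And>n. norm (X n) \<le> C) \<Longrightarrow> Cauchy X"
    and F: "posf F" and y: "\<And>n. norm (y n) \<le> M"
    and Cau: "\<And>e. 0 < e \<Longrightarrow> \<exists>K. \<forall>m\<ge>K. \<forall>k\<ge>K. F (labs (y m - y k)) < e"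
  obtains r Z where "strict_mono (r :: nat \<Rightarrow> nat)"
    "\<And>G. subordinate F M G \<Longrightarrow> (\<lambda>n. blinfun_apply G (labs (y (r n) - Z))) \<longlonglongrightarrow> 0"
proof -
  have "\<exists>K. \<forall>m\<ge>K. \<forall>k\<ge>K. F (labs (y m - y k)) < (1/2)^n" for n by (rule Cau) simp
  then obtain K where K: "\<And>n m k. K n \<le> m \<Longrightarrow> K n \<le> k \<Longrightarrow> F (labs (y m - y k)) < (1/2)^n" by metis
  have "\<exists>r. \<forall>n. K n \<le> r n \<and> r n < r (Suc n)"
  proof (rule dependent_nat_choice)
    show "\<exists>a. K 0 \<le> a" by blast
    show "\<exists>b. K (Suc n) \<le> b \<and> a < b" for a n by (intro exI[of _ "max (K (Suc n)) (Suc a)"]) auto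
  qed
  then obtain r where r: "\<And>n. K n \<le> r n" "\<And>n. r n < r (Suc n)" by blast
  have close: "F (labs (y (r (Suc n)) - y (r n))) \<le> (1/2)^n" for n
    using K[of n "r (Suc n)" "r n"] r(1)[of n] r(2)[of n] by simp
  have close': "F (labs (pprt (\<sigma> *\<^sub>R y (r (Suc n))) - pprt (\<sigma> *\<^sub>R y (r n)))) \<le> (1/2)^n" if "\<bar>\<sigma>\<bar> = 1" for n \<sigma>
  proof -
    have "labs (pprt (\<sigma> *\<^sub>R y (r (Suc n))) - pprt (\<sigma> *\<^sub>R y (r n))) \<le> labs (\<sigma> *\<^sub>R y (r (Suc n)) - \<sigma> *\<^sub>R y (r n))"
      by (rule pprt_diff_labs)
    also have "\<dots> = labs (y (r (Suc n)) - y (r n))" using that by (simp add: scaleR_diff_right[symmetric] labs_scaleR)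
    finally show ?thesis using posf_mono[OF F] close order_trans by blast
  qed
  have nle: "norm (pprt (\<sigma> *\<^sub>R y (r n))) \<le> M" if "\<bar>\<sigma>\<bar> = 1" for n \<sigma>
    using norm_pprt_le[of "\<sigma> *\<^sub>R y (r n)"] y[of "r n"] that by simp
  have sgn: "\<bar>1::real\<bar> = 1" "\<bar>- 1::real\<bar> = 1" by simp_all
  obtain Z1 where Z1: "\<And>G. subordinate F M G \<Longrightarrow> (\<lambda>n. blinfun_apply G (labs (pprt (1 *\<^sub>R y (r n)) - Z1))) \<longlonglongrightarrow> 0"
    by (rule functional_limit_of_positive[of F "\<lambda>n. pprt (1 *\<^sub>R y (r n))" M, OF oc kb F zero_le_pprt nle[OF sgn(1)] close'[OF sgn(1)]]) blast+
  obtain Z2 where Z2: "\<And>G. subordinate F M G \<Longrightarrow> (\<lambda>n. blinfun_apply G (labs (pprt (- 1 *\<^sub>R y (r n)) - Z2))) \<longlonglongrightarrow> 0"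
    by (rule functional_limit_of_positive[of F "\<lambda>n. pprt (- 1 *\<^sub>R y (r n))" M, OF oc kb F zero_le_pprt nle[OF sgn(2)] close'[OF sgn(2)]]) blast+
  show thesis
  proof (rule that[of r "Z1 - Z2"])
    show "strict_mono r" using r(2) by (simp add: strict_mono_Suc_iff)
    fix G :: "'a \<Rightarrow>\<^sub>L real"
    assume sub: "subordinate F M G"
    then have G: "posf G" unfolding subordinate_def by blast
    let ?a = "\<lambda>n. pprt (1 *\<^sub>R y (r n)) - Z1" and ?b = "\<lambda>n. pprt (- 1 *\<^sub>R y (r n)) - Z2"
    have "(\<lambda>n. G (labs (?a n)) + G (labs (?b n))) \<longlonglongrightarrow> 0 + 0" by (intro tendsto_add Z1[OF sub] Z2[OF sub])
    then have lim0: "(\<lambda>n. G (labs (?a n)) + G (labs (?b n))) \<longlonglongrightarrow> 0" by simp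
    have "norm (G (labs (y (r n) - (Z1 - Z2)))) \<le> G (labs (?a n)) + G (labs (?b n))" for n
    proof -
      have "y (r n) - (Z1 - Z2) = ?a n - ?b n" using pprt_minus_pprt[of "y (r n)"] by (simp add: algebra_simps)
      then have "labs (y (r n) - (Z1 - Z2)) \<le> labs (?a n) + labs (?b n)" by (simp only: labs_triangle_diff)
      from posf_mono[OF G this] show ?thesis
        using posfD[OF G labs_nonneg[of "y (r n) - (Z1 - Z2)"]] by (simp add: blinfun.add_right)
    qed
    then show "(\<lambda>n. G (labs (y (r n) - (Z1 - Z2)))) \<longlonglongrightarrow> 0"
      by (intro Lim_null_comparison[OF always_eventually lim0]) blast
  qed
qed

text \<open>The substance of Ogasawara's theorem: \<open>oc\<close> is the order continuity of the
  norm for sequences, \<open>kb\<close> the KB property, and \<open>ao\<close> a form of the order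
  continuity of the dual norm.\<close>

theorem reflexive_if_KB_and_dual_continuous:
  assumes sc: "dedekind_sigma_complete TYPE('a::banach_lattice)"
    and oc: "\<And>X (u::'a). incseq X \<Longrightarrow> (\<And>n. X n \<le> u) \<Longrightarrow> Cauchy X"
    and kb: "\<And>(X :: nat \<Rightarrow> 'a) C. incseq X \<Longrightarrow> (\<And>n. norm (X n) \<le> C) \<Longrightarrow> Cauchy X"
    and ao: "\<And>(G :: 'a \<Rightarrow>\<^sub>L real) e M. posf G \<Longrightarrow> 0 < e \<Longrightarrow> \<exists>u\<ge>0. \<forall>x. norm x \<le> M \<longrightarrow> G (pprt (labs x - u)) \<le> e"
  shows "reflexive TYPE('a)"
proof (rule ccontr)
  assume "\<not> reflexive TYPE('a)"
  then obtain \<theta> M :: real and x :: "nat \<Rightarrow> 'a" and f :: "nat \<Rightarrow> 'a \<Rightarrow>\<^sub>L real"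
    where \<theta>: "0 < \<theta>" and xM: "\<And>k. norm (x k) \<le> M" and f1: "\<And>n. norm (f n) \<le> 1"
      and f_small: "\<And>k n. k < n \<Longrightarrow> f n (x k) \<le> \<theta> / 4" and f_large: "\<And>k n. n \<le> k \<Longrightarrow> \<theta> \<le> f n (x k)"
    by (rule nonreflexive_sequences) blast
  have "\<exists>g. posf g \<and> norm g \<le> 1 \<and> (\<forall>y. \<bar>f j y\<bar> \<le> blinfun_apply g (labs y))" for j
    using modulus_functional[of "f j"] f1[of j] order_trans by metis
  then obtain h where h: "\<And>j. posf (h j)" "\<And>j. norm (h j) \<le> 1" "\<And>j y. \<bar>f j y\<bar> \<le> blinfun_apply (h j) (labs y)" by metis
  have smF: "summable (\<lambda>j. (1/2)^j *\<^sub>R h j)"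
  proof (rule summable_comparison_test')
    show "summable (\<lambda>j. (1/2::real)^j)" by (simp add: summable_geometric)
    show "norm ((1/2)^j *\<^sub>R h j) \<le> (1/2)^j" for j using h(2)[of j] by (simp add: mult_left_le)
  qed
  \<comment> \<open>Positive weights on all \<open>h j\<close>: where \<open>F\<close> vanishes on
    the cone, every \<open>h j\<close> does.\<close>
  define F where "F = (\<Sum>j. (1/2)^j *\<^sub>R h j)"
  have smFx: "summable (\<lambda>j. (1/2)^j * h j y)" and Fx: "F y = (\<Sum>j. (1/2)^j * h j y)" for y
    using bounded_linear.summable[OF blinfun.bounded_linear_right smF, of "eval_at y"]
      bounded_linear.suminf[OF blinfun.bounded_linear_right smF, of "eval_at y"]
    by (simp_all add: F_def blinfun.scaleR_left)
  have hF: "(1/2)^j * h j y \<le> F y" if "0 \<le> y" for j y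
    unfolding Fx using sum_le_suminf[OF smFx[of y], of "{j}"] posfD[OF h(1) that] by simp
  have F: "posf F" unfolding posf_def
  proof (intro allI impI)
    fix y :: 'a assume y: "0 \<le> y"
    have "0 \<le> (1/2)^0 * h 0 y" using posfD[OF h(1) y] by simp
    then show "0 \<le> F y" using hF[OF y] by (rule order_trans)
  qed
  have F_zero: "h j y = 0" if "0 \<le> y" "F y = 0" for j y
  proof -
    have "(1/2)^j * h j y \<le> 0" using hF[OF that(1), of j] that(2) by simp
    moreover have "0 < (1/2::real)^j" by simp
    ultimately have "h j y \<le> 0" using mult_pos_pos[of "(1/2)^j" "h j y"] by linarith
    with posfD[OF h(1) that(1), of j] show ?thesis by simp
  qed
  obtain y where y: "\<And>m. y m \<in> convex hull (x ` {m..})"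
    and yC: "\<And>e. 0 < e \<Longrightarrow> \<exists>K. \<forall>m\<ge>K. \<forall>k\<ge>K. F (labs (y m - y k)) < e"
    by (rule functional_Cauchy_blocks[of F x M, OF sc F xM ao[OF F]]) blast+
  have yM: "norm (y m) \<le> M" for m
  proof -
    have "convex hull (x ` {m..}) \<subseteq> cball 0 M" by (intro hull_minimal convex_cball) (use xM in auto)
    with y[of m] show ?thesis by auto
  qed
  obtain r Z where r: "strict_mono (r :: nat \<Rightarrow> nat)"
    and Z: "\<And>G. subordinate F M G \<Longrightarrow> (\<lambda>n. blinfun_apply G (labs (y (r n) - Z))) \<longlonglongrightarrow> 0"
    by (rule functional_limit[of F y M, OF oc kb F yM yC]) blast+
  have Zlim: "(\<lambda>n. G (labs (y (r n) - Z))) \<longlonglongrightarrow> 0"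
    if "posf G" "\<And>x. 0 \<le> x \<Longrightarrow> F x = 0 \<Longrightarrow> G x = 0" for G 
    using that ao by (intro Z) (simp add: subordinate_def)
  have fZ: "\<theta> \<le> f j Z" for j
  proof (rule LIMSEQ_le_const)
    have lim0: "(\<lambda>n. h j (labs (y (r n) - Z))) \<longlonglongrightarrow> 0" by (rule Zlim[OF h(1) F_zero])
    have bnd: "norm (f j (y (r n)) - f j Z) \<le> h j (labs (y (r n) - Z))" for n
      using h(3)[of j "y (r n) - Z"] by (simp add: blinfun.diff_right)
    have "(\<lambda>n. f j (y (r n)) - f j Z) \<longlonglongrightarrow> 0"
      by (rule Lim_null_comparison[OF always_eventually lim0]) (intro allI bnd)
    then show "(\<lambda>n. f j (y (r n))) \<longlonglongrightarrow> f j Z" by (rule LIM_zero_cancel)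
    show "\<exists>N. \<forall>n\<ge>N. \<theta> \<le> f j (y (r n))"
    proof (intro exI[of _ j] allI impI)
      fix n assume "j \<le> n"
      then have "j \<le> r n" using seq_suble[OF r, of n] by simp
      have "convex {z. \<theta> \<le> f j z}"
      proof (rule convexI)
        fix a b and s t :: real
        assume "a \<in> {z. \<theta> \<le> f j z}" "b \<in> {z. \<theta> \<le> f j z}" "0 \<le> s" "0 \<le> t" "s + t = 1"
        then have "s * - f j a + t * - f j b \<le> - \<theta>" by (intro convex_bound_le) auto
        then show "s *\<^sub>R a + t *\<^sub>R b \<in> {z. \<theta> \<le> f j z}" by (simp add: blinfun.add_right blinfun.scaleR_right)
      qed
      then have "convex hull (x ` {r n..}) \<subseteq> {z. \<theta> \<le> f j z}"
        by (intro hull_minimal) (use f_large \<open>j \<le> r n\<close> in auto)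
      with y[of "r n"] show "\<theta> \<le> f j (y (r n))" by blast
    qed
  qed
  \<comment> \<open>Closeness in \<open>q\<close> means closeness under all \<open>f j\<close>
    uniformly in \<open>j\<close>, which the final comparison needs because \<open>n\<close> is
    chosen after \<open>z\<close>.\<close>
  define q where "q v = (SUP j. h j (labs v))" for v
  have hle: "h j (labs v) \<le> norm v" for j v
    using apply_le_norm[of "h j" "labs v"] mult_right_mono[OF h(2)[of j] norm_ge_zero[of v]] by simp
  have bdd: "bdd_above (range (\<lambda>j. h j (labs v)))" for v using hle by (intro bdd_aboveI2)
  have up: "h j (labs v) \<le> q v" for j v unfolding q_def by (rule cSUP_upper[OF _ bdd]) simp
  have low: "q v \<le> B" if "\<And>j. h j (labs v) \<le> B" for v B unfolding q_def by (rule cSUP_least) (use that in auto)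
  have q: "sublinear q"
  proof (rule sublinearI)
    show "q (a + b) \<le> q a + q b" for a b
    proof (rule low)
      fix j
      have "h j (labs (a + b)) \<le> h j (labs a + labs b)" by (rule posf_mono[OF h(1) labs_triangle])
      also have "\<dots> \<le> q a + q b" by (simp add: blinfun.add_right add_mono up)
      finally show "h j (labs (a + b)) \<le> q a + q b" .
    qed
    show "q 0 = 0" by (simp add: q_def)
    show "q (c *\<^sub>R a) \<le> c * q a" if "0 < c" for c a
      by (rule low) (use that in \<open>simp add: labs_scaleR blinfun.scaleR_right mult_left_mono up\<close>)
  qed
  have qn: "q v \<le> 1 * norm v" for v using low[OF hle] by simp
  have "\<exists>z\<in>convex hull (range (\<lambda>n. y (r n))). q (Z - z) < \<theta> / 2"
  proof (rule ccontr)
    assume "\<not> ?thesis"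
    then have far: "\<theta> / 2 \<le> q (Z - z)" if "z \<in> convex hull (range (\<lambda>n. y (r n)))" for z using that by (auto simp: not_less)
    let ?S = "(\<lambda>z. Z - z) ` (convex hull (range (\<lambda>n. y (r n))))"
    have cS: "convex ?S"
      using convex_translation[OF convex_negations[OF convex_convex_hull[of "range (\<lambda>n. y (r n))"]], of Z]
      by (simp add: image_image)
    have neS: "?S \<noteq> {}" by simp
    have farS: "\<theta> / 2 \<le> q s" if "s \<in> ?S" for s using that far by blast
    obtain L :: "'a \<Rightarrow>\<^sub>L real" where L: "\<And>v. L v \<le> q v" "\<And>s. s \<in> ?S \<Longrightarrow> \<theta> / 2 \<le> L s"
      by (rule mazur_orlicz[OF q qn cS neS farS]) blast+
    obtain G where G: "posf G" "\<And>v. \<bar>L v\<bar> \<le> blinfun_apply G (labs v)"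
      "\<And>x B. 0 \<le> x \<Longrightarrow> (\<And>y. labs y \<le> x \<Longrightarrow> L y \<le> B) \<Longrightarrow> G x \<le> B"
      by (rule modulus_functional[of L]) blast
    \<comment> \<open>\<open>L\<close> is dominated by \<open>q\<close>, which is at most 0 on the
      order interval of \<open>v\<close>, and the supremum property of the modulus turns this into
      \<open>G v \<le> 0\<close>.\<close>
    have "G v = 0" if v: "0 \<le> v" "F v = 0" for v
    proof -
      have "G v \<le> 0"
      proof (rule G(3)[OF v(1)])
        fix a assume a: "labs a \<le> v"
        have "q a \<le> 0"
        proof (rule low)
          show "h j (labs a) \<le> 0" for j using posf_mono[OF h(1) a, of j] F_zero[OF v, of j] by simp
        qed
        with L(1)[of a] show "L a \<le> 0" by simp
      qed
      with posfD[OF G(1) v(1)] show ?thesis by simp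
    qed
    then have "(\<lambda>n. G (labs (y (r n) - Z))) \<longlonglongrightarrow> 0" by (rule Zlim[OF G(1)])
    moreover have "\<theta> / 2 \<le> G (labs (y (r n) - Z))" for n
    proof -
      have "\<theta> / 2 \<le> L (Z - y (r n))" by (rule L(2)) (simp add: hull_inc)
      also have "\<dots> \<le> G (labs (Z - y (r n)))" using G(2)[of "Z - y (r n)"] by simp
      finally show ?thesis by (simp add: labs_commute)
    qed
    ultimately have "\<theta> / 2 \<le> 0" by (meson LIMSEQ_le_const)
    with \<theta> show False by simp
  qed
  then obtain z where z: "z \<in> convex hull (range (\<lambda>n. y (r n)))" "q (Z - z) < \<theta> / 2" by blast
  \<comment> \<open>The index from which the bound holds depends on the point; the larger of two
    such indices serves for their combinations.\<close>
  define W where "W = {z. \<exists>n. \<forall>m\<ge>n. f m z \<le> \<theta> / 4}"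
  have W: "convex W"
  proof (rule convexI)
    fix a b and s t :: real assume "a \<in> W" "b \<in> W" and st: "0 \<le> s" "0 \<le> t" "s + t = 1"
    then obtain n n' where n: "\<And>m. n \<le> m \<Longrightarrow> f m a \<le> \<theta> / 4" "\<And>m. n' \<le> m \<Longrightarrow> f m b \<le> \<theta> / 4" by (auto simp: W_def)
    have "f m (s *\<^sub>R a + t *\<^sub>R b) \<le> \<theta> / 4" if "max n n' \<le> m" for m
      using convex_bound_le[of "f m a" "\<theta> / 4" "f m b" s t] n that st by (simp add: blinfun.add_right blinfun.scaleR_right)
    then show "s *\<^sub>R a + t *\<^sub>R b \<in> W" unfolding W_def by blast
  qed
  have "x k \<in> W" for k unfolding W_def using f_small[of k] by (intro CollectI exI[of _ "Suc k"]) auto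
  then have "convex hull (x ` {m..}) \<subseteq> W" for m by (intro hull_minimal W) auto
  then have "convex hull (range (\<lambda>n. y (r n))) \<subseteq> W" using y by (intro hull_minimal W) blast
  then obtain n where n: "f n z \<le> \<theta> / 4" using z(1) by (auto simp: W_def)
  \<comment> \<open>The choice of constants closes here: \<open>\<theta>\<close> would be below
    \<open>\<theta> / 4 + \<theta> / 2\<close>.\<close>
  have "\<theta> \<le> f n z + f n (Z - z)" using fZ[of n] by (simp add: blinfun.diff_right)
  also have "\<dots> \<le> \<theta> / 4 + q (Z - z)" using n h(3)[of n "Z - z"] up[of n "Z - z"] by linarith
  finally show False using z(2) \<theta> by linarith
qed

theorem theorem4p1:
  assumes "dedekind_sigma_complete TYPE('a::banach_lattice)"
  shows "reflexive TYPE('a) \<longleftrightarrow>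
           (\<forall>T :: 'a \<Rightarrow>\<^sub>L 'a. positive_op T \<and> weak_DP T \<longrightarrow> uaw_DP T)"
proof
  assume "reflexive TYPE('a)"
  then show "\<forall>T :: 'a \<Rightarrow>\<^sub>L 'a. positive_op T \<and> weak_DP T \<longrightarrow> uaw_DP T"
    using reflexive_imp_uaw_DP by blast
next
  assume "\<forall>T :: 'a \<Rightarrow>\<^sub>L 'a. positive_op T \<and> weak_DP T \<longrightarrow> uaw_DP T"
  then have H: "uaw_DP T" if "positive_op T" "weak_DP T" for T :: "'a \<Rightarrow>\<^sub>L 'a" using that by blast
  have oc: "Cauchy X" if "incseq X" "\<And>n. X n \<le> u" for X and u :: 'a
    by (rule order_bounded_incseq_Cauchy[OF assms H that])
  have kb: "Cauchy X" if "incseq X" "\<And>n. norm (X n) \<le> C" for X :: "nat \<Rightarrow> 'a" and C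
    by (rule norm_bounded_incseq_Cauchy[OF oc H that])
  show "reflexive TYPE('a)"
  proof (rule reflexive_if_KB_and_dual_continuous[OF assms oc kb])
    fix G :: "'a \<Rightarrow>\<^sub>L real" and e M :: real
    assume G: "posf G" and e: "0 < e"
    show "\<exists>u\<ge>0. \<forall>x. norm x \<le> M \<longrightarrow> G (pprt (labs x - u)) \<le> e"
    proof (rule almost_order_bounded[OF G _ e])
      show "(\<lambda>n. G (v n)) \<longlonglongrightarrow> 0" if "\<And>n. 0 \<le> v n" "\<And>n. norm (v n) \<le> C"
        "\<And>n m. n \<noteq> m \<Longrightarrow> inf (v n) (v m) = 0" for v C
        by (rule disjoint_null_of_rank_one[OF H G that])
    qed
  qed
qed

end
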